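(* Let $\mathcal X$ be a circulant scheme over a finite cyclic group $G$, let $\mathcal X^\star$ be a singular extension of $\mathcal X$, let $\varphi$ be an algebraic automorphism of $\mathcal X$, and let $m\ge 2$. Assume that $\mathcal X$ is $\mathrm{WL}_m$-equivalent to itself with respect to $\varphi$. Then there exists an algebraic automorphism $\varphi^\star$ of $\mathcal X^\star$ that extends $\varphi$ and such that $\mathcal X^\star$ is $\mathrm{WL}_m$-equivalent to itself with respect to $\varphi^\star$.
   Context: Coherent configurations, circulant schemes: a coherent configuration on $\Omega$ is $(\Omega,S)$ with $S$ a partition of $\Omega\times\Omega$ into basis relations such that $1_\Omega$ is a union of basis relations, $S$ is closed under transposition, and the numbers $c^t_{rs}=|\{\gamma:(\alpha,\gamma)\in r,(\gamma,\beta)\in s\}|$ do not depend on $(\alpha,\beta)\in t$. An algebraic automorphism is a permutation $\varphi$ of $S$ preserving all $c^t_{rs}$. For coherent configurations $\mathcal X\le\mathcal Y$ on the same set (every basis relation of $\mathcal X$ is a union of basis relations of $\mathcal Y$), an algebraic automorphism $\psi$ of $\mathcal Y$ extends $\varphi$ if $\psi(s)=\varphi(s)$ for every basis relation $s$ of $\mathcal X$ (with $\psi$ extended to unions). A circulant scheme over a cyclic group $G$ is a coherent configuration $(G,S)$ with $(\alpha,\beta)\in s\Rightarrow(\alpha g,\beta g)\in s$. For $H\le G$, $e(H)$ is the partition into cosets of $H$; $H$ is an $\mathcal X$-group if $e(H)$ is a union of basis relations. For $\mathcal X$-groups $L\le U$, $U/L$ is a section; $\mathrm{Sec}_1(\mathcal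 X)$ is the set of these; $U(\mathfrak S)=U$, $L(\mathfrak S)=L$; the order of $\mathfrak S$ is $|U/L|$. $\mathcal X_{U/L}$ is the scheme on $U/L$ with basis relations $s_{U/L}=\{(\Gamma,\Gamma'):s\cap(\Gamma\times\Gamma')\ne\varnothing\}$ ($s\in S$ meeting $U\times U$); a section is trivial if its basis relations are only the diagonal and its complement. A scheme is regular if each basis relation $s$ satisfies $|\{\beta:(\alpha,\beta)\in s\}|=1$ for all $\alpha$. $\mathfrak S$ is a multiple of $\mathfrak T$ if $L(\mathfrak T)=U(\mathfrak T)\cap L(\mathfrak S)$ and $U(\mathfrak S)=U(\mathfrak T)L(\mathfrak S)$; projective equivalence is the equivalence relation generated by this. For $\mathcal X$-groups $L\le U$, $\mathcal X$ satisfies the $U/L$-condition if for every basis relation $s$ with $s\cap e(U)=\varnothing$ we have $e(L)\cdot s=s\cdot e(L)=s$ (dot = relational composition). A class $C$ of projectively equivalent sections in $\mathrm{Sec}_1(\mathcal X)$ is singular if it contains a trivial section, its sections have order greater than $2$, and it contains sections $L_1/L_0$ and $U_1/U_0$ with $U_1/U_0$ a multiple of $L_1/L_0$ such that (S1) $\mathcal X$ satisfies the $U_0/L_0$- and $U_1/L_1$-conditions and (S2) $\mathcal X_{U_1/L_0}=\mathcal X_{L_1/L_0}\otimes\mathcal X_{U_0/L_0}$ (tensor product with respect to the internal direct decomposition $U_1/L_0=(L_1/L_0)\times(U_0/L_0)$). For $\mathfrak S\in\mathrm{Sec}_1(\mathcal X)$, the $\mathfrak S$-extension of $\mathcal X$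 is the smallest circulant scheme $\mathcal X^\star\ge\mathcal X$ over $G$ such that $(\mathcal X^\star)_{\mathfrak S}$ is regular; it is a singular extension if $\mathfrak S$ belongs to a singular class. $\mathrm{WL}_m$-equivalence: $\mathrm{WL}_m(\mathcal X)$ is the $m$-ary coherent configuration (partition of $G^m$ into color classes) produced by the $m$-dimensional Weisfeiler–Leman algorithm on $\mathcal X$. An algebraic isomorphism $\hat\varphi$ between $m$-ary coherent configurations is a bijection between classes commuting with the coordinate maps $x\mapsto(x_{1^\sigma},\dots,x_{m^\sigma})$, $\sigma:\{1,\dots,m\}\to\{1,\dots,m\}$, and preserving the numbers $n^{X_0}_{X_1,\dots,X_m}=|\{\alpha: x_{i\leftarrow\alpha}\in X_i\ \forall i\}|$ ($x\in X_0$). $\mathcal X$ is $\mathrm{WL}_m$-equivalent to itself with respect to $\varphi$ if there is an algebraic automorphism $\hat\varphi$ of $\mathrm{WL}_m(\mathcal X)$ whose $2$-projection $\{(x_1,x_2):x\in X\}\mapsto\{(x_1,x_2):x\in\hat\varphi(X)\}$ agrees with $\varphi$ on every basis relation of $\mathcal X$. *)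

theory Defs
  imports "HOL-Algebra.Elementary_Groups" "HOL-Library.Disjoint_Sets" "HOL-Library.Multiset"
begin

text \<open>A coherent configuration is given by its point set \<open>\<Omega>\<close> and its set \<open>S\<close> of basis relations.\<close>

definition union_of_basis :: "('a \<times> 'a) set set \<Rightarrow> ('a \<times> 'a) set \<Rightarrow> bool" where
  "union_of_basis S r \<longleftrightarrow> (\<exists>T \<subseteq> S. r = \<Union>T)"

definition coherent_configuration :: "'a set \<Rightarrow> ('a \<times> 'a) set set \<Rightarrow> bool" where
  "coherent_configuration \<Omega> S \<longleftrightarrow>
     partition_on (\<Omega> \<times> \<Omega>) S \<and>
     union_of_basis S (Id_on \<Omega>) \<and>
     (\<forall>s\<in>S. s\<inverse> \<in> S) \<and>
     (\<forall>r\<in>S. \<forall>s\<in>S. \<forall>t\<in>S. \<exists>c. \<forall>(\<alpha>, \<beta>)\<in>t.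
        card {\<gamma> \<in> \<Omega>. (\<alpha>, \<gamma>) \<in> r \<and> (\<gamma>, \<beta>) \<in> s} = c)"

definition intersection_number ::
    "'a set \<Rightarrow> ('a \<times> 'a) set \<Rightarrow> ('a \<times> 'a) set \<Rightarrow> ('a \<times> 'a) set \<Rightarrow> nat" where
  "intersection_number \<Omega> r s t =
     (THE c. \<forall>(\<alpha>, \<beta>)\<in>t. card {\<gamma> \<in> \<Omega>. (\<alpha>, \<gamma>) \<in> r \<and> (\<gamma>, \<beta>) \<in> s} = c)"

definition algebraic_automorphism ::
    "'a set \<Rightarrow> ('a \<times> 'a) set set \<Rightarrow> (('a \<times> 'a) set \<Rightarrow> ('a \<times> 'a) set) \<Rightarrow> bool" where
  "algebraic_automorphism \<Omega> S \<phi> \<longleftrightarrow>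
     bij_betw \<phi> S S \<and>
     (\<forall>r\<in>S. \<forall>s\<in>S. \<forall>t\<in>S.
        intersection_number \<Omega> (\<phi> r) (\<phi> s) (\<phi> t) = intersection_number \<Omega> r s t)"

definition coarser :: "('a \<times> 'a) set set \<Rightarrow> ('a \<times> 'a) set set \<Rightarrow> bool" where
  "coarser S T \<longleftrightarrow> (\<forall>s\<in>S. union_of_basis T s)"

definition extend_to_unions ::
    "('a \<times> 'a) set set \<Rightarrow> (('a \<times> 'a) set \<Rightarrow> ('a \<times> 'a) set) \<Rightarrow> ('a \<times> 'a) set \<Rightarrow> ('a \<times> 'a) set" where
  "extend_to_unions T \<psi> r = \<Union>(\<psi> ` {t \<in> T. t \<subseteq> r})"

definition extends_automorphism ::
    "('a \<times> 'a) set set \<Rightarrow> (('a \<times> 'a) set \<Rightarrow> ('a \<times> 'a) set) \<Rightarrow>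
     ('a \<times> 'a) set set \<Rightarrow> (('a \<times> 'a) set \<Rightarrow> ('a \<times> 'a) set) \<Rightarrow> bool" where
  "extends_automorphism S \<phi> T \<psi> \<longleftrightarrow> (\<forall>s\<in>S. extend_to_unions T \<psi> s = \<phi> s)"

definition regular_scheme :: "'a set \<Rightarrow> ('a \<times> 'a) set set \<Rightarrow> bool" where
  "regular_scheme \<Omega> S \<longleftrightarrow> (\<forall>s\<in>S. \<forall>\<alpha>\<in>\<Omega>. card {\<beta>. (\<alpha>, \<beta>) \<in> s} = 1)"

definition trivial_scheme :: "'a set \<Rightarrow> ('a \<times> 'a) set set \<Rightarrow> bool" where
  "trivial_scheme \<Omega> S \<longleftrightarrow> S \<subseteq> {Id_on \<Omega>, \<Omega> \<times> \<Omega> - Id_on \<Omega>}"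


definition circulant_scheme :: "('a, 'b) monoid_scheme \<Rightarrow> ('a \<times> 'a) set set \<Rightarrow> bool" where
  "circulant_scheme G S \<longleftrightarrow>
     coherent_configuration (carrier G) S \<and>
     (\<forall>s\<in>S. \<forall>(\<alpha>, \<beta>)\<in>s. \<forall>g\<in>carrier G. (\<alpha> \<otimes>\<^bsub>G\<^esub> g, \<beta> \<otimes>\<^bsub>G\<^esub> g) \<in> s)"

definition coset_equiv :: "('a, 'b) monoid_scheme \<Rightarrow> 'a set \<Rightarrow> ('a \<times> 'a) set" where
  "coset_equiv G H = {(x, y) \<in> carrier G \<times> carrier G. H #>\<^bsub>G\<^esub> x = H #>\<^bsub>G\<^esub> y}"

definition scheme_group ::
    "('a, 'b) monoid_scheme \<Rightarrow> ('a \<times> 'a) set set \<Rightarrow> 'a set \<Rightarrow> bool" where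
  "scheme_group G S H \<longleftrightarrow> subgroup H G \<and> union_of_basis S (coset_equiv G H)"

text \<open>A section \<open>U/L\<close> is the pair \<open>(U, L)\<close>; the points of \<open>U/L\<close> are the cosets of \<open>L\<close> in \<open>U\<close>.\<close>

definition sections ::
    "('a, 'b) monoid_scheme \<Rightarrow> ('a \<times> 'a) set set \<Rightarrow> ('a set \<times> 'a set) set" where
  "sections G S = {(U, L). scheme_group G S U \<and> scheme_group G S L \<and> L \<subseteq> U}"

definition section_points :: "('a, 'b) monoid_scheme \<Rightarrow> 'a set \<times> 'a set \<Rightarrow> 'a set set" where
  "section_points G = (\<lambda>(U, L). rcosets\<^bsub>G\<lparr>carrier := U\<rparr>\<^esub> L)"

definition section_scheme ::
    "('a, 'b) monoid_scheme \<Rightarrow> ('a \<times> 'a) set set \<Rightarrow> 'a set \<times> 'a set \<Rightarrow>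
     ('a set \<times> 'a set) set set" where
  "section_scheme G S \<SS> =
     (\<lambda>s. {(\<Gamma>, \<Gamma>') \<in> section_points G \<SS> \<times> section_points G \<SS>. s \<inter> (\<Gamma> \<times> \<Gamma>') \<noteq> {}}) `
       {s \<in> S. s \<inter> (fst \<SS> \<times> fst \<SS>) \<noteq> {}}"

definition section_order :: "('a, 'b) monoid_scheme \<Rightarrow> 'a set \<times> 'a set \<Rightarrow> nat" where
  "section_order G \<SS> = card (section_points G \<SS>)"

definition trivial_section ::
    "('a, 'b) monoid_scheme \<Rightarrow> ('a \<times> 'a) set set \<Rightarrow> 'a set \<times> 'a set \<Rightarrow> bool" where
  "trivial_section G S \<SS> \<longleftrightarrow> trivial_scheme (section_points G \<SS>) (section_scheme G S \<SS>)"

definition multiple_of ::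
    "('a, 'b) monoid_scheme \<Rightarrow> 'a set \<times> 'a set \<Rightarrow> 'a set \<times> 'a set \<Rightarrow> bool" where
  "multiple_of G \<SS> \<TT> \<longleftrightarrow>
     snd \<TT> = fst \<TT> \<inter> snd \<SS> \<and> fst \<SS> = fst \<TT> <#>\<^bsub>G\<^esub> snd \<SS>"

definition projective_equiv ::
    "('a, 'b) monoid_scheme \<Rightarrow> ('a \<times> 'a) set set \<Rightarrow>
     (('a set \<times> 'a set) \<times> ('a set \<times> 'a set)) set" where
  "projective_equiv G S =
     (let R = {(\<SS>, \<TT>) \<in> sections G S \<times> sections G S. multiple_of G \<SS> \<TT>}
      in (R \<union> R\<inverse>)\<^sup>*)"

definition section_condition ::
    "('a, 'b) monoid_scheme \<Rightarrow> ('a \<times> 'a) set set \<Rightarrow> 'a set \<Rightarrow> 'a set \<Rightarrow> bool" where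
  "section_condition G S U L \<longleftrightarrow>
     (\<forall>s\<in>S. s \<inter> coset_equiv G U = {} \<longrightarrow>
        coset_equiv G L O s = s \<and> s O coset_equiv G L = s)"

text \<open>Tensor product of schemes on two factors of an internal direct product of groups of cosets:
  the pair \<open>(\<Gamma>, \<Delta>)\<close> of points is identified with the coset \<open>\<Gamma>\<Delta>\<close>.\<close>

definition internal_tensor ::
    "('a, 'b) monoid_scheme \<Rightarrow> ('a set \<times> 'a set) set set \<Rightarrow> ('a set \<times> 'a set) set set \<Rightarrow>
     ('a set \<times> 'a set) set set" where
  "internal_tensor G S T =
     {{(\<Gamma> <#>\<^bsub>G\<^esub> \<Delta>, \<Gamma>' <#>\<^bsub>G\<^esub> \<Delta>') | \<Gamma> \<Gamma>' \<Delta> \<Delta>'. (\<Gamma>, \<Gamma>') \<in> s \<and> (\<Delta>, \<Delta>') \<in> t} | s t.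
        s \<in> S \<and> t \<in> T}"

definition singular_class ::
    "('a, 'b) monoid_scheme \<Rightarrow> ('a \<times> 'a) set set \<Rightarrow> ('a set \<times> 'a set) set \<Rightarrow> bool" where
  "singular_class G S C \<longleftrightarrow>
     C \<in> sections G S // projective_equiv G S \<and>
     (\<exists>\<SS>\<in>C. trivial_section G S \<SS>) \<and>
     (\<forall>\<SS>\<in>C. section_order G \<SS> > 2) \<and>
     (\<exists>L\<^sub>0 L\<^sub>1 U\<^sub>0 U\<^sub>1.
        (L\<^sub>1, L\<^sub>0) \<in> C \<and> (U\<^sub>1, U\<^sub>0) \<in> C \<and>
        multiple_of G (U\<^sub>1, U\<^sub>0) (L\<^sub>1, L\<^sub>0) \<and>
        section_condition G S U\<^sub>0 L\<^sub>0 \<and> section_condition G S U\<^sub>1 L\<^sub>1 \<and>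
        section_scheme G S (U\<^sub>1, L\<^sub>0) =
          internal_tensor G (section_scheme G S (L\<^sub>1, L\<^sub>0)) (section_scheme G S (U\<^sub>0, L\<^sub>0)))"

definition regularizes_section ::
    "('a, 'b) monoid_scheme \<Rightarrow> ('a \<times> 'a) set set \<Rightarrow> 'a set \<times> 'a set \<Rightarrow>
     ('a \<times> 'a) set set \<Rightarrow> bool" where
  "regularizes_section G S \<SS> T \<longleftrightarrow>
     circulant_scheme G T \<and> coarser S T \<and>
     regular_scheme (section_points G \<SS>) (section_scheme G T \<SS>)"

definition is_section_extension ::
    "('a, 'b) monoid_scheme \<Rightarrow> ('a \<times> 'a) set set \<Rightarrow> 'a set \<times> 'a set \<Rightarrow>
     ('a \<times> 'a) set set \<Rightarrow> bool" where
  "is_section_extension G S \<SS> T \<longleftrightarrow>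
     regularizes_section G S \<SS> T \<and> (\<forall>T'. regularizes_section G S \<SS> T' \<longrightarrow> coarser T T')"

definition singular_extension ::
    "('a, 'b) monoid_scheme \<Rightarrow> ('a \<times> 'a) set set \<Rightarrow> ('a \<times> 'a) set set \<Rightarrow> bool" where
  "singular_extension G S T \<longleftrightarrow>
     (\<exists>C. singular_class G S C \<and> (\<exists>\<SS>\<in>C. is_section_extension G S \<SS> T))"


text \<open>Tuples in \<open>\<Omega>\<^sup>m\<close> are lists of length \<open>m\<close> (coordinates numbered from 0), colorings are
  represented by their equivalence relations on tuples, and \<open>x\<^bsub>i\<leftarrow>\<alpha>\<^esub>\<close> is the list update
  \<open>x[i := \<alpha>]\<close>.\<close>

definition tuples :: "nat \<Rightarrow> 'a set \<Rightarrow> 'a list set" where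
  "tuples m \<Omega> = {x. length x = m \<and> set x \<subseteq> \<Omega>}"

definition WL_initial ::
    "nat \<Rightarrow> 'a set \<Rightarrow> ('a \<times> 'a) set set \<Rightarrow> ('a list \<times> 'a list) set" where
  "WL_initial m \<Omega> S =
     {(x, y) \<in> tuples m \<Omega> \<times> tuples m \<Omega>. \<forall>i<m. \<forall>j<m.
        (x ! i = x ! j \<longleftrightarrow> y ! i = y ! j) \<and>
        (\<forall>s\<in>S. (x ! i, x ! j) \<in> s \<longleftrightarrow> (y ! i, y ! j) \<in> s)}"

definition WL_neighbour_colors ::
    "nat \<Rightarrow> 'a set \<Rightarrow> ('a list \<times> 'a list) set \<Rightarrow> 'a list \<Rightarrow> 'a list set list multiset" where
  "WL_neighbour_colors m \<Omega> E x =
     image_mset (\<lambda>\<alpha>. map (\<lambda>i. E `` {x[i := \<alpha>]}) [0..<m]) (mset_set \<Omega>)"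

definition WL_refine ::
    "nat \<Rightarrow> 'a set \<Rightarrow> ('a list \<times> 'a list) set \<Rightarrow> ('a list \<times> 'a list) set" where
  "WL_refine m \<Omega> E =
     {(x, y) \<in> E. WL_neighbour_colors m \<Omega> E x = WL_neighbour_colors m \<Omega> E y}"

definition WL_stable ::
    "nat \<Rightarrow> 'a set \<Rightarrow> ('a \<times> 'a) set set \<Rightarrow> ('a list \<times> 'a list) set" where
  "WL_stable m \<Omega> S =
     (let E = (\<lambda>k. (WL_refine m \<Omega> ^^ k) (WL_initial m \<Omega> S))
      in E (LEAST k. E (Suc k) = E k))"

definition WL :: "nat \<Rightarrow> 'a set \<Rightarrow> ('a \<times> 'a) set set \<Rightarrow> 'a list set set" where
  "WL m \<Omega> S = tuples m \<Omega> // WL_stable m \<Omega> S"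

definition coordinate_map :: "nat \<Rightarrow> (nat \<Rightarrow> nat) \<Rightarrow> 'a list \<Rightarrow> 'a list" where
  "coordinate_map m \<sigma> x = map (\<lambda>i. x ! \<sigma> i) [0..<m]"

definition mary_intersection_number ::
    "nat \<Rightarrow> 'a set \<Rightarrow> 'a list set list \<Rightarrow> 'a list set \<Rightarrow> nat" where
  "mary_intersection_number m \<Omega> Xs X\<^sub>0 =
     (THE c. \<forall>x\<in>X\<^sub>0. card {\<alpha> \<in> \<Omega>. \<forall>i<m. x[i := \<alpha>] \<in> Xs ! i} = c)"

definition mary_algebraic_automorphism ::
    "nat \<Rightarrow> 'a set \<Rightarrow> 'a list set set \<Rightarrow> ('a list set \<Rightarrow> 'a list set) \<Rightarrow> bool" where
  "mary_algebraic_automorphism m \<Omega> P f \<longleftrightarrow>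
     bij_betw f P P \<and>
     (\<forall>X\<in>P. \<forall>\<sigma> \<in> {..<m} \<rightarrow> {..<m}. f (coordinate_map m \<sigma> ` X) = coordinate_map m \<sigma> ` f X) \<and>
     (\<forall>X\<^sub>0\<in>P. \<forall>Xs. length Xs = m \<and> set Xs \<subseteq> P \<longrightarrow>
        mary_intersection_number m \<Omega> (map f Xs) (f X\<^sub>0) = mary_intersection_number m \<Omega> Xs X\<^sub>0)"

definition proj2 :: "'a list set \<Rightarrow> ('a \<times> 'a) set" where
  "proj2 X = (\<lambda>x. (x ! 0, x ! 1)) ` X"

text \<open>A basis relation \<open>s\<close> is the union of the projections contained in it, so the map induced by
  \<open>f\<close> on projections sends \<open>s\<close> to the union of their images.\<close>

definition WL_self_equivalent ::
    "nat \<Rightarrow> 'a set \<Rightarrow> ('a \<times> 'a) set set \<Rightarrow> (('a \<times> 'a) set \<Rightarrow> ('a \<times> 'a) set) \<Rightarrow> bool" where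
  "WL_self_equivalent m \<Omega> S \<phi> \<longleftrightarrow>
     (\<exists>f. mary_algebraic_automorphism m \<Omega> (WL m \<Omega> S) f \<and>
          (\<forall>s\<in>S. \<phi> s = (\<Union>X \<in> {X \<in> WL m \<Omega> S. proj2 X \<subseteq> s}. proj2 (f X))))"

end

theory Submission
  imports Defs "HOL-Algebra.Multiplicative_Group" "HOL-Combinatorics.Permutations"
begin

text \<open>
  Self-equivalence under the Weisfeiler--Leman algorithm is a bijective pebble game: it amounts to a
  relation \<open>R\<close> between \<open>m\<close>-tuples, compatible with \<open>\<phi>\<close>, such that for \<open>(x, y) \<in> R\<close> some
  permutation \<open>g\<close> of the points satisfies \<open>(x[i := \<alpha>], y[i := g \<alpha>]) \<in> R\<close> for all \<open>i\<close> and \<open>\<alpha>\<close>.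

  The singular extension colors a pair \<open>(a, b)\<close> inside a \<open>U\<^sub>1\<close>-coset additionally by the coset of
  \<open>a b\<^sup>-\<^sup>1\<close> modulo \<open>U\<^sub>0\<close>, and changes nothing else. An algebraic automorphism fixes every
  \<open>\<X>\<close>-group, a subgroup of a cyclic group being determined by its order. Hence \<open>\<phi>\<close> extends by
  keeping the additional color, and the positions of the game for the extension are the pairs
  \<open>(x, y) \<in> R\<close> such that \<open>x\<close> and \<open>y\<close> differ by a constant modulo \<open>U\<^sub>0\<close> on each \<open>U\<^sub>1\<close>-coset.

  The game can still be played because of many automorphisms of \<open>\<X>\<close>: by (S1), (S2) and the
  triviality of \<open>L\<^sub>1/L\<^sub>0\<close>, any two \<open>U\<^sub>0\<close>-cosets in a \<open>U\<^sub>1\<close>-coset can be exchanged by a translation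
  by an element of \<open>L\<^sub>1\<close>, all other points being fixed. Thus the points available for a move are
  equidistributed over the \<open>U\<^sub>0\<close>-cosets that contain no pebble, and a move of the game for \<open>\<X>\<close> can
  be redirected to the prescribed \<open>U\<^sub>0\<close>-coset. With \<open>m = 2\<close> and \<open>\<phi> = id\<close> the same argument shows
  that the refined partition is coherent.
\<close>

section \<open>Bijective games and the stable coloring\<close>

text \<open>The classes of the m-dimensional algorithm on the extension are never computed. A game
  transports the stable coloring along itself, so one nonempty compatible game closed under
  coordinate maps already determines an algebraic automorphism of the m-ary configuration. The
  obstacle is that the answering permutation supplied by the game for the scheme ignores the cosets
  of \<open>U0\<close>. It can only be rearranged among points that are acceptable answers to the
  same moves, so these points have to form blocks. This is why the relation \<open>R\<close> is kept
  difunctional (it comes from a bijection between classes), and why its saturation under the stable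
  coloring is recorded, which lets automorphisms of the scheme act on either side of a position.
  That the refined scheme is the extension for whatever section of the singular class was chosen
  rests on regularity of a section being invariant under projective equivalence.\<close>

definition WL_forth :: "nat \<Rightarrow> 'a set \<Rightarrow> ('a list \<times> 'a list) set \<Rightarrow> bool" where
  "WL_forth m V R \<longleftrightarrow> R \<subseteq> tuples m V \<times> tuples m V \<and>
     (\<forall>(x, y)\<in>R. \<exists>g. bij_betw g V V \<and> (\<forall>\<alpha>\<in>V. \<forall>i<m. (x[i := \<alpha>], y[i := g \<alpha>]) \<in> R))"

text \<open>For \<open>\<phi> = id\<close> and tuples over the point set, this says that
  \<open>R\<close> lies in the initial coloring; a general \<open>\<phi>\<close> translates the
  initial color of \<open>x\<close> into that of \<open>y\<close>.\<close>

definition WL_compatible ::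
    "nat \<Rightarrow> ('a \<times> 'a) set set \<Rightarrow> (('a \<times> 'a) set \<Rightarrow> ('a \<times> 'a) set) \<Rightarrow> ('a list \<times> 'a list) set \<Rightarrow> bool"
  where
  "WL_compatible m S \<phi> R \<longleftrightarrow>
     (\<forall>(x, y)\<in>R. \<forall>i<m. \<forall>j<m. (x ! i = x ! j \<longleftrightarrow> y ! i = y ! j) \<and>
        (\<forall>s\<in>S. (x ! i, x ! j) \<in> s \<longleftrightarrow> (y ! i, y ! j) \<in> \<phi> s))"

lemma tuples_update: "x \<in> tuples m V \<Longrightarrow> \<alpha> \<in> V \<Longrightarrow> x[i := \<alpha>] \<in> tuples m V"
  unfolding tuples_def using set_update_subset_insert by fastforce

lemma tuples_nth: "x \<in> tuples m V \<Longrightarrow> i < m \<Longrightarrow> x ! i \<in> V"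
  unfolding tuples_def by auto

lemma tuples_length: "x \<in> tuples m V \<Longrightarrow> length x = m"
  unfolding tuples_def by auto

lemma finite_tuples: "finite V \<Longrightarrow> finite (tuples m V)"
  unfolding tuples_def using finite_lists_length_eq[of V m] by (simp add: conj_commute)

lemma coordinate_map_length [simp]: "length (coordinate_map m \<sigma> x) = m"
  unfolding coordinate_map_def by simp

lemma coordinate_map_nth [simp]: "i < m \<Longrightarrow> coordinate_map m \<sigma> x ! i = x ! \<sigma> i"
  unfolding coordinate_map_def by simp

lemma coordinate_map_tuples:
  "x \<in> tuples m V \<Longrightarrow> \<sigma> \<in> {..<m} \<rightarrow> {..<m} \<Longrightarrow> coordinate_map m \<sigma> x \<in> tuples m V"
  unfolding tuples_def coordinate_map_def by (auto simp: Pi_iff)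

lemma WL_forth_subset: "WL_forth m V R \<Longrightarrow> (x, y) \<in> R \<Longrightarrow> x \<in> tuples m V \<and> y \<in> tuples m V"
  unfolding WL_forth_def by auto

lemma WL_forthE:
  assumes "WL_forth m V R" "(x, y) \<in> R"
  obtains g where "bij_betw g V V" "\<And>\<alpha> i. \<alpha> \<in> V \<Longrightarrow> i < m \<Longrightarrow> (x[i := \<alpha>], y[i := g \<alpha>]) \<in> R"
  using assms unfolding WL_forth_def by blast

lemma WL_forthI:
  assumes "R \<subseteq> tuples m V \<times> tuples m V"
    and "\<And>x y. (x, y) \<in> R \<Longrightarrow>
       \<exists>g. bij_betw g V V \<and> (\<forall>\<alpha>\<in>V. \<forall>i<m. (x[i := \<alpha>], y[i := g \<alpha>]) \<in> R)"
  shows "WL_forth m V R"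
  using assms unfolding WL_forth_def by blast

lemma WL_compatibleD:
  assumes "WL_compatible m S \<phi> R" "(x, y) \<in> R" "i < m" "j < m"
  shows "x ! i = x ! j \<longleftrightarrow> y ! i = y ! j"
    and "s \<in> S \<Longrightarrow> (x ! i, x ! j) \<in> s \<longleftrightarrow> (y ! i, y ! j) \<in> \<phi> s"
  using assms unfolding WL_compatible_def by blast+

lemma WL_forth_converse:
  assumes "WL_forth m V R"
  shows "WL_forth m V (R\<inverse>)"
proof (rule WL_forthI)
  show "R\<inverse> \<subseteq> tuples m V \<times> tuples m V"
    using assms unfolding WL_forth_def by auto
  fix y x assume "(y, x) \<in> R\<inverse>"
  then have "(x, y) \<in> R" by simp
  then obtain g where g: "bij_betw g V V"
    "\<And>\<alpha> i. \<alpha> \<in> V \<Longrightarrow> i < m \<Longrightarrow> (x[i := \<alpha>], y[i := g \<alpha>]) \<in> R"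
    using WL_forthE[OF assms] by metis
  have "(y[i := \<beta>], x[i := inv_into V g \<beta>]) \<in> R\<inverse>" if "\<beta> \<in> V" "i < m" for \<beta> i
    using g(2)[of "inv_into V g \<beta>" i] that bij_betw_inv_into_right[OF g(1)]
      bij_betw_inv_into[OF g(1)] by (auto simp: bij_betw_apply)
  then show "\<exists>h. bij_betw h V V \<and> (\<forall>\<alpha>\<in>V. \<forall>i<m. (y[i := \<alpha>], x[i := h \<alpha>]) \<in> R\<inverse>)"
    using bij_betw_inv_into[OF g(1)] by blast
qed

text \<open>A single position suffices: its coordinates are overwritten one after the other by those
  of \<open>x\<close>, and each time the game supplies a partner.\<close>

lemma WL_forth_total:
  assumes "WL_forth m V R" "R \<noteq> {}" "x \<in> tuples m V"
  obtains y where "(x, y) \<in> R"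
proof -
  obtain x0 y0 where xy0: "(x0, y0) \<in> R" using assms(2) by auto
  have len: "length x0 = m" "length x = m"
    using WL_forth_subset[OF assms(1) xy0] assms(3) by (auto simp: tuples_length)
  have "n \<le> m \<Longrightarrow> \<exists>y. (take n x @ drop n x0, y) \<in> R" for n
  proof (induction n)
    case 0
    then show ?case using xy0 by auto
  next
    case (Suc n)
    then obtain y where "(take n x @ drop n x0, y) \<in> R" by auto
    then obtain y' where "((take n x @ drop n x0)[n := x ! n], y') \<in> R"
      using WL_forthE[OF assms(1)] tuples_nth[OF assms(3), of n] Suc.prems by (metis Suc_le_lessD)
    moreover have "(take n x @ drop n x0)[n := x ! n] = take (Suc n) x @ drop (Suc n) x0"
      using len Suc.prems
      by (simp add: list_update_append take_Suc_conv_app_nth Cons_nth_drop_Suc[symmetric])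
    ultimately show ?case by auto
  qed
  from this[of m] len that show thesis by auto
qed

lemma WL_forth_surj:
  assumes "WL_forth m V R" "R \<noteq> {}" "y \<in> tuples m V"
  obtains x where "(x, y) \<in> R"
  using WL_forth_total[OF WL_forth_converse[OF assms(1)], of y] assms by auto

section \<open>The stable coloring as the greatest game compatible with the identity\<close>

abbreviation WL_iter where
  "WL_iter m V S k \<equiv> (WL_refine m V ^^ k) (WL_initial m V S)"

lemma equiv_WL_initial: "equiv (tuples m V) (WL_initial m V S)"
proof (rule equivI)
  show "WL_initial m V S \<subseteq> tuples m V \<times> tuples m V" "refl_on (tuples m V) (WL_initial m V S)"
    unfolding WL_initial_def refl_on_def by simp_all blast
  show "sym (WL_initial m V S)" by (rule symI) (simp add: WL_initial_def)
  show "trans (WL_initial m V S)" by (rule transI) (simp add: WL_initial_def)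
qed

lemma equiv_WL_refine:
  assumes "equiv (tuples m V) E"
  shows "equiv (tuples m V) (WL_refine m V E)"
proof (rule equivI)
  show "WL_refine m V E \<subseteq> tuples m V \<times> tuples m V"
    using equiv_type[OF assms] unfolding WL_refine_def by blast
  show "refl_on (tuples m V) (WL_refine m V E)"
    using equivE[OF assms] unfolding WL_refine_def refl_on_def by simp
  show "sym (WL_refine m V E)"
    using assms unfolding WL_refine_def by (auto intro!: symI elim: equivE dest: symD)
  show "trans (WL_refine m V E)"
    using assms unfolding WL_refine_def by (auto intro!: transI elim: equivE dest: transD)
qed

lemma equiv_WL_iter: "equiv (tuples m V) (WL_iter m V S k)"
  by (induction k) (auto intro: equiv_WL_initial equiv_WL_refine)

lemma equiv_mem: "equiv A r \<Longrightarrow> (x, y) \<in> r \<Longrightarrow> x \<in> A \<and> y \<in> A"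
  using equiv_type by blast

text \<open>Two multisets of color vectors indexed by the same finite set are equal exactly when
  some permutation matches them, so one round of refinement is one round of the bijective
  game.\<close>

lemma WL_refine_iff:
  assumes "finite V" "equiv (tuples m V) E"
  shows "(x, y) \<in> WL_refine m V E \<longleftrightarrow> (x, y) \<in> E \<and>
    (\<exists>g. bij_betw g V V \<and> (\<forall>\<alpha>\<in>V. \<forall>i<m. (x[i := \<alpha>], y[i := g \<alpha>]) \<in> E))"
proof (cases "(x, y) \<in> E")
  case True
  then have xy: "x \<in> tuples m V" "y \<in> tuples m V" using equiv_mem[OF assms(2)] by auto
  let ?c = "\<lambda>x \<alpha>. map (\<lambda>i. E `` {x[i := \<alpha>]}) [0..<m]"
  have eq: "?c x \<alpha> = ?c y \<beta> \<longleftrightarrow> (\<forall>i<m. (x[i := \<alpha>], y[i := \<beta>]) \<in> E)" if "\<alpha> \<in> V" "\<beta> \<in> V" for \<alpha> \<beta>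
    unfolding map_eq_conv
    using eq_equiv_class_iff[OF assms(2) tuples_update[OF xy(1) that(1)] tuples_update[OF xy(2) that(2)]]
    by (auto simp: Ball_def)
  have "image_mset (?c x) (mset_set V) = image_mset (?c y) (mset_set V) \<longleftrightarrow>
    (\<exists>g. bij_betw g V V \<and> (\<forall>\<alpha>\<in>V. ?c x \<alpha> = ?c y (g \<alpha>)))" (is "?l \<longleftrightarrow> ?r")
  proof
    assume ?l
    then obtain p where "p permutes V" "\<forall>\<alpha>\<in>V. ?c x \<alpha> = ?c y (p \<alpha>)"
      using image_mset_eq_implies_permutes[OF assms(1)] by blast
    then show ?r using permutes_imp_bij by blast
  next
    assume ?r
    then obtain g where g: "bij_betw g V V" "\<forall>\<alpha>\<in>V. ?c x \<alpha> = ?c y (g \<alpha>)" by blast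
    have "image_mset (?c x) (mset_set V) = image_mset (\<lambda>\<alpha>. ?c y (g \<alpha>)) (mset_set V)"
      using g(2) assms(1) by (intro image_mset_cong) auto
    also have "\<dots> = image_mset (?c y) (image_mset g (mset_set V))" by (simp add: multiset.map_comp o_def)
    also have "image_mset g (mset_set V) = mset_set V"
      using g(1) by (simp add: bij_betw_def image_mset_mset_set)
    finally show ?l .
  qed
  also have "\<dots> \<longleftrightarrow> (\<exists>g. bij_betw g V V \<and> (\<forall>\<alpha>\<in>V. \<forall>i<m. (x[i := \<alpha>], y[i := g \<alpha>]) \<in> E))"
  proof (rule ex_cong1, rule conj_cong[OF refl])
    fix g assume "bij_betw g V V"
    then show "(\<forall>\<alpha>\<in>V. ?c x \<alpha> = ?c y (g \<alpha>)) \<longleftrightarrow> (\<forall>\<alpha>\<in>V. \<forall>i<m. (x[i := \<alpha>], y[i := g \<alpha>]) \<in> E)"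
      by (intro ball_cong[OF refl] eq) (auto simp: bij_betw_apply)
  qed
  finally show ?thesis using True unfolding WL_refine_def WL_neighbour_colors_def by auto
qed (auto simp: WL_refine_def)

lemma WL_stable_iter: obtains k where "WL_stable m V S = WL_iter m V S k"
  unfolding WL_stable_def Let_def by blast

text \<open>The iterates form a decreasing chain of finite relations, so some step is not strict;
  this makes the \<open>LEAST\<close> in the definition of \<open>WL_stable\<close>
  meaningful.\<close>

lemma WL_refine_stable:
  assumes "finite V"
  shows "WL_refine m V (WL_stable m V S) = WL_stable m V S"
proof -
  let ?E = "WL_iter m V S"
  have "\<exists>k. ?E (Suc k) = ?E k"
  proof (rule ccontr)
    assume ne: "\<nexists>k. ?E (Suc k) = ?E k"
    have sub: "?E k \<subseteq> tuples m V \<times> tuples m V" for k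
      using equiv_mem[OF equiv_WL_iter] by fastforce
    have "?E (Suc k) \<subset> ?E k" for k
      using ne unfolding WL_refine_def by auto
    then have lt: "card (?E (Suc k)) < card (?E k)" for k
      using sub finite_tuples[OF assms]
      by (meson finite_SigmaI finite_subset psubset_card_mono)
    \<comment> \<open>Each strict step lowers the cardinality by at least one, which cannot go on
      for more steps than there are pairs.\<close>
    have "card (?E k) + k \<le> card (?E 0)" for k
    proof (induction k)
      case (Suc k)
      then show ?case using lt[of k] by linarith
    qed simp
    from this[of "Suc (card (?E 0))"] show False by simp
  qed
  then have "?E (Suc (LEAST k. ?E (Suc k) = ?E k)) = ?E (LEAST k. ?E (Suc k) = ?E k)"
    by (rule LeastI_ex)
  then show ?thesis unfolding WL_stable_def Let_def by simp
qed

lemma equiv_WL_stable: "equiv (tuples m V) (WL_stable m V S)"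
  by (rule WL_stable_iter[of m V S]) (simp add: equiv_WL_iter)

lemma WL_stable_subset_initial: "WL_stable m V S \<subseteq> WL_initial m V S"
proof -
  have "WL_iter m V S k \<subseteq> WL_initial m V S" for k
    by (induction k) (auto simp: WL_refine_def)
  then show ?thesis by (metis WL_stable_iter)
qed

lemma WL_stable_compatible: "WL_compatible m S id (WL_stable m V S)"
  using WL_stable_subset_initial[of m V S] unfolding WL_compatible_def WL_initial_def by auto

lemma WL_stable_forth:
  assumes "finite V"
  shows "WL_forth m V (WL_stable m V S)"
proof (rule WL_forthI)
  show "WL_stable m V S \<subseteq> tuples m V \<times> tuples m V"
    using equiv_mem[OF equiv_WL_stable] by fastforce
  fix x y assume "(x, y) \<in> WL_stable m V S"
  then show "\<exists>g. bij_betw g V V \<and> (\<forall>\<alpha>\<in>V. \<forall>i<m. (x[i := \<alpha>], y[i := g \<alpha>]) \<in> WL_stable m V S)"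
    using WL_refine_iff[OF assms equiv_WL_stable[of m V S]] WL_refine_stable[OF assms, of m S] by blast
qed

text \<open>Induction on the rounds: an answering permutation for \<open>R\<close> is also one for
  every iterate that contains \<open>R\<close>. Below, tuples are shown to be equivalent by
  exhibiting such a relation.\<close>

lemma WL_stable_greatest:
  assumes "finite V" "WL_forth m V R" "WL_compatible m S id R"
  shows "R \<subseteq> WL_stable m V S"
proof -
  have "R \<subseteq> WL_iter m V S k" for k
  proof (induction k)
    case 0
    have "(x, y) \<in> WL_initial m V S" if "(x, y) \<in> R" for x y
      using WL_compatibleD[OF assms(3) that] WL_forth_subset[OF assms(2) that]
      unfolding WL_initial_def by auto
    then show ?case by auto
  next
    case (Suc k)
    have "(x, y) \<in> WL_refine m V (WL_iter m V S k)" if "(x, y) \<in> R" for x y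
      unfolding WL_refine_iff[OF assms(1) equiv_WL_iter]
      using WL_forthE[OF assms(2) that] Suc that by (metis (no_types, lifting) subsetD)
    then show ?case by auto
  qed
  then show ?thesis by (metis WL_stable_iter)
qed

text \<open>An equivalence of \<open>x\<close> and \<open>x'\<close> is carried to \<open>y\<close>
  and \<open>y'\<close> by going back along \<open>R\<close>, through the refinement, and forth
  along \<open>R\<close>. The initial colorings are compared in one direction only, so that the
  lemma applies to \<open>R\<close> and to its converse alike.\<close>

lemma WL_iter_transfer:
  assumes "finite V" "WL_forth m V R" "(x, y) \<in> R" "(x', y') \<in> R"
    and initial: "\<And>x y x' y'. (x, y) \<in> R \<Longrightarrow> (x', y') \<in> R \<Longrightarrow>
      (x, x') \<in> WL_initial m V S \<Longrightarrow> (y, y') \<in> WL_initial m V S"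
    and "(x, x') \<in> WL_iter m V S k"
  shows "(y, y') \<in> WL_iter m V S k"
  using assms(3,4,6)
proof (induction k arbitrary: x y x' y')
  case 0
  then show ?case using initial by simp
next
  case (Suc k)
  let ?E = "WL_iter m V S k"
  obtain g where g: "bij_betw g V V"
    "\<And>\<alpha> i. \<alpha> \<in> V \<Longrightarrow> i < m \<Longrightarrow> (x[i := \<alpha>], y[i := g \<alpha>]) \<in> R"
    using WL_forthE[OF assms(2) Suc.prems(1)] by metis
  obtain g' where g': "bij_betw g' V V"
    "\<And>\<alpha> i. \<alpha> \<in> V \<Longrightarrow> i < m \<Longrightarrow> (x'[i := \<alpha>], y'[i := g' \<alpha>]) \<in> R"
    using WL_forthE[OF assms(2) Suc.prems(2)] by metis
  have "(x, x') \<in> WL_refine m V ?E" using Suc.prems(3) by simp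
  then obtain h where E: "(x, x') \<in> ?E" and h: "bij_betw h V V"
    "\<And>\<alpha> i. \<alpha> \<in> V \<Longrightarrow> i < m \<Longrightarrow> (x[i := \<alpha>], x'[i := h \<alpha>]) \<in> ?E"
    unfolding WL_refine_iff[OF assms(1) equiv_WL_iter] by blast
  let ?gi = "inv_into V g"
  note gi = bij_betw_inv_into[OF g(1)] bij_betw_inv_into_right[OF g(1)]
  have "(y[i := \<beta>], y'[i := g' (h (?gi \<beta>))]) \<in> ?E" if "\<beta> \<in> V" "i < m" for \<beta> i
  proof -
    have 1: "?gi \<beta> \<in> V" using gi(1) that by (auto simp: bij_betw_apply)
    then have 2: "h (?gi \<beta>) \<in> V" using h(1) by (auto simp: bij_betw_apply)
    show ?thesis
      using Suc.IH[OF g(2)[OF 1 that(2)] g'(2)[OF 2 that(2)] h(2)[OF 1 that(2)]] gi(2)[OF that(1)] by simp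
  qed
  moreover have "bij_betw (\<lambda>\<beta>. g' (h (?gi \<beta>))) V V"
    using bij_betw_trans[OF gi(1) bij_betw_trans[OF h(1) g'(1)]] by (simp add: o_def)
  ultimately have "(y, y') \<in> WL_refine m V ?E"
    unfolding WL_refine_iff[OF assms(1) equiv_WL_iter] using Suc.IH[OF Suc.prems(1,2) E] by blast
  then show ?case by simp
qed

text \<open>Since \<open>\<phi>\<close> permutes the basis relations, equality of initial colors is
  preserved both ways. Hence \<open>R\<close> induces a well-defined injective map on the classes of
  the stable coloring, from which \<open>WL_self_equivalentI\<close> builds its
  automorphism.\<close>

lemma WL_stable_transfer:
  assumes "finite V" "WL_forth m V R" "WL_compatible m S \<phi> R" "bij_betw \<phi> S S"
    and "(x, y) \<in> R" "(x', y') \<in> R"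
  shows "(x, x') \<in> WL_stable m V S \<longleftrightarrow> (y, y') \<in> WL_stable m V S"
proof -
  have initial: "(x, x') \<in> WL_initial m V S \<longleftrightarrow> (y, y') \<in> WL_initial m V S"
    if xy: "(x, y) \<in> R" "(x', y') \<in> R" for x y x' y'
  proof -
    note c = WL_compatibleD[OF assms(3)]
    have "(\<forall>s\<in>S. (x ! i, x ! j) \<in> s \<longleftrightarrow> (x' ! i, x' ! j) \<in> s) \<longleftrightarrow>
      (\<forall>s\<in>S. (y ! i, y ! j) \<in> s \<longleftrightarrow> (y' ! i, y' ! j) \<in> s)" if "i < m" "j < m" for i j
    proof -
      have "(\<forall>s\<in>S. (x ! i, x ! j) \<in> s \<longleftrightarrow> (x' ! i, x' ! j) \<in> s) \<longleftrightarrow>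
        (\<forall>s\<in>S. (y ! i, y ! j) \<in> \<phi> s \<longleftrightarrow> (y' ! i, y' ! j) \<in> \<phi> s)"
        using c(2)[OF xy(1) that] c(2)[OF xy(2) that] by auto
      also have "\<dots> \<longleftrightarrow> (\<forall>s\<in>\<phi> ` S. (y ! i, y ! j) \<in> s \<longleftrightarrow> (y' ! i, y' ! j) \<in> s)" by auto
      also have "\<phi> ` S = S" using assms(4) by (simp add: bij_betw_def)
      finally show ?thesis .
    qed
    moreover have "(x ! i = x ! j \<longleftrightarrow> x' ! i = x' ! j) \<longleftrightarrow> (y ! i = y ! j \<longleftrightarrow> y' ! i = y' ! j)"
      if "i < m" "j < m" for i j
      using c(1)[OF xy(1) that] c(1)[OF xy(2) that] by simp
    ultimately have "(\<forall>i<m. \<forall>j<m. (x ! i = x ! j \<longleftrightarrow> x' ! i = x' ! j) \<and>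
        (\<forall>s\<in>S. (x ! i, x ! j) \<in> s \<longleftrightarrow> (x' ! i, x' ! j) \<in> s)) \<longleftrightarrow>
      (\<forall>i<m. \<forall>j<m. (y ! i = y ! j \<longleftrightarrow> y' ! i = y' ! j) \<and>
        (\<forall>s\<in>S. (y ! i, y ! j) \<in> s \<longleftrightarrow> (y' ! i, y' ! j) \<in> s))"
      by (intro all_cong1 imp_cong) (auto simp only:)
    then show ?thesis
      using WL_forth_subset[OF assms(2) xy(1)] WL_forth_subset[OF assms(2) xy(2)]
      unfolding WL_initial_def by simp
  qed
  obtain k where k: "WL_stable m V S = WL_iter m V S k" by (rule WL_stable_iter)
  show ?thesis
    unfolding k
    using WL_iter_transfer[OF assms(1,2,5,6)] initial
      WL_iter_transfer[OF assms(1) WL_forth_converse[OF assms(2)], of y x y' x'] assms(5,6) by fastforce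
qed

section \<open>Coordinate maps and automorphisms acting on the stable coloring\<close>

lemma coordinate_map_update_inj:
  assumes "length x = m" "inj_on \<sigma> {..<m}" "\<sigma> \<in> {..<m} \<rightarrow> {..<m}" "i < m"
  shows "(coordinate_map m \<sigma> x)[i := \<alpha>] = coordinate_map m \<sigma> (x[\<sigma> i := \<alpha>])"
proof (rule nth_equalityI)
  fix l assume "l < length ((coordinate_map m \<sigma> x)[i := \<alpha>])"
  then have l: "l < m" by simp
  have "\<sigma> i < m" using assms by auto
  then show "(coordinate_map m \<sigma> x)[i := \<alpha>] ! l = coordinate_map m \<sigma> (x[\<sigma> i := \<alpha>]) ! l"
    using assms l inj_onD[OF assms(2), of l i] by (cases "l = i") (auto simp: nth_list_update)
qed simp

lemma coordinate_map_update_free: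
  assumes "length x = m" "j < m" "j \<notin> \<sigma> ` {..<m}"
  shows "(coordinate_map m \<sigma> x)[i := \<alpha>] = coordinate_map m (\<sigma>(i := j)) (x[j := \<alpha>])"
proof (rule nth_equalityI)
  fix l assume "l < length ((coordinate_map m \<sigma> x)[i := \<alpha>])"
  then have l: "l < m" by simp
  then have "\<sigma> l \<noteq> j" using assms(3) by auto
  then show "(coordinate_map m \<sigma> x)[i := \<alpha>] ! l = coordinate_map m (\<sigma>(i := j)) (x[j := \<alpha>]) ! l"
    using l assms by (cases "l = i") (auto simp: nth_list_update)
qed simp

lemma not_inj_on_missing:
  fixes m :: nat
  assumes "\<not> inj_on \<sigma> {..<m}" "\<sigma> \<in> {..<m} \<rightarrow> {..<m}"
  obtains j where "j < m" "j \<notin> \<sigma> ` {..<m}"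
proof -
  have "\<sigma> ` {..<m} \<noteq> {..<m}" using assms(1) eq_card_imp_inj_on[of "{..<m}" \<sigma>] by fastforce
  moreover have "\<sigma> ` {..<m} \<subseteq> {..<m}" using assms(2) by blast
  ultimately obtain j where "j \<in> {..<m}" "j \<notin> \<sigma> ` {..<m}" by blast
  then show thesis using that by simp
qed

text \<open>If \<open>\<sigma>\<close> is not injective, then overwriting a coordinate of the image tuple amounts to
  overwriting a coordinate of \<open>x\<close> which \<open>\<sigma>\<close> does not use; hence \<open>\<sigma>\<close> must be allowed to vary.\<close>

lemma WL_stable_coordinate_map:
  assumes "finite V" "(x, y) \<in> WL_stable m V S" "\<sigma> \<in> {..<m} \<rightarrow> {..<m}"
  shows "(coordinate_map m \<sigma> x, coordinate_map m \<sigma> y) \<in> WL_stable m V S"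
proof -
  let ?E = "WL_stable m V S"
  note forth = WL_stable_forth[OF assms(1), of m S]
  define R where "R = {(coordinate_map m \<sigma> x, coordinate_map m \<sigma> y) | \<sigma> x y.
    \<sigma> \<in> {..<m} \<rightarrow> {..<m} \<and> (x, y) \<in> ?E}"
  have "WL_forth m V R"
  proof (rule WL_forthI)
    show "R \<subseteq> tuples m V \<times> tuples m V"
      unfolding R_def using WL_forth_subset[OF forth] coordinate_map_tuples by fastforce
    fix u v assume "(u, v) \<in> R"
    then obtain \<sigma> x y where u: "u = coordinate_map m \<sigma> x" "v = coordinate_map m \<sigma> y"
      and s: "\<sigma> \<in> {..<m} \<rightarrow> {..<m}" and xy: "(x, y) \<in> ?E" unfolding R_def by blast
    have len: "length x = m" "length y = m" using WL_forth_subset[OF forth xy] by (auto simp: tuples_length)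
    obtain g where g: "bij_betw g V V"
      "\<And>\<alpha> i. \<alpha> \<in> V \<Longrightarrow> i < m \<Longrightarrow> (x[i := \<alpha>], y[i := g \<alpha>]) \<in> ?E"
      using WL_forthE[OF forth xy] by metis
    have "(u[i := \<alpha>], v[i := g \<alpha>]) \<in> R" if "\<alpha> \<in> V" "i < m" for \<alpha> i
    proof (cases "inj_on \<sigma> {..<m}")
      case True
      have "\<sigma> i < m" using s that by auto
      then show ?thesis
        using g(2)[OF that(1)] s unfolding R_def u
        by (auto simp: coordinate_map_update_inj[OF _ True s that(2)] len)
    next
      case False
      then obtain j where j: "j < m" "j \<notin> \<sigma> ` {..<m}" using not_inj_on_missing s by metis
      have "\<sigma>(i := j) \<in> {..<m} \<rightarrow> {..<m}" using s j by auto
      then show ?thesis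
        using g(2)[OF that(1) j(1)] unfolding R_def u
          coordinate_map_update_free[OF len(1) j] coordinate_map_update_free[OF len(2) j] by blast
    qed
    then show "\<exists>g. bij_betw g V V \<and> (\<forall>\<alpha>\<in>V. \<forall>i<m. (u[i := \<alpha>], v[i := g \<alpha>]) \<in> R)"
      using g(1) by blast
  qed
  moreover have "WL_compatible m S id R"
  proof -
    have "(u ! i = u ! j \<longleftrightarrow> v ! i = v ! j) \<and> (\<forall>s\<in>S. (u ! i, u ! j) \<in> s \<longleftrightarrow> (v ! i, v ! j) \<in> id s)"
      if uv: "(u, v) \<in> R" and ij: "i < m" "j < m" for u v i j
    proof -
      obtain \<sigma> x y where u: "u = coordinate_map m \<sigma> x" "v = coordinate_map m \<sigma> y"
        and s: "\<sigma> \<in> {..<m} \<rightarrow> {..<m}" and xy: "(x, y) \<in> ?E" using uv unfolding R_def by blast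
      have "\<sigma> i < m" "\<sigma> j < m" using s ij by auto
      then show ?thesis using WL_compatibleD[OF WL_stable_compatible xy, of "\<sigma> i" "\<sigma> j"] ij unfolding u by simp
    qed
    then show ?thesis unfolding WL_compatible_def by blast
  qed
  ultimately have "R \<subseteq> ?E" by (rule WL_stable_greatest[OF assms(1)])
  then show ?thesis using assms(2,3) unfolding R_def by blast
qed

lemma WL_stable_coordinate_map_lift:
  assumes "finite V" "\<sigma> \<in> {..<m} \<rightarrow> {..<m}" "x \<in> tuples m V"
    and "(coordinate_map m \<sigma> x, z) \<in> WL_stable m V S"
  shows "\<exists>x'. (x, x') \<in> WL_stable m V S \<and> coordinate_map m \<sigma> x' = z"
  using assms(2,4)
proof (induction "m - card (\<sigma> ` {..<m})" arbitrary: \<sigma> z rule: less_induct)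
  case less
  let ?E = "WL_stable m V S"
  note forth = WL_stable_forth[OF assms(1), of m S]
  have z: "z \<in> tuples m V" using WL_forth_subset[OF forth less.prems(2)] by simp
  have lx: "length x = m" using assms(3) by (simp add: tuples_length)
  show ?case
  proof (cases "inj_on \<sigma> {..<m}")
    case True
    then have bij: "bij_betw \<sigma> {..<m} {..<m}"
      using less.prems(1) by (intro bij_betw_imageI endo_inj_surj) auto
    define \<tau> where "\<tau> = inv_into {..<m} \<sigma>"
    have t: "\<tau> \<in> {..<m} \<rightarrow> {..<m}"
      unfolding \<tau>_def using bij_betw_inv_into[OF bij] by (auto simp: bij_betw_def)
    have ts: "\<tau> (\<sigma> i) = i" "\<sigma> (\<tau> i) = i" if "i < m" for i
      unfolding \<tau>_def using that bij_betw_inv_into_left[OF bij] bij_betw_inv_into_right[OF bij] by auto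
    have "coordinate_map m \<tau> (coordinate_map m \<sigma> x) = x"
      using t ts lx by (intro nth_equalityI) (auto simp: Pi_iff)
    moreover have "coordinate_map m \<sigma> (coordinate_map m \<tau> z) = z"
      using less.prems(1) ts z by (intro nth_equalityI) (auto simp: Pi_iff tuples_length)
    ultimately show ?thesis
      using WL_stable_coordinate_map[OF assms(1) less.prems(2) t] by auto
  next
    case False
    then obtain i i' where i: "i < m" "i' < m" "i \<noteq> i'" "\<sigma> i = \<sigma> i'" unfolding inj_on_def by auto
    obtain j where j: "j < m" "j \<notin> \<sigma> ` {..<m}" using not_inj_on_missing[OF False less.prems(1)] by metis
    define \<sigma>' where "\<sigma>' = \<sigma>(i := j)"
    have s': "\<sigma>' \<in> {..<m} \<rightarrow> {..<m}" using less.prems(1) j unfolding \<sigma>'_def by auto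
    have "\<sigma>' ` {..<m} = insert j (\<sigma> ` {..<m})"
    proof
      show "insert j (\<sigma> ` {..<m}) \<subseteq> \<sigma>' ` {..<m}"
      proof
        fix a assume "a \<in> insert j (\<sigma> ` {..<m})"
        then consider "a = j" | l where "l < m" "a = \<sigma> l" by auto
        then show "a \<in> \<sigma>' ` {..<m}"
        proof cases
          case 1
          then show ?thesis using i unfolding \<sigma>'_def by (intro image_eqI[of _ _ i]) auto
        next
          case 2
          \<comment> \<open>Redirecting position \<open>i\<close> loses no value, as
            \<open>i'\<close> still reads the same coordinate.\<close>
          then show ?thesis using i unfolding \<sigma>'_def
            by (intro image_eqI[of _ _ "if l = i then i' else l"]) auto
        qed
      qed
    qed (auto simp: \<sigma>'_def)
    then have "card (\<sigma>' ` {..<m}) = Suc (card (\<sigma> ` {..<m}))" using j by simp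
    moreover have "card (\<sigma>' ` {..<m}) \<le> m" using card_image_le[of "{..<m}" \<sigma>'] by simp
    ultimately have less': "m - card (\<sigma>' ` {..<m}) < m - card (\<sigma> ` {..<m})" by simp
    \<comment> \<open>Position \<open>i\<close> of the image is first changed to what
      \<open>\<sigma>'\<close> reads there; the game answers this change by some point.\<close>
    obtain \<beta> where b: "((coordinate_map m \<sigma> x)[i := x ! j], z[i := \<beta>]) \<in> ?E"
      using WL_forthE[OF forth less.prems(2)] tuples_nth[OF assms(3) j(1)] i(1) by metis
    have "(coordinate_map m \<sigma> x)[i := x ! j] = coordinate_map m \<sigma>' x"
      using coordinate_map_update_free[OF lx j, of i "x ! j"] unfolding \<sigma>'_def by simp
    with b obtain x' where x': "(x, x') \<in> ?E" "coordinate_map m \<sigma>' x' = z[i := \<beta>]"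
      using less.hyps[OF less' s'] by metis
    \<comment> \<open>\<open>coordinate_map m \<sigma> x\<close> repeats an entry at
      \<open>i\<close> and \<open>i'\<close>, and the initial coloring forces the same on
      \<open>z\<close>.\<close>
    have zi: "z ! i = z ! i'"
      using WL_compatibleD(1)[OF WL_stable_compatible less.prems(2) i(1,2)] i by simp
    have "coordinate_map m \<sigma> x' = z"
    proof (rule nth_equalityI)
      fix l assume "l < length (coordinate_map m \<sigma> x')"
      then have l: "l < m" by simp
      have *: "x' ! \<sigma>' l = z[i := \<beta>] ! l" if "l < m" for l
        using x'(2) that by (metis coordinate_map_nth)
      show "coordinate_map m \<sigma> x' ! l = z ! l"
        using *[OF l] *[OF i(2)] l i zi z
        by (cases "l = i") (auto simp: \<sigma>'_def tuples_length)
    qed (use z in \<open>simp add: tuples_length\<close>)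
    then show ?thesis using x'(1) by blast
  qed
qed

lemma coordinate_map_WL_class:
  assumes "finite V" "\<sigma> \<in> {..<m} \<rightarrow> {..<m}" "x \<in> tuples m V"
  shows "coordinate_map m \<sigma> ` (WL_stable m V S `` {x}) = WL_stable m V S `` {coordinate_map m \<sigma> x}"
  using WL_stable_coordinate_map[OF assms(1) _ assms(2), of x _ S]
    WL_stable_coordinate_map_lift[OF assms, of _ S] by (auto simp: image_iff)

text \<open>The graph of an automorphism on tuples is a game in which the automorphism itself
  answers every move.\<close>

lemma WL_stable_automorphism:
  assumes "finite V" "bij_betw k V V"
    and "\<And>s a b. s \<in> S \<Longrightarrow> a \<in> V \<Longrightarrow> b \<in> V \<Longrightarrow> (k a, k b) \<in> s \<longleftrightarrow> (a, b) \<in> s"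
    and "x \<in> tuples m V"
  shows "(x, map k x) \<in> WL_stable m V S"
proof -
  define R where "R = {(x, map k x) | x. x \<in> tuples m V}"
  have "WL_forth m V R"
  proof (rule WL_forthI)
    show "R \<subseteq> tuples m V \<times> tuples m V"
      unfolding R_def tuples_def using bij_betw_apply[OF assms(2)] by (auto 0 3)
    fix u v assume "(u, v) \<in> R"
    then have u: "u \<in> tuples m V" "v = map k u" unfolding R_def by auto
    have "(u[i := \<alpha>], v[i := k \<alpha>]) \<in> R" if "\<alpha> \<in> V" for \<alpha> i
      using tuples_update[OF u(1) that] unfolding R_def u(2) by (auto simp: map_update[symmetric])
    then show "\<exists>g. bij_betw g V V \<and> (\<forall>\<alpha>\<in>V. \<forall>i<m. (u[i := \<alpha>], v[i := g \<alpha>]) \<in> R)"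
      using assms(2) by blast
  qed
  moreover have "WL_compatible m S id R"
  proof -
    have "(u ! i = u ! j \<longleftrightarrow> v ! i = v ! j) \<and> (\<forall>s\<in>S. (u ! i, u ! j) \<in> s \<longleftrightarrow> (v ! i, v ! j) \<in> id s)"
      if uv: "(u, v) \<in> R" and ij: "i < m" "j < m" for u v i j
    proof -
      have u: "u \<in> tuples m V" "v = map k u" using uv unfolding R_def by auto
      note t = tuples_nth[OF u(1) ij(1)] tuples_nth[OF u(1) ij(2)]
      show ?thesis
        using inj_on_eq_iff[OF bij_betw_imp_inj_on[OF assms(2)] t] assms(3)[OF _ t] ij tuples_length[OF u(1)]
        unfolding u(2) by simp
    qed
    then show ?thesis unfolding WL_compatible_def by blast
  qed
  ultimately have "R \<subseteq> WL_stable m V S" by (rule WL_stable_greatest[OF assms(1)])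
  then show ?thesis using assms(4) unfolding R_def by blast
qed

lemma equiv_WL_stable_sym: "(x, y) \<in> WL_stable m V S \<Longrightarrow> (y, x) \<in> WL_stable m V S"
  using equiv_WL_stable[of m V S] by (auto simp: equiv_def dest: symD)

text \<open>The count does not depend on the representative: the answering permutation matches the
  points counted for two equivalent tuples, as classes are closed under the stable
  equivalence.\<close>

lemma mary_intersection_number_eq:
  assumes "finite V" "X\<^sub>0 \<in> WL m V S" "length Xs = m" "set Xs \<subseteq> WL m V S" "x \<in> X\<^sub>0"
  shows "mary_intersection_number m V Xs X\<^sub>0 = card {\<alpha> \<in> V. \<forall>i<m. x[i := \<alpha>] \<in> Xs ! i}"
proof -
  let ?E = "WL_stable m V S"
  have "card {\<alpha> \<in> V. \<forall>i<m. y[i := \<alpha>] \<in> Xs ! i} = card {\<alpha> \<in> V. \<forall>i<m. x[i := \<alpha>] \<in> Xs ! i}"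
    if "y \<in> X\<^sub>0" for y
  proof -
    have "(y, x) \<in> ?E"
      using quotient_eq_iff[OF equiv_WL_stable[of m V S], of X\<^sub>0 X\<^sub>0 y x] assms(2,5) that
      unfolding WL_def by simp
    then obtain g where g: "bij_betw g V V"
      "\<And>\<alpha> i. \<alpha> \<in> V \<Longrightarrow> i < m \<Longrightarrow> (y[i := \<alpha>], x[i := g \<alpha>]) \<in> ?E"
      using WL_forthE[OF WL_stable_forth[OF assms(1)]] by metis
    have "Xs ! i \<in> WL m V S" if "i < m" for i using assms(3,4) that by auto
    then have iff: "y[i := \<alpha>] \<in> Xs ! i \<longleftrightarrow> x[i := g \<alpha>] \<in> Xs ! i" if "\<alpha> \<in> V" "i < m" for \<alpha> i
      using g(2)[OF that] in_quotient_imp_closed[OF equiv_WL_stable[of m V S], of "Xs ! i"] that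
        equiv_WL_stable_sym[of _ _ m V S]
      unfolding WL_def by blast
    have "bij_betw g {\<alpha> \<in> V. \<forall>i<m. y[i := \<alpha>] \<in> Xs ! i} {\<alpha> \<in> V. \<forall>i<m. x[i := \<alpha>] \<in> Xs ! i}"
      using g(1) iff by (intro bij_betw_Collect) auto
    then show ?thesis by (rule bij_betw_same_card)
  qed
  then show ?thesis
    unfolding mary_intersection_number_def using assms(5)
    by (intro the_equality) (blast, drule (1) bspec, erule sym)
qed

section \<open>Self-equivalence as a game\<close>

lemma partition_on_member_eq:
  "partition_on A P \<Longrightarrow> p \<in> P \<Longrightarrow> q \<in> P \<Longrightarrow> a \<in> p \<Longrightarrow> a \<in> q \<Longrightarrow> p = q"
  unfolding partition_on_def disjoint_def by blast

lemma partition_on_obtain: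
  assumes "partition_on A P" "a \<in> A"
  obtains p where "p \<in> P" "a \<in> p"
  using assms unfolding partition_on_def by blast

lemma nonempty_basis:
  assumes "partition_on A P" "p \<in> P"
  shows "p \<noteq> {}" "p \<subseteq> A"
  using assms unfolding partition_on_def by auto

text \<open>Labels may have any type: the lemma is applied to lists of classes, to pairs of an
  answer set and a coset label, and to pairs of basis relations.\<close>

lemma bij_with_equal_fibres:
  fixes p q :: "'a \<Rightarrow> 'b"
  assumes "finite A" "\<And>c. card {a \<in> A. p a = c} = card {a \<in> A. q a = c}"
  shows "\<exists>g. g permutes A \<and> (\<forall>a\<in>A. p a = q (g a))"
proof -
  have "image_mset p (mset_set A) = image_mset q (mset_set A)"
  proof (rule multiset_eqI)
    fix c
    have "count (image_mset r (mset_set A)) c = card {a \<in> A. r a = c}" for r :: "'a \<Rightarrow> 'b"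
      using assms(1) by (simp add: count_image_mset' eq_commute)
    then show "count (image_mset p (mset_set A)) c = count (image_mset q (mset_set A)) c"
      using assms(2) by simp
  qed
  then show ?thesis using image_mset_eq_implies_permutes[OF assms(1)] by blast
qed

text \<open>\<open>R\<close> relates a tuple to the members of the image of its class. It is the
  preimage of the graph of a bijection between classes, which gives the last two properties at once.
  The intersection numbers give the answering permutations, the coordinate maps the preservation of
  equalities, the 2-projection that of basis relations.\<close>

lemma WL_self_equivalent_imp_forth:
  assumes fin: "finite V" and ne: "V \<noteq> {}" and m: "m \<ge> 2"
    and part: "partition_on (V \<times> V) S" and bij: "bij_betw \<phi> S S"
    and WL: "WL_self_equivalent m V S \<phi>"
  obtains R where "WL_forth m V R" "WL_compatible m S \<phi> R" "R \<noteq> {}"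
    "\<And>x y \<sigma>. (x, y) \<in> R \<Longrightarrow> \<sigma> \<in> {..<m} \<rightarrow> {..<m} \<Longrightarrow>
       (coordinate_map m \<sigma> x, coordinate_map m \<sigma> y) \<in> R"
    "\<And>x y x' y'. (x, y) \<in> R \<Longrightarrow> (x', y) \<in> R \<Longrightarrow> (x', y') \<in> R \<Longrightarrow> (x, y') \<in> R"
    "\<And>x x' y y'. (x, x') \<in> WL_stable m V S \<Longrightarrow> (x', y') \<in> R \<Longrightarrow>
       (y', y) \<in> WL_stable m V S \<Longrightarrow> (x, y) \<in> R"
proof -
  let ?E = "WL_stable m V S" and ?P = "WL m V S" and ?T = "tuples m V"
  note eqv = equiv_WL_stable[of m V S]
  obtain f where f_aut: "mary_algebraic_automorphism m V ?P f"
    and f_proj: "\<And>s. s \<in> S \<Longrightarrow> \<phi> s = (\<Union>X \<in> {X \<in> ?P. proj2 X \<subseteq> s}. proj2 (f X))"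
    using WL unfolding WL_self_equivalent_def by auto
  note f_aut' = f_aut[unfolded mary_algebraic_automorphism_def]
  have f: "bij_betw f ?P ?P" using f_aut' by (rule conjunct1)
  have f_map: "f (coordinate_map m \<sigma> ` X) = coordinate_map m \<sigma> ` f X"
    if "X \<in> ?P" "\<sigma> \<in> {..<m} \<rightarrow> {..<m}" for X \<sigma>
    using conjunct1[OF conjunct2[OF f_aut']] that by (elim ballE) auto
  have f_num: "mary_intersection_number m V (map f Xs) (f X\<^sub>0) = mary_intersection_number m V Xs X\<^sub>0"
    if "X\<^sub>0 \<in> ?P" "length Xs = m" "set Xs \<subseteq> ?P" for X\<^sub>0 Xs
    using conjunct2[OF conjunct2[OF f_aut']] that by blast
  define R where "R = {(x, y). x \<in> ?T \<and> y \<in> f (?E `` {x})}"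
  have cls: "?E `` {x} \<in> ?P" if "x \<in> ?T" for x using that unfolding WL_def by (rule quotientI)
  have fcls: "f X \<in> ?P" if "X \<in> ?P" for X using f that by (rule bij_betw_apply)
  have finj: "f X = f Y \<Longrightarrow> X = Y" if "X \<in> ?P" "Y \<in> ?P" for X Y
    using f that by (simp add: bij_betw_def inj_on_def)
  have self: "x \<in> ?E `` {x}" if "x \<in> ?T" for x using equiv_class_self[OF eqv that] .
  have mem: "X = ?E `` {x}" if "X \<in> ?P" "x \<in> X" for X x
    using that eqv unfolding WL_def by (metis quotientE Image_singleton_iff equiv_class_eq)
  have sub: "x \<in> ?T" if "X \<in> ?P" "x \<in> X" for X x
    using that in_quotient_imp_subset[OF eqv] unfolding WL_def by blast
  have R_iff: "(x, y) \<in> R \<longleftrightarrow> x \<in> ?T \<and> y \<in> ?T \<and> f (?E `` {x}) = ?E `` {y}" for x y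
    unfolding R_def using mem[OF fcls[OF cls], of x y] sub[OF fcls[OF cls], of x y] self[of y] by auto
  have R_coord: "(coordinate_map m \<sigma> x, coordinate_map m \<sigma> y) \<in> R"
    if "(x, y) \<in> R" "\<sigma> \<in> {..<m} \<rightarrow> {..<m}" for x y \<sigma>
  proof -
    have xy: "x \<in> ?T" "y \<in> ?T" "f (?E `` {x}) = ?E `` {y}" using that(1) R_iff by auto
    have "f (?E `` {coordinate_map m \<sigma> x}) = f (coordinate_map m \<sigma> ` (?E `` {x}))"
      using coordinate_map_WL_class[OF fin that(2) xy(1)] by metis
    also have "\<dots> = coordinate_map m \<sigma> ` (?E `` {y})" using f_map[OF cls[OF xy(1)] that(2)] xy(3) by simp
    also have "\<dots> = ?E `` {coordinate_map m \<sigma> y}" using coordinate_map_WL_class[OF fin that(2) xy(2)] .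
    finally show ?thesis using R_iff coordinate_map_tuples[OF xy(1) that(2)] coordinate_map_tuples[OF xy(2) that(2)] by blast
  qed
  have R_forth: "WL_forth m V R"
  proof (rule WL_forthI)
    show "R \<subseteq> ?T \<times> ?T" using R_iff by auto
    fix x y assume "(x, y) \<in> R"
    then have xy: "x \<in> ?T" "y \<in> ?T" "f (?E `` {x}) = ?E `` {y}" using R_iff by auto
    \<comment> \<open>The color vector of a move on the left is carried over by \<open>f\<close>, so
      a permutation matching \<open>?p\<close> with \<open>?q\<close> is exactly an answer in
      \<open>R\<close>.\<close>
    let ?p = "\<lambda>\<alpha>. map (\<lambda>i. f (?E `` {x[i := \<alpha>]})) [0..<m]"
    let ?q = "\<lambda>\<beta>. map (\<lambda>i. ?E `` {y[i := \<beta>]}) [0..<m]"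
    have "card {\<alpha> \<in> V. ?p \<alpha> = Ys} = card {\<beta> \<in> V. ?q \<beta> = Ys}" for Ys
    proof (cases "length Ys = m \<and> set Ys \<subseteq> ?P")
      case True
      \<comment> \<open>Preservation of intersection numbers speaks of images of classes, so the
        prescribed classes are pulled back along \<open>f\<close>.\<close>
      define Xs where "Xs = map (inv_into ?P f) Ys"
      have inv: "inv_into ?P f Y \<in> ?P" "f (inv_into ?P f Y) = Y" if "Y \<in> ?P" for Y
        using that f by (auto simp: bij_betw_def inv_into_into f_inv_into_f)
      have Xs: "length Xs = m" "set Xs \<subseteq> ?P" "map f Xs = Ys"
        using True inv unfolding Xs_def by (auto simp: subset_iff map_idI)
      have Xi: "Xs ! i \<in> ?P" "Ys ! i = f (Xs ! i)" if "i < m" for i using Xs that by auto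
      have "?p \<alpha> = Ys \<longleftrightarrow> (\<forall>i<m. x[i := \<alpha>] \<in> Xs ! i)" if "\<alpha> \<in> V" for \<alpha>
      proof -
        have "?p \<alpha> = Ys \<longleftrightarrow> (\<forall>i<m. f (?E `` {x[i := \<alpha>]}) = f (Xs ! i))"
          using True Xi(2) by (auto simp: list_eq_iff_nth_eq)
        also have "\<dots> \<longleftrightarrow> (\<forall>i<m. x[i := \<alpha>] \<in> Xs ! i)"
          using finj[OF cls[OF tuples_update[OF xy(1) that]] Xi(1)] mem[OF Xi(1)]
            self[OF tuples_update[OF xy(1) that]] by metis
        finally show ?thesis .
      qed
      then have "card {\<alpha> \<in> V. ?p \<alpha> = Ys} = card {\<alpha> \<in> V. \<forall>i<m. x[i := \<alpha>] \<in> Xs ! i}"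
        by (intro arg_cong[where f = card]) blast
      also have "\<dots> = mary_intersection_number m V Xs (?E `` {x})"
        using mary_intersection_number_eq[OF fin cls[OF xy(1)] Xs(1,2) self[OF xy(1)]] by simp
      also have "\<dots> = mary_intersection_number m V Ys (?E `` {y})"
        using f_num[OF cls[OF xy(1)] Xs(1,2)] Xs(3) xy(3) by simp
      also have "\<dots> = card {\<beta> \<in> V. \<forall>i<m. y[i := \<beta>] \<in> Ys ! i}"
        using mary_intersection_number_eq[OF fin cls[OF xy(2)] _ _ self[OF xy(2)], of Ys] True by simp
      also have "\<dots> = card {\<beta> \<in> V. ?q \<beta> = Ys}"
      proof -
        have Yi: "Ys ! i \<in> ?P" if "i < m" for i using True that by auto
        have "?q \<beta> = Ys \<longleftrightarrow> (\<forall>i<m. y[i := \<beta>] \<in> Ys ! i)" if "\<beta> \<in> V" for \<beta>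
        proof -
          have "?q \<beta> = Ys \<longleftrightarrow> (\<forall>i<m. ?E `` {y[i := \<beta>]} = Ys ! i)"
            using True by (auto simp: list_eq_iff_nth_eq)
          also have "\<dots> \<longleftrightarrow> (\<forall>i<m. y[i := \<beta>] \<in> Ys ! i)"
            using mem[OF Yi] self[OF tuples_update[OF xy(2) that]] by metis
          finally show ?thesis .
        qed
        then show ?thesis by (intro arg_cong[where f = card]) blast
      qed
      finally show ?thesis .
    next
      case False
      have "?p \<alpha> \<noteq> Ys" if "\<alpha> \<in> V" for \<alpha>
        using False fcls[OF cls[OF tuples_update[OF xy(1) that]]] by fastforce
      moreover have "?q \<beta> \<noteq> Ys" if "\<beta> \<in> V" for \<beta>
        using False cls[OF tuples_update[OF xy(2) that]] by fastforce
      ultimately have "{\<alpha> \<in> V. ?p \<alpha> = Ys} = {}" "{\<beta> \<in> V. ?q \<beta> = Ys} = {}" by blast+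
      then show ?thesis by (simp only:)
    qed
    then obtain g where g: "g permutes V" "\<forall>\<alpha>\<in>V. ?p \<alpha> = ?q (g \<alpha>)"
      using bij_with_equal_fibres[OF fin, of ?p ?q] by blast
    have "(x[i := \<alpha>], y[i := g \<alpha>]) \<in> R" if "\<alpha> \<in> V" "i < m" for \<alpha> i
    proof -
      have "f (?E `` {x[i := \<alpha>]}) = ?E `` {y[i := g \<alpha>]}"
        using g(2) that by (auto simp: map_eq_conv)
      then show ?thesis
        using R_iff tuples_update[OF xy(1) that(1)] tuples_update[OF xy(2), of "g \<alpha>"] that
          permutes_in_image[OF g(1)] by simp
    qed
    then show "\<exists>g. bij_betw g V V \<and> (\<forall>\<alpha>\<in>V. \<forall>i<m. (x[i := \<alpha>], y[i := g \<alpha>]) \<in> R)"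
      using permutes_imp_bij[OF g(1)] by blast
  qed
  have R_rel: "(y ! i, y ! j) \<in> \<phi> s"
    if xy: "(x, y) \<in> R" and ij: "i < m" "j < m" and s: "s \<in> S" "(x ! i, x ! j) \<in> s" for x y i j s
  proof -
    \<comment> \<open>The 2-projection sees only the first two coordinates, so \<open>x ! i\<close>
      and \<open>x ! j\<close> are moved there.\<close>
    define \<sigma> where "\<sigma> = (\<lambda>l::nat. if l = 0 then i else j)"
    have sg: "\<sigma> \<in> {..<m} \<rightarrow> {..<m}" using ij unfolding \<sigma>_def by auto
    define u v where "u = coordinate_map m \<sigma> x" and "v = coordinate_map m \<sigma> y"
    have uv: "(u, v) \<in> R" using R_coord[OF xy sg] unfolding u_def v_def .
    then have uT: "u \<in> ?T" "v \<in> ?T" "f (?E `` {u}) = ?E `` {v}" using R_iff by auto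
    have u01: "u ! 0 = x ! i" "u ! 1 = x ! j" "v ! 0 = y ! i" "v ! 1 = y ! j"
      using m unfolding u_def v_def by (auto simp: \<sigma>_def)
    have "(w ! 0, w ! 1) \<in> s" if "(u, w) \<in> ?E" for w
      using WL_compatibleD(2)[OF WL_stable_compatible that, of 0 1 s] m s u01 by simp
    then have "proj2 (?E `` {u}) \<subseteq> s" unfolding proj2_def by auto
    moreover have "(y ! i, y ! j) \<in> proj2 (f (?E `` {u}))"
      unfolding proj2_def uT(3) using self[OF uT(2)] u01 by (auto simp: image_iff intro!: bexI[of _ v])
    ultimately show ?thesis using f_proj[OF s(1)] cls[OF uT(1)] by blast
  qed
  have R_compat: "WL_compatible m S \<phi> R"
    unfolding WL_compatible_def
  proof (clarify, intro conjI ballI)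
    fix x y i j assume xy: "(x, y) \<in> R" and ij: "i < m" "j < m"
    have xyT: "x \<in> ?T" "y \<in> ?T" "f (?E `` {x}) = ?E `` {y}" using xy R_iff by auto
    \<comment> \<open>Position \<open>i\<close> is made to read coordinate \<open>j\<close>. This
      map fixes the class of \<open>z\<close> exactly if \<open>z ! i = z ! j\<close>, so equality
      of entries is expressible by coordinate maps, with which \<open>f\<close> commutes.\<close>
    define \<sigma> where "\<sigma> = (\<lambda>l. if l = i then j else l)"
    have sg: "\<sigma> \<in> {..<m} \<rightarrow> {..<m}" using ij unfolding \<sigma>_def by auto
    have fix_iff: "z ! i = z ! j \<longleftrightarrow> coordinate_map m \<sigma> ` (?E `` {z}) = ?E `` {z}" if zT: "z \<in> ?T" for z
    proof
      assume "z ! i = z ! j"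
      then have "coordinate_map m \<sigma> z = z"
        using tuples_length[OF that] by (intro nth_equalityI) (auto simp: \<sigma>_def)
      then show "coordinate_map m \<sigma> ` (?E `` {z}) = ?E `` {z}"
        using coordinate_map_WL_class[OF fin sg that] by simp
    next
      assume "coordinate_map m \<sigma> ` (?E `` {z}) = ?E `` {z}"
      then obtain w where "z = coordinate_map m \<sigma> w" using self[OF zT] by blast
      then show "z ! i = z ! j" using ij by (simp add: \<sigma>_def)
    qed
    have im: "coordinate_map m \<sigma> ` (?E `` {x}) \<in> ?P"
      using coordinate_map_WL_class[OF fin sg xyT(1)] cls[OF coordinate_map_tuples[OF xyT(1) sg]] by simp
    show "x ! i = x ! j \<longleftrightarrow> y ! i = y ! j"
      unfolding fix_iff[OF xyT(1)] fix_iff[OF xyT(2)]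
      using f_map[OF cls[OF xyT(1)] sg] finj[OF im cls[OF xyT(1)]] xyT(3) by metis
    fix s assume s: "s \<in> S"
    show "(x ! i, x ! j) \<in> s \<longleftrightarrow> (y ! i, y ! j) \<in> \<phi> s"
    proof
      assume ys: "(y ! i, y ! j) \<in> \<phi> s"
      \<comment> \<open>The image of the relation \<open>s'\<close> of the left pair contains the
        right pair; so \<open>\<phi> s\<close> and \<open>\<phi> s'\<close> meet, hence are equal,
        and \<open>\<phi>\<close> is injective.\<close>
      obtain s' where s': "s' \<in> S" "(x ! i, x ! j) \<in> s'"
        using partition_on_obtain[OF part] tuples_nth[OF xyT(1)] ij by blast
      have "\<phi> s = \<phi> s'"
        using partition_on_member_eq[OF part _ _ ys R_rel[OF xy ij s']] bij s s'(1)
        by (auto simp: bij_betw_apply)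
      then have "s = s'" using bij s s' by (auto simp: bij_betw_def inj_on_def)
      then show "(x ! i, x ! j) \<in> s" using s' by simp
    qed (rule R_rel[OF xy ij s])
  qed
  obtain \<omega> where "\<omega> \<in> V" using ne by blast
  then have w: "replicate m \<omega> \<in> ?T" unfolding tuples_def by auto
  obtain Y where "Y \<in> ?P" "f (?E `` {replicate m \<omega>}) = Y" using fcls[OF cls[OF w]] by blast
  then obtain y where "y \<in> ?T" "f (?E `` {replicate m \<omega>}) = ?E `` {y}" unfolding WL_def by (metis quotientE)
  then have R_ne: "R \<noteq> {}" using w R_iff by blast
  have "(x, y') \<in> R" if "(x, y) \<in> R" "(x', y) \<in> R" "(x', y') \<in> R" for x y x' y'
    using that unfolding R_iff by auto
  moreover have "(x, y) \<in> R" if "(x, x') \<in> ?E" "(x', y') \<in> R" "(y', y) \<in> ?E" for x x' y y'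
    using that equiv_class_eq[OF eqv that(1)] equiv_class_eq[OF eqv that(3)]
      equiv_mem[OF eqv that(1)] equiv_mem[OF eqv that(3)] unfolding R_iff by auto
  ultimately show thesis using that[OF R_forth R_compat R_ne R_coord] by blast
qed

lemma pair_tuple:
  assumes "a \<in> V" "b \<in> V" "m \<ge> 2"
  obtains x where "x \<in> tuples m V" "x ! 0 = a" "x ! 1 = b"
proof
  show "(replicate m b)[0 := a] \<in> tuples m V"
    using assms by (intro tuples_update) (auto simp: tuples_def)
qed (use assms in auto)

text \<open>\<open>R\<close> need not come from a map on classes, but by
  \<open>WL_stable_transfer\<close> it induces a bijection between them. Its closure under
  coordinate maps and its answering permutations give the two remaining requirements.\<close>

lemma WL_self_equivalentI:
  assumes fin: "finite V" and m: "m \<ge> 2"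
    and part: "partition_on (V \<times> V) S" and bij: "bij_betw \<phi> S S"
    and R: "WL_forth m V R" "WL_compatible m S \<phi> R" "R \<noteq> {}"
    and R_coord: "\<And>x y \<sigma>. (x, y) \<in> R \<Longrightarrow> \<sigma> \<in> {..<m} \<rightarrow> {..<m} \<Longrightarrow>
       (coordinate_map m \<sigma> x, coordinate_map m \<sigma> y) \<in> R"
  shows "WL_self_equivalent m V S \<phi>"
proof -
  let ?E = "WL_stable m V S" and ?P = "WL m V S" and ?T = "tuples m V"
  note eqv = equiv_WL_stable[of m V S]
  note transfer = WL_stable_transfer[OF fin R(1,2) bij]
  \<comment> \<open>Images under \<open>R\<close> need not be unions of classes; composing with the
    stable equivalence turns the image of a class into a full class.\<close>
  define f where "f X = (R O ?E) `` X" for X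
  have RT: "x \<in> ?T \<and> y \<in> ?T" if "(x, y) \<in> R" for x y using WL_forth_subset[OF R(1) that] .
  have cls: "?E `` {x} \<in> ?P" if "x \<in> ?T" for x using that unfolding WL_def by (rule quotientI)
  have self: "(x, x) \<in> ?E" if "x \<in> ?T" for x using equiv_class_self[OF eqv that] by simp
  have Etrans: "(x, z) \<in> ?E" if "(x, y) \<in> ?E" "(y, z) \<in> ?E" for x y z
    using equivE[OF eqv] that by (meson transD)
  have f_cls: "f (?E `` {x}) = ?E `` {y}" if "(x, y) \<in> R" for x y
  proof
    show "?E `` {y} \<subseteq> f (?E `` {x})" unfolding f_def using that self RT[OF that] by blast
    show "f (?E `` {x}) \<subseteq> ?E `` {y}"
      unfolding f_def using transfer[OF that] Etrans by blast
  qed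
  have obt: "\<exists>x y. (x, y) \<in> R \<and> X = ?E `` {x} \<and> f X = ?E `` {y}" if X: "X \<in> ?P" for X
  proof -
    obtain x where x: "x \<in> ?T" "X = ?E `` {x}" using X unfolding WL_def by (rule quotientE)
    obtain y where y: "(x, y) \<in> R" using WL_forth_total[OF R(1,3) x(1)] .
    show ?thesis using x(2) y f_cls[OF y] by blast
  qed
  have mem_iff: "x \<in> X \<longleftrightarrow> y \<in> f X" if X: "X \<in> ?P" and xy: "(x, y) \<in> R" for X x y
  proof -
    obtain x' y' where "(x', y') \<in> R" "X = ?E `` {x'}" "f X = ?E `` {y'}" using obt[OF X] by blast
    then show ?thesis using transfer[OF _ xy] by blast
  qed
  have f_in: "f X \<in> ?P" if X: "X \<in> ?P" for X
  proof -
    obtain x y where "(x, y) \<in> R" "f X = ?E `` {y}" using obt[OF X] by blast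
    then show ?thesis using cls RT by metis
  qed
  have f_bij: "bij_betw f ?P ?P"
  proof (rule bij_betw_imageI)
    show "inj_on f ?P"
    proof (rule inj_onI)
      fix X Y assume XY: "X \<in> ?P" "Y \<in> ?P" "f X = f Y"
      obtain x y where x: "(x, y) \<in> R" "X = ?E `` {x}" "f X = ?E `` {y}" using obt[OF XY(1)] by blast
      obtain x' y' where x': "(x', y') \<in> R" "Y = ?E `` {x'}" "f Y = ?E `` {y'}" using obt[OF XY(2)] by blast
      have "(y, y') \<in> ?E"
        using eq_equiv_class_iff[OF eqv] XY(3) x x' RT by metis
      then have "(x, x') \<in> ?E" using transfer[OF x(1) x'(1)] by simp
      then show "X = Y" using equiv_class_eq[OF eqv] x x' by metis
    qed
    show "f ` ?P = ?P"
    proof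
      show "f ` ?P \<subseteq> ?P" using f_in by blast
      show "?P \<subseteq> f ` ?P"
      proof
        fix Y assume Y: "Y \<in> ?P"
        obtain y where y: "y \<in> ?T" "Y = ?E `` {y}" using Y unfolding WL_def by (rule quotientE)
        obtain x where x: "(x, y) \<in> R" using WL_forth_surj[OF R(1,3) y(1)] .
        show "Y \<in> f ` ?P" using f_cls[OF x] y(2) cls RT[OF x] by blast
      qed
    qed
  qed
  have f_map: "f (coordinate_map m \<sigma> ` X) = coordinate_map m \<sigma> ` f X"
    if X: "X \<in> ?P" and s: "\<sigma> \<in> {..<m} \<rightarrow> {..<m}" for X \<sigma>
  proof -
    obtain x y where x: "(x, y) \<in> R" "X = ?E `` {x}" "f X = ?E `` {y}" using obt[OF X] by blast
    show ?thesis
      unfolding x(3) unfolding x(2)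
        coordinate_map_WL_class[OF fin s conjunct1[OF RT[OF x(1)]]]
        coordinate_map_WL_class[OF fin s conjunct2[OF RT[OF x(1)]]]
      by (rule f_cls[OF R_coord[OF x(1) s]])
  qed
  have f_num: "mary_intersection_number m V (map f Xs) (f X\<^sub>0) = mary_intersection_number m V Xs X\<^sub>0"
    if X0: "X\<^sub>0 \<in> ?P" and Xs: "length Xs = m" "set Xs \<subseteq> ?P" for X\<^sub>0 Xs
  proof -
    obtain x y where x: "(x, y) \<in> R" "X\<^sub>0 = ?E `` {x}" "f X\<^sub>0 = ?E `` {y}" using obt[OF X0] by blast
    have fXs: "length (map f Xs) = m" "set (map f Xs) \<subseteq> ?P" using Xs f_in by auto
    obtain g where g: "bij_betw g V V"
      "\<And>\<alpha> i. \<alpha> \<in> V \<Longrightarrow> i < m \<Longrightarrow> (x[i := \<alpha>], y[i := g \<alpha>]) \<in> R"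
      using WL_forthE[OF R(1) x(1)] by metis
    have Xi: "Xs ! i \<in> ?P" "map f Xs ! i = f (Xs ! i)" if "i < m" for i using Xs that by auto
    have "(\<forall>i<m. y[i := g \<alpha>] \<in> map f Xs ! i) \<longleftrightarrow> (\<forall>i<m. x[i := \<alpha>] \<in> Xs ! i)" if "\<alpha> \<in> V" for \<alpha>
      using mem_iff[OF Xi(1) g(2)[OF that]] Xi(2) by (auto simp del: nth_map)
    then have "bij_betw g {\<alpha> \<in> V. \<forall>i<m. x[i := \<alpha>] \<in> Xs ! i} {\<beta> \<in> V. \<forall>i<m. y[i := \<beta>] \<in> map f Xs ! i}"
      by (intro bij_betw_Collect[OF g(1)])
    then have "card {\<alpha> \<in> V. \<forall>i<m. x[i := \<alpha>] \<in> Xs ! i} = card {\<beta> \<in> V. \<forall>i<m. y[i := \<beta>] \<in> map f Xs ! i}"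
      by (rule bij_betw_same_card)
    moreover have "x \<in> X\<^sub>0" "y \<in> f X\<^sub>0" using x self RT[OF x(1)] by auto
    note mary_intersection_number_eq[OF fin X0 Xs this(1)]
      mary_intersection_number_eq[OF fin f_in[OF X0] fXs this(2)]
    ultimately show ?thesis by (simp only:)
  qed
  have "\<phi> s = (\<Union>X \<in> {X \<in> ?P. proj2 X \<subseteq> s}. proj2 (f X))" if s: "s \<in> S" for s
  proof
    have m01: "0 < m" "1 < m" using m by auto
    have Ecomp: "(x ! 0, x ! 1) \<in> t \<longleftrightarrow> (x' ! 0, x' ! 1) \<in> t" if "(x, x') \<in> ?E" "t \<in> S" for x x' t
      using WL_compatibleD(2)[OF WL_stable_compatible that(1) m01 that(2)] by simp
    have Rcomp: "(x ! 0, x ! 1) \<in> s \<longleftrightarrow> (y ! 0, y ! 1) \<in> \<phi> s" if "(x, y) \<in> R" for x y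
      using WL_compatibleD(2)[OF R(2) that m01 s] .
    have fs: "\<phi> s \<in> S" using bij s by (rule bij_betw_apply)
    show "\<phi> s \<subseteq> (\<Union>X \<in> {X \<in> ?P. proj2 X \<subseteq> s}. proj2 (f X))"
    proof (rule subrelI)
      fix a b assume ab: "(a, b) \<in> \<phi> s"
      then have "a \<in> V" "b \<in> V" using nonempty_basis(2)[OF part fs] by auto
      then obtain y where y: "y \<in> ?T" "y ! 0 = a" "y ! 1 = b" using pair_tuple m by metis
      obtain x where x: "(x, y) \<in> R" using WL_forth_surj[OF R(1,3) y(1)] .
      have "(x ! 0, x ! 1) \<in> s" using Rcomp[OF x] ab y by simp
      then have "proj2 (?E `` {x}) \<subseteq> s" using Ecomp s unfolding proj2_def by auto
      moreover have "(a, b) \<in> proj2 (f (?E `` {x}))"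
        unfolding f_cls[OF x] proj2_def using self[OF y(1)] y by (auto intro!: image_eqI[of _ _ y])
      ultimately show "(a, b) \<in> (\<Union>X \<in> {X \<in> ?P. proj2 X \<subseteq> s}. proj2 (f X))"
        using cls RT[OF x] by blast
    qed
    show "(\<Union>X \<in> {X \<in> ?P. proj2 X \<subseteq> s}. proj2 (f X)) \<subseteq> \<phi> s"
    proof (rule UN_least)
      fix X assume "X \<in> {X \<in> ?P. proj2 X \<subseteq> s}"
      then have X: "X \<in> ?P" "proj2 X \<subseteq> s" by auto
      obtain x y where x: "(x, y) \<in> R" "X = ?E `` {x}" "f X = ?E `` {y}" using obt[OF X(1)] by blast
      have "(x ! 0, x ! 1) \<in> proj2 X" unfolding proj2_def x(2) using self RT[OF x(1)] by blast
      then have "(y ! 0, y ! 1) \<in> \<phi> s" using Rcomp[OF x(1)] X(2) by blast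
      then show "proj2 (f X) \<subseteq> \<phi> s" unfolding x(3) proj2_def using Ecomp[OF _ fs] by blast
    qed
  qed
  moreover have "mary_algebraic_automorphism m V ?P f"
    unfolding mary_algebraic_automorphism_def
    using f_bij f_map f_num by (intro conjI ballI allI impI) (auto simp del: length_map)
  ultimately show ?thesis unfolding WL_self_equivalent_def by (intro exI[of _ f]) simp
qed

lemma intersection_number_eq:
  assumes "coherent_configuration V S" "r \<in> S" "s \<in> S" "t \<in> S" "(\<alpha>, \<beta>) \<in> t"
  shows "intersection_number V r s t = card {\<gamma> \<in> V. (\<alpha>, \<gamma>) \<in> r \<and> (\<gamma>, \<beta>) \<in> s}"
proof -
  have "\<exists>c. \<forall>(\<alpha>, \<beta>)\<in>t. card {\<gamma> \<in> V. (\<alpha>, \<gamma>) \<in> r \<and> (\<gamma>, \<beta>) \<in> s} = c"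
    using assms unfolding coherent_configuration_def by simp
  then obtain c where c: "\<forall>(\<alpha>, \<beta>)\<in>t. card {\<gamma> \<in> V. (\<alpha>, \<gamma>) \<in> r \<and> (\<gamma>, \<beta>) \<in> s} = c" ..
  have "intersection_number V r s t = c"
    unfolding intersection_number_def using c assms(5) by (intro the_equality) auto
  then show ?thesis using c assms(5) by auto
qed

text \<open>For a path from \<open>a\<close> through \<open>\<gamma>\<close> to \<open>b\<close>,
  moving coordinate 1 to \<open>\<gamma>\<close> tests the first edge and moving coordinate 0 the
  second. The answering permutation is the same for both coordinates, so it matches the paths that
  are counted.\<close>

lemma algebraic_automorphism_of_forth:
  assumes "coherent_configuration V S" "m \<ge> 2" "bij_betw \<phi> S S"
    and R: "WL_forth m V R" "WL_compatible m S \<phi> R" "R \<noteq> {}"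
  shows "algebraic_automorphism V S \<phi>"
proof -
  have part: "partition_on (V \<times> V) S" using assms(1) unfolding coherent_configuration_def by simp
  have "intersection_number V (\<phi> r) (\<phi> s) (\<phi> t) = intersection_number V r s t"
    if rst: "r \<in> S" "s \<in> S" "t \<in> S" for r s t
  proof -
    obtain a b where ab: "(a, b) \<in> t" using nonempty_basis(1)[OF part rst(3)] by auto
    then have "a \<in> V" "b \<in> V" using nonempty_basis(2)[OF part rst(3)] by auto
    then obtain x where x: "x \<in> tuples m V" "x ! 0 = a" "x ! 1 = b" using pair_tuple assms(2) by metis
    obtain y where y: "(x, y) \<in> R" using WL_forth_total[OF R(1,3) x(1)] .
    have m01: "0 < m" "1 < m" using assms(2) by auto
    have len: "length x = m" "length y = m" using WL_forth_subset[OF R(1) y] by (auto simp: tuples_length)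
    have y01: "(y ! 0, y ! 1) \<in> \<phi> t"
      using WL_compatibleD(2)[OF R(2) y m01 rst(3)] x ab by simp
    obtain g where g: "bij_betw g V V"
      "\<And>\<alpha> i. \<alpha> \<in> V \<Longrightarrow> i < m \<Longrightarrow> (x[i := \<alpha>], y[i := g \<alpha>]) \<in> R"
      using WL_forthE[OF R(1) y] by metis
    have "((y ! 0, g \<gamma>) \<in> \<phi> r \<and> (g \<gamma>, y ! 1) \<in> \<phi> s) \<longleftrightarrow> ((a, \<gamma>) \<in> r \<and> (\<gamma>, b) \<in> s)" if "\<gamma> \<in> V" for \<gamma>
      using WL_compatibleD(2)[OF R(2) g(2)[OF that m01(2)] m01 rst(1)]
        WL_compatibleD(2)[OF R(2) g(2)[OF that m01(1)] m01 rst(2)] len m01 x by simp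
    then have "bij_betw g {\<gamma> \<in> V. (a, \<gamma>) \<in> r \<and> (\<gamma>, b) \<in> s}
        {\<gamma> \<in> V. (y ! 0, \<gamma>) \<in> \<phi> r \<and> (\<gamma>, y ! 1) \<in> \<phi> s}"
      by (rule bij_betw_Collect[OF g(1)])
    then have "card {\<gamma> \<in> V. (a, \<gamma>) \<in> r \<and> (\<gamma>, b) \<in> s} =
        card {\<gamma> \<in> V. (y ! 0, \<gamma>) \<in> \<phi> r \<and> (\<gamma>, y ! 1) \<in> \<phi> s}"
      by (rule bij_betw_same_card)
    moreover have "\<phi> r \<in> S" "\<phi> s \<in> S" "\<phi> t \<in> S" using bij_betw_apply[OF assms(3)] rst by auto
    ultimately show ?thesis
      using intersection_number_eq[OF assms(1) rst ab] intersection_number_eq[OF assms(1) _ _ _ y01] by simp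
  qed
  then show ?thesis using assms(3) unfolding algebraic_automorphism_def by simp
qed

section \<open>Games preserving shifts modulo a subgroup\<close>

text \<open>Being difunctional, \<open>A\<close> splits both sides into blocks of points with a
  common set of answers, and \<open>g\<close> matches blocks with blocks. Equal distribution of the
  labels within matched blocks then suffices for a bijection that respects the labels as
  well.\<close>

lemma difunctional_labelled_bij:
  assumes fin: "finite V" and g: "bij_betw g V V" "\<And>\<alpha>. \<alpha> \<in> V \<Longrightarrow> A \<alpha> (g \<alpha>)"
    and difun: "\<And>\<alpha> \<alpha>' \<beta> \<beta>'. \<alpha> \<in> V \<Longrightarrow> \<alpha>' \<in> V \<Longrightarrow> \<beta> \<in> V \<Longrightarrow> \<beta>' \<in> V \<Longrightarrow>
      A \<alpha> \<beta> \<Longrightarrow> A \<alpha>' \<beta> \<Longrightarrow> A \<alpha>' \<beta>' \<Longrightarrow> A \<alpha> \<beta>'"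
    and fib: "\<And>a0 c. a0 \<in> V \<Longrightarrow>
      card {\<alpha> \<in> V. A \<alpha> (g a0) \<and> u \<alpha> = c} = card {\<beta> \<in> V. A a0 \<beta> \<and> v \<beta> = c}"
  shows "\<exists>h. bij_betw h V V \<and> (\<forall>\<alpha>\<in>V. A \<alpha> (h \<alpha>) \<and> u \<alpha> = v (h \<alpha>))"
proof -
  define As where "As \<alpha> = {\<beta> \<in> V. A \<alpha> \<beta>}" for \<alpha>
  define gi where "gi = inv_into V g"
  have gO: "g \<alpha> \<in> V" if "\<alpha> \<in> V" for \<alpha> using g(1) that by (rule bij_betw_apply)
  have gi: "gi \<beta> \<in> V" "g (gi \<beta>) = \<beta>" if "\<beta> \<in> V" for \<beta>
    unfolding gi_def using bij_betw_inv_into[OF g(1)] bij_betw_inv_into_right[OF g(1)] that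
    by (auto simp: bij_betw_apply)
  have As_eq: "As \<alpha> = As \<alpha>' \<longleftrightarrow> A \<alpha> (g \<alpha>')" if a: "\<alpha> \<in> V" "\<alpha>' \<in> V" for \<alpha> \<alpha>'
  proof
    assume "As \<alpha> = As \<alpha>'"
    moreover have "g \<alpha>' \<in> As \<alpha>'" unfolding As_def using g(2) gO a by simp
    ultimately show "A \<alpha> (g \<alpha>')" unfolding As_def by blast
  next
    assume "A \<alpha> (g \<alpha>')"
    then show "As \<alpha> = As \<alpha>'"
      unfolding As_def using difun[OF a gO[OF a(2)]] difun[OF a(2,1) gO[OF a(2)]] g(2)[OF a(2)] by blast
  qed
  have As_eq': "As (gi \<beta>) = As \<alpha> \<longleftrightarrow> A \<alpha> \<beta>" if "\<alpha> \<in> V" "\<beta> \<in> V" for \<alpha> \<beta>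
    using As_eq[OF that(1) gi(1)[OF that(2)]] gi(2)[OF that(2)] by auto
  \<comment> \<open>A point on the right receives the block of its preimage under \<open>g\<close>,
    so both labelings record a block and a label.\<close>
  let ?p = "\<lambda>\<alpha>. (As \<alpha>, u \<alpha>)" and ?q = "\<lambda>\<beta>. (As (gi \<beta>), v \<beta>)"
  have "card {\<alpha> \<in> V. ?p \<alpha> = c} = card {\<beta> \<in> V. ?q \<beta> = c}" for c
  proof (cases "\<exists>\<alpha>\<in>V. fst c = As \<alpha>")
    case True
    then obtain a0 where a0: "a0 \<in> V" "fst c = As a0" by blast
    have "{\<alpha> \<in> V. ?p \<alpha> = c} = {\<alpha> \<in> V. A \<alpha> (g a0) \<and> u \<alpha> = snd c}"
      using As_eq[OF _ a0(1)] a0(2) by (cases c) auto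
    moreover have "{\<beta> \<in> V. ?q \<beta> = c} = {\<beta> \<in> V. A a0 \<beta> \<and> v \<beta> = snd c}"
      using As_eq'[OF a0(1)] a0(2) by (cases c) auto
    ultimately show ?thesis using fib[OF a0(1)] by simp
  next
    case False
    then have "{\<alpha> \<in> V. ?p \<alpha> = c} = {}" "{\<beta> \<in> V. ?q \<beta> = c} = {}" using gi(1) by force+
    then show ?thesis by (simp only:)
  qed
  then obtain h where h: "h permutes V" "\<forall>\<alpha>\<in>V. ?p \<alpha> = ?q (h \<alpha>)"
    using bij_with_equal_fibres[OF fin, of ?p ?q] by blast
  have "A \<alpha> (h \<alpha>) \<and> u \<alpha> = v (h \<alpha>)" if a: "\<alpha> \<in> V" for \<alpha>
    using As_eq'[OF a, of "h \<alpha>"] h(2) a permutes_in_image[OF h(1)] by auto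
  then show ?thesis using permutes_imp_bij[OF h(1)] by blast
qed

lemma card_constant_fibres:
  assumes "finite K" "finite \<Lambda>" "\<And>a. a \<in> K \<Longrightarrow> f a \<in> \<Lambda>" "\<And>l. l \<in> \<Lambda> \<Longrightarrow> card {a \<in> K. f a = l} = n"
  shows "card K = card \<Lambda> * n"
proof -
  have "card K = (\<Sum>l\<in>\<Lambda>. card {a \<in> K. f a = l})"
    using assms(1-3) sum.group[of K \<Lambda> f "\<lambda>_. 1 :: nat"] by (simp add: image_subset_iff)
  then show ?thesis using assms(4) by simp
qed

context comm_group
begin

lemma coset_eq_iff:
  assumes "subgroup H G" "a \<in> carrier G" "b \<in> carrier G"
  shows "H #> a = H #> b \<longleftrightarrow> a \<otimes> inv b \<in> H"
proof
  assume "H #> a = H #> b"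
  then have "a \<in> H #> b" using rcos_self[OF assms(2,1)] by simp
  then show "a \<otimes> inv b \<in> H"
    using assms subgroup.subset[OF assms(1)] by (auto simp: r_coset_def m_assoc)
next
  assume "a \<otimes> inv b \<in> H"
  moreover have "a = (a \<otimes> inv b) \<otimes> b" using assms by (simp add: m_assoc)
  ultimately have "a \<in> H #> b" unfolding r_coset_def by blast
  then show "H #> a = H #> b" using repr_independence assms by metis
qed

lemma mem_coset_iff:
  assumes "subgroup H G" "a \<in> carrier G" "b \<in> carrier G"
  shows "a \<in> H #> b \<longleftrightarrow> a \<otimes> inv b \<in> H"
  using coset_eq_iff[OF assms] repr_independence[OF _ assms(3,1)] rcos_self[OF assms(2,1)] by metis

lemma coset_eq_mult:
  assumes "H \<subseteq> carrier G" "H #> a = H #> b" "a \<in> carrier G" "b \<in> carrier G" "c \<in> carrier G"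
  shows "H #> (a \<otimes> c) = H #> (b \<otimes> c)"
  using assms coset_mult_assoc by metis

lemma sub_sym:
  assumes "subgroup H G" "a \<in> carrier G" "b \<in> carrier G" "a \<otimes> inv b \<in> H"
  shows "b \<otimes> inv a \<in> H"
  using coset_eq_iff[OF assms(1-3)] coset_eq_iff[OF assms(1,3,2)] assms(4) by simp

lemma sub_trans:
  assumes "subgroup H G" "a \<in> carrier G" "b \<in> carrier G" "c \<in> carrier G"
    "a \<otimes> inv b \<in> H" "b \<otimes> inv c \<in> H"
  shows "a \<otimes> inv c \<in> H"
  using coset_eq_iff[OF assms(1-3)] coset_eq_iff[OF assms(1,3,4)] coset_eq_iff[OF assms(1,2,4)] assms(5,6)
  by simp

text \<open>An injective map that preserves \<open>K\<close> and carries one coset into the other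
  compares the fibres of \<open>K\<close> over them; exchanging \<open>a\<close> and
  \<open>b\<close> gives equality in the applications.\<close>

lemma card_coset_le:
  assumes "finite K" "K \<subseteq> carrier G" "subgroup H G" "b \<in> carrier G" "inj_on k (carrier G)"
    and k: "\<And>z. z \<in> H #> a \<Longrightarrow> k z \<in> H #> b" "\<And>z. z \<in> K \<Longrightarrow> k z \<in> K"
  shows "card {z \<in> K. H #> z = H #> a} \<le> card {z \<in> K. H #> z = H #> b}"
proof (rule card_inj_on_le[of k])
  show "inj_on k {z \<in> K. H #> z = H #> a}"
    by (rule inj_on_subset[OF assms(5)]) (use assms(2) in auto)
  show "k ` {z \<in> K. H #> z = H #> a} \<subseteq> {z \<in> K. H #> z = H #> b}"
  proof clarify
    fix z assume z: "z \<in> K" "H #> z = H #> a"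
    then have "k z \<in> H #> b" using k(1) rcos_self[OF subsetD[OF assms(2) z(1)] assms(3)] by simp
    from repr_independence[OF this assms(4,3)] show "k z \<in> K \<and> H #> k z = H #> b" using k(2)[OF z(1)] by simp
  qed
qed (use assms(1) in simp)

text \<open>Preservation of the new color of a pair of entries is written as constancy of the
  difference between \<open>x\<close> and \<open>y\<close>, since this constant tells where a move
  has to be answered; \<open>shift_swap\<close> relates the two forms.\<close>

definition shift_refinement :: "nat \<Rightarrow> 'a set \<Rightarrow> 'a set \<Rightarrow> ('a list \<times> 'a list) set \<Rightarrow> ('a list \<times> 'a list) set" where
  "shift_refinement m U1 U0 R = {(x, y) \<in> R. \<forall>i<m. \<forall>j<m. x ! i \<otimes> inv (x ! j) \<in> U1 \<longrightarrow>
     U0 #> (x ! i \<otimes> inv (y ! i)) = U0 #> (x ! j \<otimes> inv (y ! j))}"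

text \<open>Inside a block of acceptable answers the target coset is irrelevant (no pebble in the
  \<open>U1\<close>-coset), already forced (a pebble in the same \<open>U0\<close>-coset), or free
  among the unpebbled \<open>U0\<close>-cosets of one \<open>U1\<close>-coset. In the last case the
  exchanges given by \<open>swap\<close> fix all pebbles, so they act on the block and make its
  fibres over these cosets equally large, on the left and on the right.\<close>

lemma shift_refinement_forth:
  assumes fin: "finite (carrier G)" and m: "m \<ge> 2"
    and U: "subgroup U0 G" "subgroup U1 G" "U0 \<subseteq> U1"
    and R: "WL_forth m (carrier G) R"
    and R1: "\<And>x y i j. (x, y) \<in> R \<Longrightarrow> i < m \<Longrightarrow> j < m \<Longrightarrow>
       x ! i \<otimes> inv (x ! j) \<in> U1 \<longleftrightarrow> y ! i \<otimes> inv (y ! j) \<in> U1"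
    and R0: "\<And>x y i j. (x, y) \<in> R \<Longrightarrow> i < m \<Longrightarrow> j < m \<Longrightarrow>
       x ! i \<otimes> inv (x ! j) \<in> U0 \<longleftrightarrow> y ! i \<otimes> inv (y ! j) \<in> U0"
    and difun: "\<And>x y x' y'. (x, y) \<in> R \<Longrightarrow> (x', y) \<in> R \<Longrightarrow> (x', y') \<in> R \<Longrightarrow> (x, y') \<in> R"
    and swap: "\<And>a b. a \<in> carrier G \<Longrightarrow> b \<in> carrier G \<Longrightarrow> a \<otimes> inv b \<in> U1 \<Longrightarrow>
       \<exists>k. bij_betw k (carrier G) (carrier G) \<and> (\<forall>z\<in>U0 #> a. k z \<in> U0 #> b) \<and>
         (\<forall>z\<in>carrier G. z \<notin> U0 #> a \<longrightarrow> z \<notin> U0 #> b \<longrightarrow> k z = z) \<and>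
         (\<forall>(x, y)\<in>R. (map k x, y) \<in> R \<and> (x, map k y) \<in> R)"
  shows "WL_forth m (carrier G) (shift_refinement m U1 U0 R)"
proof (rule WL_forthI)
  let ?V = "carrier G"
  show "shift_refinement m U1 U0 R \<subseteq> tuples m ?V \<times> tuples m ?V"
    using R unfolding shift_refinement_def WL_forth_def by auto
  fix x y assume "(x, y) \<in> shift_refinement m U1 U0 R"
  then have xy: "(x, y) \<in> R"
    and shift: "\<And>i j. i < m \<Longrightarrow> j < m \<Longrightarrow> x ! i \<otimes> inv (x ! j) \<in> U1 \<Longrightarrow>
      U0 #> (x ! i \<otimes> inv (y ! i)) = U0 #> (x ! j \<otimes> inv (y ! j))"
    unfolding shift_refinement_def by auto
  note U0s = subgroup.subset[OF U(1)]
  have xyT: "x \<in> tuples m ?V" "y \<in> tuples m ?V" using WL_forth_subset[OF R xy] by auto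
  have len: "length x = m" "length y = m" using xyT by (auto simp: tuples_length)
  have xO: "x ! i \<in> ?V" and yO: "y ! i \<in> ?V" if "i < m" for i using xyT that tuples_nth by metis+
  obtain g where g: "bij_betw g ?V ?V"
    "\<And>\<alpha> i. \<alpha> \<in> ?V \<Longrightarrow> i < m \<Longrightarrow> (x[i := \<alpha>], y[i := g \<alpha>]) \<in> R"
    using WL_forthE[OF R xy] by metis
  have gO: "g \<alpha> \<in> ?V" if "\<alpha> \<in> ?V" for \<alpha> using g(1) that by (rule bij_betw_apply)
  \<comment> \<open>An answer has to be good at every coordinate, as one permutation must serve all
    of them.\<close>
  define A where "A \<alpha> \<beta> \<longleftrightarrow> (\<forall>i<m. (x[i := \<alpha>], y[i := \<beta>]) \<in> R)" for \<alpha> \<beta>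
  have A_difun: "A \<alpha> \<beta>'" if "A \<alpha> \<beta>" "A \<alpha>' \<beta>" "A \<alpha>' \<beta>'" for \<alpha> \<alpha>' \<beta> \<beta>'
    using that difun unfolding A_def by blast
  have A_g: "A \<alpha> (g \<alpha>)" if "\<alpha> \<in> ?V" for \<alpha> using g(2) that unfolding A_def by blast
  \<comment> \<open>A new point can be compared with pebble \<open>j\<close> only if another pebble
    is the one that moves; this uses \<open>m \<ge> 2\<close>.\<close>
  have other: "\<exists>i<m. i \<noteq> j" for j
    using m by (cases "j = 0") (auto intro: exI[of _ 1] exI[of _ 0])
  have A1: "\<alpha> \<otimes> inv (x ! j) \<in> U1 \<longleftrightarrow> \<beta> \<otimes> inv (y ! j) \<in> U1" if "A \<alpha> \<beta>" "j < m" for \<alpha> \<beta> j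
  proof -
    obtain i where i: "i < m" "i \<noteq> j" using other by blast
    show ?thesis using R1[of "x[i := \<alpha>]" "y[i := \<beta>]" i j] that i len unfolding A_def by simp
  qed
  have A0: "\<alpha> \<otimes> inv (x ! j) \<in> U0 \<longleftrightarrow> \<beta> \<otimes> inv (y ! j) \<in> U0" if "A \<alpha> \<beta>" "j < m" for \<alpha> \<beta> j
  proof -
    obtain i where i: "i < m" "i \<noteq> j" using other by blast
    show ?thesis using R0[of "x[i := \<alpha>]" "y[i := \<beta>]" i j] that i len unfolding A_def by simp
  qed
  define d where "d j = x ! j \<otimes> inv (y ! j)" for j
  have dO: "d j \<in> ?V" if "j < m" for j unfolding d_def using xO yO that by simp
  \<comment> \<open>Equality of \<open>u \<alpha>\<close> and \<open>v \<beta>\<close> says that the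
    answer \<open>\<beta>\<close> realizes the prescribed shift; \<open>None\<close> marks points
    whose \<open>U1\<close>-coset carries no pebble.\<close>
  define u where "u \<alpha> = (if \<exists>j<m. \<alpha> \<otimes> inv (x ! j) \<in> U1 then Some (U0 #> \<alpha>) else None)" for \<alpha>
  define v where "v \<beta> = (if \<exists>j<m. \<beta> \<otimes> inv (y ! j) \<in> U1
    then Some (U0 #> (d (SOME j. j < m \<and> \<beta> \<otimes> inv (y ! j) \<in> U1) \<otimes> \<beta>)) else None)" for \<beta>
  \<comment> \<open>The pebble picked by \<open>SOME\<close> is immaterial, since the shifts within
    one \<open>U1\<close>-coset agree modulo \<open>U0\<close>.\<close>
  have v_eq: "v \<beta> = Some (U0 #> (d j \<otimes> \<beta>))" if b: "\<beta> \<in> ?V" and j: "j < m" "\<beta> \<otimes> inv (y ! j) \<in> U1" for \<beta> j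
  proof -
    define l where "l = (SOME j. j < m \<and> \<beta> \<otimes> inv (y ! j) \<in> U1)"
    have l: "l < m \<and> \<beta> \<otimes> inv (y ! l) \<in> U1"
      unfolding l_def by (rule someI[where x = j]) (use j in simp)
    have "y ! l \<otimes> inv (y ! j) \<in> U1"
      using sub_trans[OF U(2) yO[of l] b yO[OF j(1)] sub_sym[OF U(2) b yO[of l]] j(2)] l by blast
    then have "U0 #> d l = U0 #> d j" using shift[of l j] R1[OF xy, of l j] l j unfolding d_def by simp
    then have "U0 #> (d l \<otimes> \<beta>) = U0 #> (d j \<otimes> \<beta>)" using dO l j b
      by (intro coset_eq_mult[OF U0s]) auto
    moreover have "v \<beta> = Some (U0 #> (d l \<otimes> \<beta>))" unfolding v_def l_def using j by (intro if_P) blast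
    ultimately show ?thesis by simp
  qed
  have fib: "card {\<alpha> \<in> ?V. A \<alpha> (g a0) \<and> u \<alpha> = c} = card {\<beta> \<in> ?V. A a0 \<beta> \<and> v \<beta> = c}"
    if a0: "a0 \<in> ?V" for a0 c
  proof -
    \<comment> \<open>The block of \<open>a0\<close> and the set of its answers. They are matched by
      \<open>g\<close>, and their members lie relative to the pebbles as \<open>a0\<close>
      does.\<close>
    define K where "K = {\<alpha> \<in> ?V. A \<alpha> (g a0)}"
    define K' where "K' = {\<beta> \<in> ?V. A a0 \<beta>}"
    have finK: "finite K" "finite K'" unfolding K_def K'_def using fin by auto
    have "bij_betw g K K'"
      unfolding K_def K'_def using A_difun A_g a0 by (intro bij_betw_Collect[OF g(1)]) blast
    then have cardK: "card K = card K'" by (rule bij_betw_same_card)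
    have K1: "\<alpha> \<otimes> inv (x ! j) \<in> U1 \<longleftrightarrow> a0 \<otimes> inv (x ! j) \<in> U1"
      and K0: "\<alpha> \<otimes> inv (x ! j) \<in> U0 \<longleftrightarrow> a0 \<otimes> inv (x ! j) \<in> U0" if "\<alpha> \<in> K" "j < m" for \<alpha> j
      using A1[of _ "g a0" j] A0[of _ "g a0" j] A_g[OF a0] that unfolding K_def by auto
    have K1': "\<beta> \<otimes> inv (y ! j) \<in> U1 \<longleftrightarrow> a0 \<otimes> inv (x ! j) \<in> U1"
      and K0': "\<beta> \<otimes> inv (y ! j) \<in> U0 \<longleftrightarrow> a0 \<otimes> inv (x ! j) \<in> U0" if "\<beta> \<in> K'" "j < m" for \<beta> j
      using A1[of a0 \<beta> j] A0[of a0 \<beta> j] that unfolding K'_def by auto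
    have "card {\<alpha> \<in> K. u \<alpha> = c} = card {\<beta> \<in> K'. v \<beta> = c}"
    proof (cases "\<exists>j<m. a0 \<otimes> inv (x ! j) \<in> U1")
      case False
      then have "u \<alpha> = None" if "\<alpha> \<in> K" for \<alpha> using K1[OF that] unfolding u_def by auto
      moreover have "v \<beta> = None" if "\<beta> \<in> K'" for \<beta> using K1'[OF that] False unfolding v_def by auto
      ultimately have "{\<alpha> \<in> K. u \<alpha> = c} = (if c = None then K else {})"
        "{\<beta> \<in> K'. v \<beta> = c} = (if c = None then K' else {})" by auto
      then show ?thesis using cardK by simp
    next
      case True
      then obtain j where j: "j < m" "a0 \<otimes> inv (x ! j) \<in> U1" by blast
      have KO: "\<alpha> \<in> ?V" if "\<alpha> \<in> K" for \<alpha> using that unfolding K_def by simp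
      have KO': "\<beta> \<in> ?V" if "\<beta> \<in> K'" for \<beta> using that unfolding K'_def by simp
      have uK: "u \<alpha> = Some (U0 #> \<alpha>)" if "\<alpha> \<in> K" for \<alpha> using K1[OF that j(1)] j unfolding u_def by auto
      have vK: "v \<beta> = Some (U0 #> (d l \<otimes> \<beta>))" if "\<beta> \<in> K'" "l < m" "a0 \<otimes> inv (x ! l) \<in> U1" for \<beta> l
        using v_eq[OF KO'] K1' that by blast
      show ?thesis
      proof (cases "\<exists>l<m. a0 \<otimes> inv (x ! l) \<in> U0")
        \<comment> \<open>A pebble lies in the same \<open>U0\<close>-coset: the whole block is in
          that coset and its answers are in the coset of \<open>y ! l\<close>, so there is only one
          label.\<close>
        case True
        then obtain l where l: "l < m" "a0 \<otimes> inv (x ! l) \<in> U0" by blast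
        have "u \<alpha> = Some (U0 #> (x ! l))" if "\<alpha> \<in> K" for \<alpha>
          using uK[OF that] K0[OF that l(1)] l coset_eq_iff[OF U(1) KO[OF that] xO[OF l(1)]] by simp
        moreover have "v \<beta> = Some (U0 #> (x ! l))" if b: "\<beta> \<in> K'" for \<beta>
        proof -
          have "U0 #> \<beta> = U0 #> (y ! l)"
            using K0'[OF b l(1)] l coset_eq_iff[OF U(1) KO'[OF b] yO[OF l(1)]] by simp
          then have "U0 #> (\<beta> \<otimes> d l) = U0 #> (y ! l \<otimes> d l)"
            using KO'[OF b] yO dO l by (intro coset_eq_mult[OF U0s]) auto
          moreover have "y ! l \<otimes> d l = x ! l"
            unfolding d_def using xO[OF l(1)] yO[OF l(1)] by (simp add: m_lcomm)
          ultimately show ?thesis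
            using vK[OF b l(1)] l U(3) m_comm[OF dO[OF l(1)] KO'[OF b]] by auto
        qed
        ultimately have "{\<alpha> \<in> K. u \<alpha> = c} = (if c = Some (U0 #> (x ! l)) then K else {})"
          "{\<beta> \<in> K'. v \<beta> = c} = (if c = Some (U0 #> (x ! l)) then K' else {})" by auto
        then show ?thesis using cardK by simp
      next
        case False
        \<comment> \<open>\<open>W\<close> is the part of the \<open>U1\<close>-coset of
          \<open>x ! j\<close> outside all pebbled \<open>U0\<close>-cosets. Translation by the
          common shift takes \<open>W'\<close> onto \<open>W\<close>, so the same labels are
          possible on both sides.\<close>
        define W where "W = {\<alpha> \<in> ?V. \<alpha> \<otimes> inv (x ! j) \<in> U1 \<and> (\<forall>l<m. \<alpha> \<otimes> inv (x ! l) \<notin> U0)}"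
        define W' where "W' = {\<beta> \<in> ?V. \<beta> \<otimes> inv (y ! j) \<in> U1 \<and> (\<forall>l<m. \<beta> \<otimes> inv (y ! l) \<notin> U0)}"
        have KW: "K \<subseteq> W" unfolding W_def using K0 K1 KO j False by blast
        have KW': "K' \<subseteq> W'" unfolding W'_def using K0' K1' KO' j False by blast
        have dj: "d j \<in> ?V" "x ! j \<in> ?V" "y ! j \<in> ?V" using dO xO yO j by auto
        have W_shift: "\<beta> \<in> W' \<longleftrightarrow> d j \<otimes> \<beta> \<in> W" if b: "\<beta> \<in> ?V" for \<beta>
        proof -
          have e1: "d j \<otimes> \<beta> \<otimes> inv (x ! j) = \<beta> \<otimes> inv (y ! j)"
            unfolding d_def using b dj by (simp add: m_ac) (simp add: m_assoc[symmetric])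
          have e2: "d j \<otimes> \<beta> \<otimes> inv (x ! l) \<in> U0 \<longleftrightarrow> \<beta> \<otimes> inv (y ! l) \<in> U0"
            if l: "l < m" and bj: "\<beta> \<otimes> inv (y ! j) \<in> U1" for l
          proof (cases "x ! l \<otimes> inv (x ! j) \<in> U1")
            case True
            then have "U0 #> d l = U0 #> d j" using shift[OF l j(1)] unfolding d_def by simp
            then have "U0 #> (d l \<otimes> \<beta> \<otimes> inv (x ! l)) = U0 #> (d j \<otimes> \<beta> \<otimes> inv (x ! l))"
              using dO[OF l] dj b xO[OF l] by (intro coset_eq_mult[OF U0s]) auto
            moreover have "d l \<otimes> \<beta> \<otimes> inv (x ! l) = \<beta> \<otimes> inv (y ! l)"
              unfolding d_def using b xO[OF l] yO[OF l] by (simp add: m_ac) (simp add: m_assoc[symmetric])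
            ultimately show ?thesis
              using coset_eq_iff[OF U(1) _ one_closed, of "\<beta> \<otimes> inv (y ! l)"]
                coset_eq_iff[OF U(1) _ one_closed, of "d j \<otimes> \<beta> \<otimes> inv (x ! l)"] b dj xO[OF l] yO[OF l]
              by simp
          next
            case False
            \<comment> \<open>A pebble in another \<open>U1\<close>-coset excludes both
              memberships.\<close>
            have "\<beta> \<otimes> inv (y ! l) \<notin> U0"
              using False R1[OF xy l j(1)] sub_trans[OF U(2) yO[OF l] b dj(3)] sub_sym[OF U(2) b yO[OF l]]
                bj U(3) by blast
            moreover have "d j \<otimes> \<beta> \<otimes> inv (x ! l) \<notin> U0"
              using False sub_trans[OF U(2) xO[OF l] _ dj(2), of "d j \<otimes> \<beta>"]
                sub_sym[OF U(2) _ xO[OF l], of "d j \<otimes> \<beta>"] bj U(3) e1 dj b by auto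
            ultimately show ?thesis by simp
          qed
          show ?thesis unfolding W_def W'_def using e1 e2 b dj by auto
        qed
        define \<Lambda> where "\<Lambda> = (\<lambda>\<alpha>. U0 #> \<alpha>) ` W"
        have \<Lambda>': "\<Lambda> = (\<lambda>\<beta>. U0 #> (d j \<otimes> \<beta>)) ` W'"
        proof
          show "\<Lambda> \<subseteq> (\<lambda>\<beta>. U0 #> (d j \<otimes> \<beta>)) ` W'"
          proof
            fix l assume "l \<in> \<Lambda>"
            then obtain a where a: "a \<in> W" "l = U0 #> a" unfolding \<Lambda>_def by blast
            have aO: "a \<in> ?V" using a unfolding W_def by simp
            have "d j \<otimes> (inv (d j) \<otimes> a) = a" using dj aO by (simp add: m_assoc[symmetric])
            then show "l \<in> (\<lambda>\<beta>. U0 #> (d j \<otimes> \<beta>)) ` W'"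
              using W_shift[of "inv (d j) \<otimes> a"] a dj aO by (intro image_eqI[of _ _ "inv (d j) \<otimes> a"]) auto
          qed
          show "(\<lambda>\<beta>. U0 #> (d j \<otimes> \<beta>)) ` W' \<subseteq> \<Lambda>"
            unfolding \<Lambda>_def using W_shift unfolding W'_def by blast
        qed
        have fin\<Lambda>: "finite \<Lambda>" unfolding \<Lambda>_def W_def using fin by simp
        have WO: "a \<in> ?V" if "a \<in> W" for a using that unfolding W_def by simp
        have WO': "b \<in> ?V" if "b \<in> W'" for b using that unfolding W'_def by simp
        have le: "card {\<alpha> \<in> K. U0 #> \<alpha> = U0 #> a} \<le> card {\<alpha> \<in> K. U0 #> \<alpha> = U0 #> b}"
          if a: "a \<in> W" and b: "b \<in> W" for a b
        proof -
          have "a \<otimes> inv b \<in> U1"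
            using sub_trans[OF U(2) WO[OF a] dj(2) WO[OF b]] sub_sym[OF U(2) WO[OF b] dj(2)] a b
            unfolding W_def by blast
          then obtain k where k: "bij_betw k ?V ?V" "\<And>z. z \<in> U0 #> a \<Longrightarrow> k z \<in> U0 #> b"
            "\<And>z. z \<in> ?V \<Longrightarrow> z \<notin> U0 #> a \<Longrightarrow> z \<notin> U0 #> b \<Longrightarrow> k z = z"
            "\<And>x y. (x, y) \<in> R \<Longrightarrow> (map k x, y) \<in> R"
            using swap[OF WO[OF a] WO[OF b]] by blast
          \<comment> \<open>The exchange moves only points of two unpebbled cosets; it therefore
            fixes \<open>x\<close> and preserves the block.\<close>
          have kx: "map k x = x"
          proof (rule map_idI)
            fix z assume "z \<in> set x"
            then obtain l where l: "l < m" "z = x ! l" using len by (auto simp: in_set_conv_nth)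
            have "z \<notin> U0 #> w" if w: "w \<in> W" for w
              using w l sub_sym[OF U(1) xO[OF l(1)] WO[OF w]] mem_coset_iff[OF U(1) xO[OF l(1)] WO[OF w]]
              unfolding W_def by blast
            then show "k z = z" using k(3) a b l xO by blast
          qed
          have kK: "k \<alpha> \<in> K" if "\<alpha> \<in> K" for \<alpha>
          proof -
            have "(x[i := k \<alpha>], y[i := g a0]) \<in> R" if "i < m" for i
              using k(4)[of "x[i := \<alpha>]"] \<open>\<alpha> \<in> K\<close> that kx unfolding K_def A_def by (auto simp: map_update)
            then show ?thesis using bij_betw_apply[OF k(1) KO[OF that]] unfolding K_def A_def by simp
          qed
          show ?thesis
            using KO by (intro card_coset_le[OF finK(1) _ U(1) WO[OF b] bij_betw_imp_inj_on[OF k(1)] k(2) kK]) auto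
        qed
        have le': "card {\<beta> \<in> K'. U0 #> \<beta> = U0 #> a} \<le> card {\<beta> \<in> K'. U0 #> \<beta> = U0 #> b}"
          if a: "a \<in> W'" and b: "b \<in> W'" for a b
        proof -
          have "a \<otimes> inv b \<in> U1"
            using sub_trans[OF U(2) WO'[OF a] dj(3) WO'[OF b]] sub_sym[OF U(2) WO'[OF b] dj(3)] a b
            unfolding W'_def by blast
          then obtain k where k: "bij_betw k ?V ?V" "\<And>z. z \<in> U0 #> a \<Longrightarrow> k z \<in> U0 #> b"
            "\<And>z. z \<in> ?V \<Longrightarrow> z \<notin> U0 #> a \<Longrightarrow> z \<notin> U0 #> b \<Longrightarrow> k z = z"
            "\<And>x y. (x, y) \<in> R \<Longrightarrow> (x, map k y) \<in> R"
            using swap[OF WO'[OF a] WO'[OF b]] by blast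
          have ky: "map k y = y"
          proof (rule map_idI)
            fix z assume "z \<in> set y"
            then obtain l where l: "l < m" "z = y ! l" using len by (auto simp: in_set_conv_nth)
            have "z \<notin> U0 #> w" if w: "w \<in> W'" for w
              using w l sub_sym[OF U(1) yO[OF l(1)] WO'[OF w]] mem_coset_iff[OF U(1) yO[OF l(1)] WO'[OF w]]
              unfolding W'_def by blast
            then show "k z = z" using k(3) a b l yO by blast
          qed
          have kK: "k \<beta> \<in> K'" if "\<beta> \<in> K'" for \<beta>
          proof -
            have "(x[i := a0], y[i := k \<beta>]) \<in> R" if "i < m" for i
              using k(4)[of "x[i := a0]" "y[i := \<beta>]"] \<open>\<beta> \<in> K'\<close> that ky unfolding K'_def A_def
              by (auto simp: map_update)
            then show ?thesis using bij_betw_apply[OF k(1) KO'[OF that]] unfolding K'_def A_def by simp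
          qed
          show ?thesis
            using KO' by (intro card_coset_le[OF finK(2) _ U(1) WO'[OF b] bij_betw_imp_inj_on[OF k(1)] k(2) kK]) auto
        qed
        have shift_eq: "U0 #> (d j \<otimes> \<beta>) = U0 #> (d j \<otimes> b) \<longleftrightarrow> U0 #> \<beta> = U0 #> b"
          if "\<beta> \<in> ?V" "b \<in> ?V" for \<beta> b
        proof -
          have "d j \<otimes> \<beta> \<otimes> inv (d j \<otimes> b) = \<beta> \<otimes> inv b"
            using dj that by (simp add: inv_mult m_ac)
          then show ?thesis using coset_eq_iff[OF U(1)] dj that by simp
        qed
        have a0W: "a0 \<in> W" using KW A_g[OF a0] a0 unfolding K_def by blast
        then obtain b0 where b0: "b0 \<in> W'" "U0 #> a0 = U0 #> (d j \<otimes> b0)" using \<Lambda>' unfolding \<Lambda>_def by blast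
        define n where "n = card {\<alpha> \<in> K. U0 #> \<alpha> = U0 #> a0}"
        define n' where "n' = card {\<beta> \<in> K'. U0 #> \<beta> = U0 #> b0}"
        have n: "card {\<alpha> \<in> K. U0 #> \<alpha> = l} = n" if "l \<in> \<Lambda>" for l
          using that le a0W unfolding \<Lambda>_def n_def by (auto intro!: antisym)
        have n': "card {\<beta> \<in> K'. U0 #> (d j \<otimes> \<beta>) = l} = n'" if l: "l \<in> \<Lambda>" for l
        proof -
          obtain b where b: "b \<in> W'" "l = U0 #> (d j \<otimes> b)" using l unfolding \<Lambda>' by blast
          have "{\<beta> \<in> K'. U0 #> (d j \<otimes> \<beta>) = l} = {\<beta> \<in> K'. U0 #> \<beta> = U0 #> b}"
            unfolding b(2) using shift_eq[OF KO' WO'[OF b(1)]] by blast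
          then show ?thesis using le' b b0 unfolding n'_def by (auto intro!: antisym)
        qed
        \<comment> \<open>Each side is equidistributed over \<open>\<Lambda>\<close>; as the blocks
          have equal size and \<open>\<Lambda>\<close> is nonempty, the two constants agree.\<close>
        have "card K = card \<Lambda> * n"
          using KW n unfolding \<Lambda>_def by (intro card_constant_fibres[OF finK(1) fin\<Lambda>[unfolded \<Lambda>_def]]) auto
        moreover have "card K' = card \<Lambda> * n'"
          using KW' n' \<Lambda>' by (intro card_constant_fibres[OF finK(2) fin\<Lambda>]) auto
        moreover have "card \<Lambda> \<noteq> 0" using fin\<Lambda> a0W unfolding \<Lambda>_def by auto
        ultimately have nn: "n = n'" using cardK by simp
        show ?thesis
        proof (cases "\<exists>l\<in>\<Lambda>. c = Some l")
          case True
          then obtain l where l: "l \<in> \<Lambda>" "c = Some l" by blast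
          have "{\<alpha> \<in> K. u \<alpha> = c} = {\<alpha> \<in> K. U0 #> \<alpha> = l}" using uK l by auto
          moreover have "{\<beta> \<in> K'. v \<beta> = c} = {\<beta> \<in> K'. U0 #> (d j \<otimes> \<beta>) = l}" using vK[OF _ j] l by auto
          ultimately show ?thesis using n[OF l(1)] n'[OF l(1)] nn by simp
        next
          case False
          have "{\<alpha> \<in> K. u \<alpha> = c} = {}" using uK False KW unfolding \<Lambda>_def by auto
          moreover have "{\<beta> \<in> K'. v \<beta> = c} = {}" using vK[OF _ j] False KW' unfolding \<Lambda>' by auto
          ultimately show ?thesis by (simp only:)
        qed
      qed
    qed
    then show ?thesis unfolding K_def K'_def by (simp add: conj_assoc)
  qed
  have "\<exists>h. bij_betw h ?V ?V \<and> (\<forall>\<alpha>\<in>?V. A \<alpha> (h \<alpha>) \<and> u \<alpha> = v (h \<alpha>))"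
    by (rule difunctional_labelled_bij[where A = A, OF fin g(1)])
      (use A_g in blast, use A_difun in blast, use fib in blast)
  then obtain h where h: "bij_betw h ?V ?V" "\<And>\<alpha>. \<alpha> \<in> ?V \<Longrightarrow> A \<alpha> (h \<alpha>) \<and> u \<alpha> = v (h \<alpha>)"
    by blast
  have "(x[i := \<alpha>], y[i := h \<alpha>]) \<in> shift_refinement m U1 U0 R" if a: "\<alpha> \<in> ?V" and i: "i < m" for \<alpha> i
  proof -
    have Ah: "A \<alpha> (h \<alpha>)" "u \<alpha> = v (h \<alpha>)" using h(2)[OF a] by auto
    have hO: "h \<alpha> \<in> ?V" using h(1) a by (rule bij_betw_apply)
    have *: "U0 #> (\<alpha> \<otimes> inv (h \<alpha>)) = U0 #> (x ! q \<otimes> inv (y ! q))"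
      if q: "q < m" "\<alpha> \<otimes> inv (x ! q) \<in> U1" for q
    proof -
      have "U0 #> \<alpha> = U0 #> (d q \<otimes> h \<alpha>)"
        using Ah(2) v_eq[OF hO q(1)] A1[OF Ah(1) q(1)] q unfolding u_def by (auto split: if_splits)
      then have "U0 #> (\<alpha> \<otimes> inv (h \<alpha>)) = U0 #> (d q \<otimes> h \<alpha> \<otimes> inv (h \<alpha>))"
        using a hO dO[OF q(1)] by (intro coset_eq_mult[OF U0s]) auto
      then show ?thesis using hO dO[OF q(1)] unfolding d_def by (simp add: m_assoc)
    qed
    have "U0 #> (x[i := \<alpha>] ! p \<otimes> inv (y[i := h \<alpha>] ! p)) = U0 #> (x[i := \<alpha>] ! q \<otimes> inv (y[i := h \<alpha>] ! q))"
      if pq: "p < m" "q < m" "x[i := \<alpha>] ! p \<otimes> inv (x[i := \<alpha>] ! q) \<in> U1" for p q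
    proof (cases "p = i"; cases "q = i")
      assume "p = i" "q \<noteq> i"
      then show ?thesis using *[OF pq(2)] pq len i by simp
    next
      assume "p \<noteq> i" "q = i"
      then show ?thesis using *[OF pq(1)] sub_sym[OF U(2) xO[OF pq(1)] a] pq len i by simp
    next
      assume "p \<noteq> i" "q \<noteq> i"
      then show ?thesis using shift[OF pq(1,2)] pq len i by simp
    qed simp
    then show ?thesis unfolding shift_refinement_def using Ah(1) i unfolding A_def by simp
  qed
  then show "\<exists>g. bij_betw g ?V ?V \<and>
      (\<forall>\<alpha>\<in>?V. \<forall>i<m. (x[i := \<alpha>], y[i := g \<alpha>]) \<in> shift_refinement m U1 U0 R)"
    using h(1) by blast
qed

end

section \<open>Circulant schemes and their sections\<close>

text \<open>With \<open>e\<close> the index of \<open>H\<close> and \<open>x\<close> a generator,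
  \<open>x [^] k\<close> is such a root only if \<open>e\<close> divides \<open>k\<close>, which
  leaves at most \<open>card H\<close> elements; \<open>H\<close> already supplies that many.
  Subgroups of equal order therefore coincide.\<close>

lemma (in group) cyclic_subgroup_eq_roots:
  assumes "cyclic_group G" "finite (carrier G)" "subgroup H G"
  shows "H = {g \<in> carrier G. g [^] card H = \<one>}"
proof (rule card_subset_eq)
  let ?d = "card H"
  let ?N = "{g \<in> carrier G. g [^] ?d = \<one>}"
  show "finite ?N" using assms(2) by simp
  show "H \<subseteq> ?N"
  proof
    fix h assume h: "h \<in> H"
    interpret H: group "G\<lparr>carrier := H\<rparr>" using subgroup.subgroup_is_group[OF assms(3) is_group] .
    have "h [^]\<^bsub>G\<lparr>carrier := H\<rparr>\<^esub> order (G\<lparr>carrier := H\<rparr>) = \<one>" using H.pow_order_eq_1[of h] h by simp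
    then show "h \<in> ?N"
      using h subgroup.subset[OF assms(3)] by (auto simp: order_def nat_pow_consistent[symmetric])
  qed
  obtain x where x: "x \<in> carrier G" "subgroup_generated G {x} = G" using assms(1) unfolding cyclic_group_def by blast
  have ord: "ord x = order G" using cyclic_order_is_ord[OF x(1)] x(2) by simp
  have G: "carrier G = {x [^] k | k. k \<in> (UNIV :: nat set)}"
    using generate_pow_on_finite_carrier[OF assms(2) x(1)] x carrier_subgroup_generated[of G "{x}"] by simp
  obtain e where e: "order G = e * ?d" using lagrange[OF assms(3)] by metis
  have pos: "order G > 0" using assms(2) one_closed unfolding order_def by (auto simp: card_gt_0_iff)
  then have d0: "?d > 0" "e > 0" using e by (auto intro: Nat.gr0I)
  have "?N \<subseteq> (\<lambda>k. x [^] (e * k)) ` {..<?d}"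
  proof
    fix g assume "g \<in> ?N"
    then obtain k :: nat where k: "g = x [^] k" "(x [^] k) [^] ?d = \<one>" using G by auto
    then have "x [^] (k * ?d) = \<one>" using x(1) by (simp add: nat_pow_pow)
    then have "e * ?d dvd k * ?d" using pow_eq_id[OF x(1)] ord e by simp
    then have "e dvd k" using d0 by simp
    then obtain k' where k': "k = e * k'" by blast
    \<comment> \<open>The exponent is reduced modulo the order \<open>e * ?d\<close> of the
      group.\<close>
    have "x [^] k = x [^] (e * ?d * (k' div ?d) + e * (k' mod ?d))"
      unfolding k' by (metis add_mult_distrib2 mult.assoc mult_div_mod_eq)
    also have "\<dots> = (x [^] (e * ?d)) [^] (k' div ?d) \<otimes> x [^] (e * (k' mod ?d))"
      using x(1) by (simp add: nat_pow_mult[symmetric] nat_pow_pow)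
    also have "\<dots> = x [^] (e * (k' mod ?d))" using pow_order_eq_1[OF x(1)] x(1) e by simp
    finally show "g \<in> (\<lambda>k. x [^] (e * k)) ` {..<?d}" using k(1) d0 by auto
  qed
  then have "card ?N \<le> ?d" using card_image_le[of "{..<?d}"] card_mono by (metis (no_types, lifting) card_lessThan finite_imageI finite_lessThan le_trans)
  then show "card H = card ?N" using card_mono[OF \<open>finite ?N\<close> \<open>H \<subseteq> ?N\<close>] by simp
qed

lemma union_of_basis_iff:
  assumes "partition_on A S"
  shows "union_of_basis S r \<longleftrightarrow> r \<subseteq> A \<and> (\<forall>s\<in>S. s \<inter> r \<noteq> {} \<longrightarrow> s \<subseteq> r)"
proof
  assume "union_of_basis S r"
  then obtain T where T: "T \<subseteq> S" "r = \<Union>T" unfolding union_of_basis_def by blast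
  then show "r \<subseteq> A \<and> (\<forall>s\<in>S. s \<inter> r \<noteq> {} \<longrightarrow> s \<subseteq> r)"
    using nonempty_basis(2)[OF assms] partition_on_member_eq[OF assms] by blast
next
  assume r: "r \<subseteq> A \<and> (\<forall>s\<in>S. s \<inter> r \<noteq> {} \<longrightarrow> s \<subseteq> r)"
  have "r \<subseteq> \<Union>{s \<in> S. s \<subseteq> r}"
  proof
    fix p assume p: "p \<in> r"
    then have "p \<in> A" using r by blast
    then obtain s where s: "s \<in> S" "p \<in> s" using partition_on_obtain[OF assms] by blast
    then have "s \<inter> r \<noteq> {}" using p by blast
    then have "s \<subseteq> r" using r s(1) by simp
    then show "p \<in> \<Union>{s \<in> S. s \<subseteq> r}" using s by blast
  qed
  then show "union_of_basis S r" unfolding union_of_basis_def by (intro exI[of _ "{s \<in> S. s \<subseteq> r}"]) blast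
qed

lemma coarser_union_of_basis:
  assumes "coarser S T" "union_of_basis S r"
  shows "union_of_basis T r"
proof -
  obtain S' where S': "S' \<subseteq> S" "r = \<Union>S'" using assms(2) unfolding union_of_basis_def by blast
  have "r \<subseteq> \<Union>{t \<in> T. t \<subseteq> r}"
  proof
    fix p assume "p \<in> r"
    then obtain s where s: "s \<in> S'" "p \<in> s" using S'(2) by blast
    then have "union_of_basis T s" using assms(1) S'(1) unfolding coarser_def by blast
    then obtain T' where T': "T' \<subseteq> T" "s = \<Union>T'" unfolding union_of_basis_def by blast
    then obtain t where t: "t \<in> T'" "p \<in> t" using s(2) by auto
    have "t \<subseteq> r" using t(1) T'(2) s(1) S'(2) by auto
    then show "p \<in> \<Union>{t \<in> T. t \<subseteq> r}" using t T'(1) by blast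
  qed
  then show ?thesis unfolding union_of_basis_def by (intro exI[of _ "{t \<in> T. t \<subseteq> r}"]) blast
qed

lemma coarser_antisym:
  assumes "partition_on A S" "partition_on A T" "coarser S T" "coarser T S"
  shows "S = T"
proof -
  have "s \<in> Q" if PQ: "partition_on A P" "partition_on A Q" "coarser P Q" "coarser Q P" and s: "s \<in> P"
    for P Q and s
  proof -
    obtain a where a: "a \<in> s" using nonempty_basis(1)[OF PQ(1) s] by blast
    then have "a \<in> A" using nonempty_basis(2)[OF PQ(1) s] by blast
    then obtain t where t: "t \<in> Q" "a \<in> t" using partition_on_obtain[OF PQ(2)] by blast
    have "t \<subseteq> s" using PQ(3) s t a union_of_basis_iff[OF PQ(2), of s] unfolding coarser_def by blast
    moreover have "s \<subseteq> t" using PQ(4) s t a union_of_basis_iff[OF PQ(1), of t] unfolding coarser_def by blast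
    ultimately show ?thesis using t by simp
  qed
  then show ?thesis using assms by blast
qed

lemma scheme_group_coarser: "coarser S T \<Longrightarrow> scheme_group G S H \<Longrightarrow> scheme_group G T H"
  unfolding scheme_group_def using coarser_union_of_basis by blast

lemma sections_coarser: "coarser S T \<Longrightarrow> sections G S \<subseteq> sections G T"
  unfolding sections_def using scheme_group_coarser by blast

text \<open>Projective equivalence is generated by multiples, so a property invariant under single
  multiples is constant on a class. With a constant predicate \<open>P\<close>, the first conclusion
  gives membership in \<open>sections\<close>.\<close>

lemma projective_class_invariant:
  assumes "C \<in> sections G S // projective_equiv G S" "\<SS> \<in> C" "\<TT> \<in> C"
    and inv: "\<And>\<SS> \<TT>. \<SS> \<in> sections G S \<Longrightarrow> \<TT> \<in> sections G S \<Longrightarrow> multiple_of G \<SS> \<TT> \<Longrightarrow> P \<SS> \<longleftrightarrow> P \<TT>"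
  shows "\<SS> \<in> sections G S" "P \<SS> \<longleftrightarrow> P \<TT>"
proof -
  define R where "R = {(\<SS>, \<TT>) \<in> sections G S \<times> sections G S. multiple_of G \<SS> \<TT>}"
  obtain \<SS>\<^sub>0 where S0: "\<SS>\<^sub>0 \<in> sections G S" "C = (R \<union> R\<inverse>)\<^sup>* `` {\<SS>\<^sub>0}"
    using assms(1) unfolding projective_equiv_def Let_def R_def by (rule quotientE)
  have key: "\<SS> \<in> sections G S \<and> (P \<SS>\<^sub>0 \<longleftrightarrow> P \<SS>)" if "(\<SS>\<^sub>0, \<SS>) \<in> (R \<union> R\<inverse>)\<^sup>*" for \<SS>
    using that
  proof (induction rule: rtrancl_induct)
    case base
    then show ?case using S0 by simp
  next
    case (step \<SS> \<TT>)
    then show ?case using inv unfolding R_def by blast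
  qed
  have "(\<SS>\<^sub>0, \<SS>) \<in> (R \<union> R\<inverse>)\<^sup>*" "(\<SS>\<^sub>0, \<TT>) \<in> (R \<union> R\<inverse>)\<^sup>*" using S0(2) assms(2,3) by simp_all
  from key[OF this(1)] key[OF this(2)] show "\<SS> \<in> sections G S" "P \<SS> \<longleftrightarrow> P \<TT>" by simp_all
qed

context comm_group
begin

lemma subgroup_closed:
  assumes "subgroup H G" "x \<in> H" "y \<in> H"
  shows "x \<otimes> y \<in> H" "inv x \<in> H"
  using assms by (simp_all add: subgroup.m_closed subgroup.m_inv_closed)

text \<open>Simplification with \<open>m_ac\<close> sorts the factors of a product, which may leave
  a factor and its inverse apart. These rules cancel the two when up to three factors stand between
  them, at the end of a product or inside it.\<close>

lemma comm_cancel0: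
  assumes "a \<in> carrier G" "x \<in> carrier G"
  shows "a \<otimes> (inv a \<otimes> x) = x" "inv a \<otimes> (a \<otimes> x) = x"
  using assms by (simp_all add: m_assoc[symmetric])

lemma comm_cancel1:
  assumes "a \<in> carrier G" "x \<in> carrier G" "y \<in> carrier G"
  shows "a \<otimes> (x \<otimes> inv a) = x" "inv a \<otimes> (x \<otimes> a) = x"
    "a \<otimes> (x \<otimes> (inv a \<otimes> y)) = x \<otimes> y" "inv a \<otimes> (x \<otimes> (a \<otimes> y)) = x \<otimes> y"
  using assms m_lcomm[of a x] m_lcomm[of "inv a" x] by (simp_all add: comm_cancel0)

lemma comm_cancel2:
  assumes "a \<in> carrier G" "x \<in> carrier G" "y \<in> carrier G" "z \<in> carrier G"
  shows "a \<otimes> (x \<otimes> (y \<otimes> inv a)) = x \<otimes> y" "inv a \<otimes> (x \<otimes> (y \<otimes> a)) = x \<otimes> y"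
    "a \<otimes> (x \<otimes> (y \<otimes> (inv a \<otimes> z))) = x \<otimes> (y \<otimes> z)" "inv a \<otimes> (x \<otimes> (y \<otimes> (a \<otimes> z))) = x \<otimes> (y \<otimes> z)"
  using assms m_lcomm[of a x] m_lcomm[of "inv a" x] by (simp_all add: comm_cancel1)

lemma comm_cancel3:
  assumes "a \<in> carrier G" "x \<in> carrier G" "y \<in> carrier G" "z \<in> carrier G" "w \<in> carrier G"
  shows "a \<otimes> (x \<otimes> (y \<otimes> (z \<otimes> inv a))) = x \<otimes> (y \<otimes> z)" "inv a \<otimes> (x \<otimes> (y \<otimes> (z \<otimes> a))) = x \<otimes> (y \<otimes> z)"
    "a \<otimes> (x \<otimes> (y \<otimes> (z \<otimes> (inv a \<otimes> w)))) = x \<otimes> (y \<otimes> (z \<otimes> w))"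
    "inv a \<otimes> (x \<otimes> (y \<otimes> (z \<otimes> (a \<otimes> w)))) = x \<otimes> (y \<otimes> (z \<otimes> w))"
  using assms m_lcomm[of a x] m_lcomm[of "inv a" x] by (simp_all add: comm_cancel2)

lemmas comm_cancel = comm_cancel0 comm_cancel1 comm_cancel2 comm_cancel3

end

locale circulant = comm_group G for G (structure) +
  fixes S
  assumes fin: "finite (carrier G)" and circ: "circulant_scheme G S"
begin

abbreviation V where "V \<equiv> carrier G"

lemma coherent: "coherent_configuration V S"
  using circ unfolding circulant_scheme_def by simp

lemma part: "partition_on (V \<times> V) S"
  using coherent unfolding coherent_configuration_def by simp

lemma basis_carrier: "s \<in> S \<Longrightarrow> (a, b) \<in> s \<Longrightarrow> a \<in> V \<and> b \<in> V"
  using nonempty_basis(2)[OF part] by blast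

lemma translate: "s \<in> S \<Longrightarrow> (a, b) \<in> s \<Longrightarrow> g \<in> V \<Longrightarrow> (a \<otimes> g, b \<otimes> g) \<in> s"
  using circ unfolding circulant_scheme_def by blast

text \<open>A basis relation is determined by the neighbours of \<open>\<one>\<close>, so statements
  about pairs become statements about group elements.\<close>

lemma translate_iff:
  assumes "s \<in> S" "a \<in> V" "b \<in> V"
  shows "(a, b) \<in> s \<longleftrightarrow> (\<one>, b \<otimes> inv a) \<in> s"
proof
  assume "(a, b) \<in> s"
  then show "(\<one>, b \<otimes> inv a) \<in> s" using translate[OF assms(1), of a b "inv a"] assms by simp
next
  assume "(\<one>, b \<otimes> inv a) \<in> s"
  then show "(a, b) \<in> s" using translate[OF assms(1), of \<one> "b \<otimes> inv a" a] assms by (simp add: m_assoc)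
qed

lemma basis_eq: "s \<in> S \<Longrightarrow> t \<in> S \<Longrightarrow> p \<in> s \<Longrightarrow> p \<in> t \<Longrightarrow> s = t"
  using partition_on_member_eq[OF part] .

lemma basis_obtain:
  assumes "a \<in> V" "b \<in> V"
  obtains s where "s \<in> S" "(a, b) \<in> s"
  using partition_on_obtain[OF part] assms by blast

lemma union_of_basis_closed:
  assumes "union_of_basis S r" "s \<in> S" "p \<in> s" "q \<in> s" "p \<in> r"
  shows "q \<in> r"
  using assms union_of_basis_iff[OF part, of r] by blast

text \<open>Whether two points are joined through given basis relations is the question whether an
  intersection number is nonzero, and this is constant along a basis relation.\<close>

lemma union_of_basis_comp:
  assumes "union_of_basis S r" "union_of_basis S r'"
  shows "union_of_basis S (r O r')"
  unfolding union_of_basis_iff[OF part]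
proof (intro conjI ballI impI)
  show "r O r' \<subseteq> V \<times> V" using assms unfolding union_of_basis_iff[OF part] by blast
  fix s assume s: "s \<in> S" "s \<inter> r O r' \<noteq> {}"
  then obtain a b c where abc: "(a, b) \<in> s" "(a, c) \<in> r" "(c, b) \<in> r'" by blast
  have O: "a \<in> V" "b \<in> V" using basis_carrier[OF s(1) abc(1)] by auto
  have c: "c \<in> V" using abc assms unfolding union_of_basis_iff[OF part] by blast
  obtain s1 where s1: "s1 \<in> S" "(a, c) \<in> s1" using basis_obtain[OF O(1) c] by blast
  obtain s2 where s2: "s2 \<in> S" "(c, b) \<in> s2" using basis_obtain[OF c O(2)] by blast
  show "s \<subseteq> r O r'"
  proof (rule subrelI)
    fix a' b' assume ab': "(a', b') \<in> s"
    have "card {\<gamma> \<in> V. (a', \<gamma>) \<in> s1 \<and> (\<gamma>, b') \<in> s2} = card {\<gamma> \<in> V. (a, \<gamma>) \<in> s1 \<and> (\<gamma>, b) \<in> s2}"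
      using intersection_number_eq[OF coherent s1(1) s2(1) s(1) abc(1)]
        intersection_number_eq[OF coherent s1(1) s2(1) s(1) ab'] by (simp only:)
    moreover have "c \<in> {\<gamma> \<in> V. (a, \<gamma>) \<in> s1 \<and> (\<gamma>, b) \<in> s2}" using s1 s2 c by blast
    then have "card {\<gamma> \<in> V. (a, \<gamma>) \<in> s1 \<and> (\<gamma>, b) \<in> s2} > 0" using fin by (auto simp: card_gt_0_iff)
    ultimately have "{\<gamma> \<in> V. (a', \<gamma>) \<in> s1 \<and> (\<gamma>, b') \<in> s2} \<noteq> {}" by (metis card.empty less_irrefl)
    then obtain c' where "(a', c') \<in> s1" "(c', b') \<in> s2" by blast
    then show "(a', b') \<in> r O r'"
      using union_of_basis_closed[OF assms(1) s1] union_of_basis_closed[OF assms(2) s2] abc by blast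
  qed
qed

lemma coset_equiv_iff:
  assumes "subgroup H G"
  shows "(a, b) \<in> coset_equiv G H \<longleftrightarrow> a \<in> V \<and> b \<in> V \<and> a \<otimes> inv b \<in> H"
  unfolding coset_equiv_def using coset_eq_iff[OF assms] by auto

lemma scheme_group_subgroup: "scheme_group G S H \<Longrightarrow> subgroup H G"
  unfolding scheme_group_def by simp

lemma scheme_group_cong:
  assumes "scheme_group G S H" "s \<in> S" "(a, b) \<in> s" "(a', b') \<in> s"
  shows "a \<otimes> inv b \<in> H \<longleftrightarrow> a' \<otimes> inv b' \<in> H"
proof -
  have H: "subgroup H G" "union_of_basis S (coset_equiv G H)" using assms(1) unfolding scheme_group_def by auto
  show ?thesis
    using union_of_basis_closed[OF H(2) assms(2,3,4)] union_of_basis_closed[OF H(2) assms(2,4,3)]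
      coset_equiv_iff[OF H(1)] basis_carrier[OF assms(2,3)] basis_carrier[OF assms(2,4)] by blast
qed

lemma scheme_group_closed:
  assumes "scheme_group G S H" "s \<in> S" "(\<one>, a) \<in> s" "(\<one>, b) \<in> s" "a \<in> H"
  shows "b \<in> H"
proof -
  have H: "subgroup H G" using scheme_group_subgroup[OF assms(1)] .
  have ab: "a \<in> V" "b \<in> V" using basis_carrier assms by blast+
  have "inv a \<in> H" using subgroup.m_inv_closed[OF H assms(5)] .
  then have "inv b \<in> H" using scheme_group_cong[OF assms(1-4)] ab by simp
  then show ?thesis using subgroup.m_inv_closed[OF H, of "inv b"] ab by simp
qed

text \<open>The composition of \<open>t\<close> with \<open>coset_equiv G L\<close> is a union of
  basis relations and contains \<open>(\<one>, a)\<close>, so it contains all of \<open>s\<close>.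
  This is the means of passing between elements that agree modulo \<open>L\<close>.\<close>

lemma basis_mod_subgroup:
  assumes "scheme_group G S L" "s \<in> S" "t \<in> S" "l \<in> L" "a \<in> V"
    "(\<one>, a) \<in> s" "(\<one>, b) \<in> s" "(\<one>, a \<otimes> l) \<in> t"
  shows "\<exists>l'\<in>L. (\<one>, b \<otimes> l') \<in> t"
proof -
  have L: "subgroup L G" "union_of_basis S (coset_equiv G L)" using assms(1) unfolding scheme_group_def by auto
  have lO: "l \<in> V" using assms(4) subgroup.subset[OF L(1)] by blast
  have bO: "b \<in> V" using basis_carrier assms by blast
  have "union_of_basis S t" unfolding union_of_basis_def using assms(3) by (intro exI[of _ "{t}"]) auto
  then have un: "union_of_basis S (t O coset_equiv G L)" using union_of_basis_comp L(2) by blast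
  have "(a \<otimes> l) \<otimes> inv a = l" using assms(5) lO by (simp add: m_ac comm_cancel)
  then have "(a \<otimes> l, a) \<in> coset_equiv G L" using coset_equiv_iff[OF L(1)] assms(4,5) lO by simp
  then have "(\<one>, a) \<in> t O coset_equiv G L" using assms(8) by blast
  then have "(\<one>, b) \<in> t O coset_equiv G L" using union_of_basis_closed[OF un assms(2,6,7)] by blast
  then obtain c where c: "(\<one>, c) \<in> t" "(c, b) \<in> coset_equiv G L" by blast
  have cO: "c \<in> V" using basis_carrier[OF assms(3) c(1)] by simp
  have "b \<otimes> (c \<otimes> inv b) = c" using bO cO by (simp add: comm_cancel)
  then show ?thesis using c coset_equiv_iff[OF L(1)] by metis
qed

text \<open>Regularity, and below triviality, of a section is restated for neighbours of
  \<open>\<one>\<close> inside \<open>G\<close>, so that sections with different point sets can be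
  compared.\<close>

definition sec_regular :: "'a set \<times> 'a set \<Rightarrow> bool" where
  "sec_regular \<SS> \<longleftrightarrow> (\<forall>s\<in>S. \<forall>a\<in>fst \<SS>. \<forall>b. (\<one>, a) \<in> s \<longrightarrow> (\<one>, b) \<in> s \<longrightarrow> a \<otimes> inv b \<in> snd \<SS>)"

definition sec_trivial :: "'a set \<times> 'a set \<Rightarrow> bool" where
  "sec_trivial \<SS> \<longleftrightarrow> (\<forall>a\<in>fst \<SS> - snd \<SS>. \<forall>b\<in>fst \<SS> - snd \<SS>. \<exists>s\<in>S. \<exists>l\<in>snd \<SS>. (\<one>, a) \<in> s \<and> (\<one>, b \<otimes> l) \<in> s)"

lemma multipleE:
  assumes "(U, L) \<in> sections G S" "(U', L') \<in> sections G S" "multiple_of G (U, L) (U', L')"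
  shows "L' = U' \<inter> L" "U' \<subseteq> U" "\<And>a. a \<in> U \<Longrightarrow> \<exists>u\<in>U'. \<exists>l\<in>L. a = u \<otimes> l"
proof -
  have sub: "subgroup L G" "subgroup U' G" using assms(1,2) unfolding sections_def scheme_group_def by auto
  have m: "L' = U' \<inter> L" "U = U' <#> L" using assms(3) unfolding multiple_of_def by auto
  show "L' = U' \<inter> L" by fact
  show *: "\<exists>u\<in>U'. \<exists>l\<in>L. a = u \<otimes> l" if "a \<in> U" for a using that m(2) unfolding set_mult_def by blast
  show "U' \<subseteq> U"
  proof
    fix a assume a: "a \<in> U'"
    then have "a \<otimes> \<one> \<in> U' <#> L" using subgroup.one_closed[OF sub(1)] unfolding set_mult_def by blast
    then show "a \<in> U" using m(2) subgroup.mem_carrier[OF sub(2) a] by simp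
  qed
qed

text \<open>By the second isomorphism theorem \<open>U'/L'\<close> is \<open>U/L\<close>: every
  element of \<open>U\<close> agrees modulo \<open>L\<close> with an element of \<open>U'\<close>,
  and on \<open>U'\<close> membership in \<open>L\<close> is membership in
  \<open>L'\<close>.\<close>

lemma sec_regular_multiple:
  assumes "(U, L) \<in> sections G S" "(U', L') \<in> sections G S" "multiple_of G (U, L) (U', L')"
  shows "sec_regular (U, L) \<longleftrightarrow> sec_regular (U', L')"
proof
  have sg: "scheme_group G S L" "scheme_group G S U'" using assms(1,2) unfolding sections_def by auto
  have sub: "subgroup L G" "subgroup U' G" using sg scheme_group_subgroup by auto
  note m = multipleE[OF assms]
  show "sec_regular (U', L')" if reg: "sec_regular (U, L)"
    unfolding sec_regular_def
  proof (intro ballI allI impI, simp)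
    fix s a b assume s: "s \<in> S" "a \<in> U'" "(\<one>, a) \<in> s" "(\<one>, b) \<in> s"
    have "a \<otimes> inv b \<in> L" using reg s m(2) unfolding sec_regular_def by auto
    moreover have "b \<in> U'" using scheme_group_closed[OF sg(2) s(1,3,4,2)] .
    then have "a \<otimes> inv b \<in> U'" using s(2) sub(2) by (simp add: subgroup.m_closed subgroup.m_inv_closed)
    ultimately show "a \<otimes> inv b \<in> L'" using m(1) by blast
  qed
  show "sec_regular (U, L)" if reg: "sec_regular (U', L')"
    unfolding sec_regular_def
  proof (intro ballI allI impI, simp)
    fix s a b assume s: "s \<in> S" "a \<in> U" "(\<one>, a) \<in> s" "(\<one>, b) \<in> s"
    obtain u l where u: "u \<in> U'" "l \<in> L" "a = u \<otimes> l" using m(3) s(2) by blast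
    have O: "u \<in> V" "l \<in> V" "a \<in> V" "b \<in> V"
      using u sub subgroup.mem_carrier basis_carrier s by metis+
    \<comment> \<open>Regularity is known only inside \<open>U'\<close>, so \<open>a\<close> is
      replaced by its part \<open>u\<close>; \<open>basis_mod_subgroup\<close> moves
      \<open>b\<close> along modulo \<open>L\<close>.\<close>
    obtain t where t: "t \<in> S" "(\<one>, u) \<in> t" using basis_obtain[OF one_closed O(1)] by blast
    have il: "inv l \<in> L" using subgroup.m_inv_closed[OF sub(1) u(2)] .
    have "a \<otimes> inv l = u" using u O by (simp add: m_assoc)
    then obtain l' where l': "l' \<in> L" "(\<one>, b \<otimes> l') \<in> t"
      using basis_mod_subgroup[OF sg(1) s(1) t(1) il O(3) s(3,4)] t(2) by auto
    have l'O: "l' \<in> V" using l' sub subgroup.mem_carrier by metis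
    have "u \<otimes> inv (b \<otimes> l') \<in> L" using reg t u(1) l' m(1) unfolding sec_regular_def by auto
    then have "u \<otimes> inv (b \<otimes> l') \<otimes> (l \<otimes> l') \<in> L"
      using l' u(2) sub(1) by (simp add: subgroup.m_closed)
    moreover have "u \<otimes> inv (b \<otimes> l') \<otimes> (l \<otimes> l') = a \<otimes> inv b"
      using O l'O u(3) by (simp add: inv_mult m_ac comm_cancel)
    ultimately show "a \<otimes> inv b \<in> L" by simp
  qed
qed

lemma sec_trivial_multiple:
  assumes "(U, L) \<in> sections G S" "(U', L') \<in> sections G S" "multiple_of G (U, L) (U', L')"
  shows "sec_trivial (U, L) \<longleftrightarrow> sec_trivial (U', L')"
proof
  have sg: "scheme_group G S L" "scheme_group G S U'" using assms(1,2) unfolding sections_def by auto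
  have sub: "subgroup L G" "subgroup U' G" using sg scheme_group_subgroup by auto
  note m = multipleE[OF assms]
  show "sec_trivial (U', L')" if tr: "sec_trivial (U, L)"
    unfolding sec_trivial_def fst_conv snd_conv
  proof (intro ballI)
    fix a b assume ab: "a \<in> U' - L'" "b \<in> U' - L'"
    then have "a \<in> U - L" "b \<in> U - L" using m by auto
    then obtain s l where s: "s \<in> S" "l \<in> L" "(\<one>, a) \<in> s" "(\<one>, b \<otimes> l) \<in> s"
      using tr unfolding sec_trivial_def by fastforce
    have O: "b \<in> V" "l \<in> V" using ab s(2) sub subgroup.mem_carrier by (metis DiffD1)+
    \<comment> \<open>Closure of \<open>U'\<close> puts the correcting factor \<open>l\<close> into
      \<open>U'\<close>, hence into \<open>L'\<close>.\<close>
    have "b \<otimes> l \<in> U'" using scheme_group_closed[OF sg(2) s(1,3,4)] ab by blast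
    then have "inv b \<otimes> (b \<otimes> l) \<in> U'"
      using ab sub(2) by (simp add: subgroup.m_closed subgroup.m_inv_closed)
    then have "l \<in> U'" using O by (simp add: m_assoc[symmetric])
    then show "\<exists>s\<in>S. \<exists>l\<in>L'. (\<one>, a) \<in> s \<and> (\<one>, b \<otimes> l) \<in> s" using s m(1) by blast
  qed
  show "sec_trivial (U, L)" if tr: "sec_trivial (U', L')"
    unfolding sec_trivial_def fst_conv snd_conv
  proof (intro ballI)
    fix a b assume ab: "a \<in> U - L" "b \<in> U - L"
    obtain u l where u: "u \<in> U'" "l \<in> L" "a = u \<otimes> l" using m(3) ab by blast
    obtain v k where v: "v \<in> U'" "k \<in> L" "b = v \<otimes> k" using m(3) ab by blast
    have "u \<notin> L" "v \<notin> L" using ab u v subgroup.m_closed[OF sub(1)] by auto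
    then have "u \<in> U' - L'" "v \<in> U' - L'" using u v m(1) by auto
    then obtain s l' where s: "s \<in> S" "l' \<in> L'" "(\<one>, u) \<in> s" "(\<one>, v \<otimes> l') \<in> s"
      using tr unfolding sec_trivial_def by fastforce
    have l'L: "l' \<in> L" using s(2) m(1) by blast
    have O: "u \<in> V" "v \<in> V" "l \<in> V" "k \<in> V" "l' \<in> V" using u v l'L sub subgroup.mem_carrier by metis+
    \<comment> \<open>Triviality was used for the parts \<open>u\<close> and \<open>v\<close> in
      \<open>U'\<close>; passing from \<open>u\<close> to \<open>a\<close> carries
      \<open>v \<otimes> l'\<close> to an element that still agrees with \<open>b\<close> modulo
      \<open>L\<close>.\<close>
    obtain t where t: "t \<in> S" "(\<one>, a) \<in> t" using basis_obtain[OF one_closed, of a] u O by auto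
    obtain l'' where l'': "l'' \<in> L" "(\<one>, v \<otimes> l' \<otimes> l'') \<in> t"
      using basis_mod_subgroup[OF sg(1) s(1) t(1) u(2) O(1) s(3,4)] t(2) u(3) by auto
    have O'': "l'' \<in> V" using l'' sub subgroup.mem_carrier by metis
    have "v \<otimes> l' \<otimes> l'' = b \<otimes> (inv k \<otimes> l' \<otimes> l'')"
      unfolding v(3) using O O'' by (simp add: m_ac comm_cancel)
    moreover have "inv k \<otimes> l' \<otimes> l'' \<in> L"
      using v(2) l'L l'' sub(1) by (simp add: subgroup.m_closed subgroup.m_inv_closed)
    ultimately show "\<exists>s\<in>S. \<exists>l\<in>L. (\<one>, a) \<in> s \<and> (\<one>, b \<otimes> l) \<in> s" using t l''(2) by metis
  qed
qed

end

section \<open>Section schemes in terms of neighbours of the identity\<close>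

context circulant
begin

lemma section_points_eq: "section_points G (U, L) = (\<lambda>a. L #> a) ` U"
  unfolding section_points_def RCOSETS_def r_coset_def by auto

lemma coset_pair_basis:
  assumes "subgroup L G" "s \<in> S" "a \<in> V" "b \<in> V"
  shows "s \<inter> ((L #> a) \<times> (L #> b)) \<noteq> {} \<longleftrightarrow> (\<exists>l\<in>L. (\<one>, b \<otimes> inv a \<otimes> l) \<in> s)"
proof
  assume "s \<inter> ((L #> a) \<times> (L #> b)) \<noteq> {}"
  then obtain p q where pq: "(p, q) \<in> s" "p \<in> L #> a" "q \<in> L #> b" by blast
  have O: "p \<in> V" "q \<in> V" using basis_carrier[OF assms(2) pq(1)] by auto
  have "p \<otimes> inv a \<in> L" "q \<otimes> inv b \<in> L" using pq mem_coset_iff[OF assms(1)] O assms(3,4) by auto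
  then have "(q \<otimes> inv b) \<otimes> inv (p \<otimes> inv a) \<in> L"
    using assms(1) by (simp add: subgroup.m_closed subgroup.m_inv_closed)
  moreover have "q \<otimes> inv p = b \<otimes> inv a \<otimes> ((q \<otimes> inv b) \<otimes> inv (p \<otimes> inv a))"
    using O assms(3,4) by (simp add: inv_mult m_ac comm_cancel)
  ultimately show "\<exists>l\<in>L. (\<one>, b \<otimes> inv a \<otimes> l) \<in> s" using translate_iff[OF assms(2) O] pq(1) by metis
next
  assume "\<exists>l\<in>L. (\<one>, b \<otimes> inv a \<otimes> l) \<in> s"
  then obtain l where l: "l \<in> L" "(\<one>, b \<otimes> inv a \<otimes> l) \<in> s" by blast
  have lO: "l \<in> V" using subgroup.mem_carrier[OF assms(1) l(1)] .
  have "(\<one> \<otimes> a, b \<otimes> inv a \<otimes> l \<otimes> a) \<in> s" using translate[OF assms(2) l(2) assms(3)] .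
  moreover have "b \<otimes> inv a \<otimes> l \<otimes> a = l \<otimes> b" using assms(3,4) lO by (simp add: m_ac comm_cancel)
  ultimately have "(a, l \<otimes> b) \<in> s" using assms(3) by simp
  moreover have "a \<in> L #> a" using rcos_self[OF assms(3,1)] .
  moreover have "l \<otimes> b \<in> L #> b" using l(1) unfolding r_coset_def by blast
  ultimately show "s \<inter> ((L #> a) \<times> (L #> b)) \<noteq> {}" by blast
qed

lemma sectionD:
  assumes "(U, L) \<in> sections G S"
  shows "scheme_group G S U" "scheme_group G S L" "subgroup U G" "subgroup L G" "L \<subseteq> U" "U \<subseteq> V"
proof -
  show s: "scheme_group G S U" "scheme_group G S L" "L \<subseteq> U" using assms unfolding sections_def by auto
  show "subgroup U G" "subgroup L G" using s scheme_group_subgroup by auto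
  then show "U \<subseteq> V" using subgroup.subset by blast
qed

lemma section_relation:
  assumes "(U, L) \<in> sections G S" "s \<in> S"
    "r = {(\<Gamma>, \<Gamma>') \<in> section_points G (U, L) \<times> section_points G (U, L). s \<inter> (\<Gamma> \<times> \<Gamma>') \<noteq> {}}"
    "a \<in> U" "b \<in> U"
  shows "(L #> a, L #> b) \<in> r \<longleftrightarrow> (\<exists>l\<in>L. (\<one>, b \<otimes> inv a \<otimes> l) \<in> s)"
proof -
  note sec = sectionD[OF assms(1)]
  have "a \<in> V" "b \<in> V" using assms(4,5) sec(6) by auto
  from coset_pair_basis[OF sec(4) assms(2) this]
  show ?thesis unfolding assms(3) section_points_eq using assms(4,5) by blast
qed

lemma sec_regular_iff:
  assumes "(U, L) \<in> sections G S"
  shows "regular_scheme (section_points G (U, L)) (section_scheme G S (U, L)) \<longleftrightarrow> sec_regular (U, L)"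
proof
  note sec = sectionD[OF assms]
  assume reg: "regular_scheme (section_points G (U, L)) (section_scheme G S (U, L))"
  show "sec_regular (U, L)"
    unfolding sec_regular_def fst_conv snd_conv
  proof (intro ballI allI impI)
    fix s a b assume s: "s \<in> S" "a \<in> U" "(\<one>, a) \<in> s" "(\<one>, b) \<in> s"
    define r where "r = {(\<Gamma>, \<Gamma>') \<in> section_points G (U, L) \<times> section_points G (U, L). s \<inter> (\<Gamma> \<times> \<Gamma>') \<noteq> {}}"
    have U: "\<one> \<in> U" "b \<in> U" using subgroup.one_closed[OF sec(3)] scheme_group_closed[OF sec(1) s(1,3,4,2)] by auto
    have O: "a \<in> V" "b \<in> V" using s U sec(6) by auto
    have "r \<in> section_scheme G S (U, L)" unfolding section_scheme_def r_def using s U by auto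
    moreover have "L #> \<one> \<in> section_points G (U, L)" unfolding section_points_eq using U by blast
    ultimately have card: "card {\<beta>. (L #> \<one>, \<beta>) \<in> r} = 1" using reg unfolding regular_scheme_def by blast
    have one: "\<one> \<in> L" using subgroup.one_closed[OF sec(4)] .
    have "(L #> \<one>, L #> a) \<in> r" "(L #> \<one>, L #> b) \<in> r"
      using section_relation[OF assms s(1) r_def U(1)] s(2-4) U(2) one O by (auto intro!: bexI[of _ \<one>])
    then have "L #> a = L #> b" using card by (metis (mono_tags, lifting) card_1_singletonE mem_Collect_eq singletonD)
    then show "a \<otimes> inv b \<in> L" using coset_eq_iff[OF sec(4) O] by simp
  qed
next
  note sec = sectionD[OF assms]
  assume reg: "sec_regular (U, L)"
  show "regular_scheme (section_points G (U, L)) (section_scheme G S (U, L))"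
    unfolding regular_scheme_def
  proof (intro ballI)
    fix r \<Gamma> assume r: "r \<in> section_scheme G S (U, L)" and \<Gamma>: "\<Gamma> \<in> section_points G (U, L)"
    obtain s where s: "s \<in> S" "s \<inter> (U \<times> U) \<noteq> {}" and r_def:
      "r = {(\<Gamma>, \<Gamma>') \<in> section_points G (U, L) \<times> section_points G (U, L). s \<inter> (\<Gamma> \<times> \<Gamma>') \<noteq> {}}"
      using r unfolding section_scheme_def by auto
    obtain p q where pq: "(p, q) \<in> s" "p \<in> U" "q \<in> U" using s(2) by blast
    obtain g where g: "g \<in> U" "\<Gamma> = L #> g" using \<Gamma> unfolding section_points_eq by blast
    \<comment> \<open>A pair of \<open>s\<close> inside \<open>U\<close> is translated to
      \<open>\<one>\<close>; the unique neighbour of the coset of \<open>g\<close> will be that of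
      \<open>a \<otimes> g\<close>.\<close>
    define a where "a = q \<otimes> inv p"
    have O: "p \<in> V" "q \<in> V" "g \<in> V" using pq g sec(6) by auto
    have aU: "a \<in> U" unfolding a_def using pq sec(3) by (simp add: subgroup.m_closed subgroup.m_inv_closed)
    then have aO: "a \<in> V" using sec(6) by blast
    have as: "(\<one>, a) \<in> s" using translate_iff[OF s(1) O(1,2)] pq(1) unfolding a_def by simp
    have agU: "a \<otimes> g \<in> U" using aU g(1) sec(3) by (simp add: subgroup.m_closed)
    have iff: "(L #> g, L #> h) \<in> r \<longleftrightarrow> L #> h = L #> (a \<otimes> g)" if h: "h \<in> U" for h
    proof -
      have hO: "h \<in> V" using h sec(6) by blast
      have "(L #> g, L #> h) \<in> r \<longleftrightarrow> (\<exists>l\<in>L. (\<one>, h \<otimes> inv g \<otimes> l) \<in> s)"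
        using section_relation[OF assms s(1) r_def g(1) h] .
      also have "\<dots> \<longleftrightarrow> a \<otimes> g \<otimes> inv h \<in> L"
      proof
        assume "\<exists>l\<in>L. (\<one>, h \<otimes> inv g \<otimes> l) \<in> s"
        then obtain l where l: "l \<in> L" "(\<one>, h \<otimes> inv g \<otimes> l) \<in> s" by blast
        have lO: "l \<in> V" using subgroup.mem_carrier[OF sec(4) l(1)] .
        have "a \<otimes> inv (h \<otimes> inv g \<otimes> l) \<in> L" using reg s(1) aU as l(2) unfolding sec_regular_def by simp
        then have "a \<otimes> inv (h \<otimes> inv g \<otimes> l) \<otimes> l \<in> L" using l(1) sec(4) by (simp add: subgroup.m_closed)
        moreover have "a \<otimes> inv (h \<otimes> inv g \<otimes> l) \<otimes> l = a \<otimes> g \<otimes> inv h"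
          using aO hO O lO by (simp add: inv_mult m_ac comm_cancel)
        ultimately show "a \<otimes> g \<otimes> inv h \<in> L" by simp
      next
        assume L: "a \<otimes> g \<otimes> inv h \<in> L"
        have "h \<otimes> inv g \<otimes> (a \<otimes> g \<otimes> inv h) = a" using aO hO O by (simp add: m_ac comm_cancel)
        then show "\<exists>l\<in>L. (\<one>, h \<otimes> inv g \<otimes> l) \<in> s" using L as by metis
      qed
      also have "\<dots> \<longleftrightarrow> L #> (a \<otimes> g) = L #> h" using coset_eq_iff[OF sec(4) _ hO, of "a \<otimes> g"] aO O by simp
      finally show ?thesis by auto
    qed
    have "{\<beta>. (\<Gamma>, \<beta>) \<in> r} = {L #> (a \<otimes> g)}"
    proof
      show "{\<beta>. (\<Gamma>, \<beta>) \<in> r} \<subseteq> {L #> (a \<otimes> g)}"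
      proof
        fix \<beta> assume "\<beta> \<in> {\<beta>. (\<Gamma>, \<beta>) \<in> r}"
        moreover from this obtain h where "h \<in> U" "\<beta> = L #> h" unfolding r_def section_points_eq by blast
        ultimately show "\<beta> \<in> {L #> (a \<otimes> g)}" using iff g by simp
      qed
      show "{L #> (a \<otimes> g)} \<subseteq> {\<beta>. (\<Gamma>, \<beta>) \<in> r}" using iff[OF agU] g by simp
    qed
    then show "card {\<beta>. (\<Gamma>, \<beta>) \<in> r} = 1" by simp
  qed
qed

text \<open>The relation joining the coset of \<open>\<one>\<close> to that of \<open>a\<close> is
  off the diagonal, so triviality makes it the full complement, which also joins the coset of
  \<open>\<one>\<close> to that of \<open>b\<close>.\<close>

lemma trivial_section_imp:
  assumes "(U, L) \<in> sections G S" "trivial_section G S (U, L)"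
  shows "sec_trivial (U, L)"
  unfolding sec_trivial_def fst_conv snd_conv
proof (intro ballI)
  note sec = sectionD[OF assms(1)]
  fix a b assume ab: "a \<in> U - L" "b \<in> U - L"
  have one: "\<one> \<in> U" "\<one> \<in> L" using subgroup.one_closed sec(3,4) by auto
  have O: "a \<in> V" "b \<in> V" using ab sec(6) by auto
  obtain s where s: "s \<in> S" "(\<one>, a) \<in> s" using basis_obtain[OF one_closed O(1)] by blast
  define r where "r = {(\<Gamma>, \<Gamma>') \<in> section_points G (U, L) \<times> section_points G (U, L). s \<inter> (\<Gamma> \<times> \<Gamma>') \<noteq> {}}"
  have rS: "r \<in> section_scheme G S (U, L)" unfolding section_scheme_def r_def using s one ab by auto
  note rel = section_relation[OF assms(1) s(1) r_def one(1)]
  have ra: "(L #> \<one>, L #> a) \<in> r" using rel[of a] ab s(2) one O by (auto intro!: bexI[of _ \<one>])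
  have ne: "L #> \<one> \<noteq> L #> c" if "c \<in> U - L" for c
  proof
    have cO: "c \<in> V" using that sec(6) by blast
    assume "L #> \<one> = L #> c"
    then have "c \<otimes> inv \<one> \<in> L" using coset_eq_iff[OF sec(4) cO one_closed] by simp
    then show False using that cO by simp
  qed
  have "r \<noteq> Id_on (section_points G (U, L))" using ra ne[OF ab(1)] by (auto simp: Id_on_def)
  then have "r = section_points G (U, L) \<times> section_points G (U, L) - Id_on (section_points G (U, L))"
    using assms(2) rS unfolding trivial_section_def trivial_scheme_def by blast
  moreover have "(L #> \<one>, L #> b) \<in> section_points G (U, L) \<times> section_points G (U, L)"
    unfolding section_points_eq using one ab by blast
  ultimately have "(L #> \<one>, L #> b) \<in> r" using ne[OF ab(2)] by (auto simp: Id_on_def)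
  then have "\<exists>l\<in>L. (\<one>, b \<otimes> l) \<in> s" using rel[of b] ab O by simp
  then show "\<exists>s\<in>S. \<exists>l\<in>L. (\<one>, a) \<in> s \<and> (\<one>, b \<otimes> l) \<in> s" using s by blast
qed

lemma coset_set_mult:
  assumes "subgroup L G" "a \<in> V" "b \<in> V"
  shows "(L #> a) <#> (L #> b) = L #> (a \<otimes> b)"
proof -
  interpret normal L G using subgroup_imp_normal[OF assms(1)] .
  show ?thesis using rcos_sum[OF assms(2,3)] .
qed

end

section \<open>Singular classes\<close>

text \<open>The data of (S1) and (S2). A singular class has triviality at some section; here it is
  placed on \<open>L1/L0\<close>, where \<open>sec_trivial_multiple\<close> allows it to be
  moved.\<close>

locale singular = circulant +
  fixes U1 U0 L1 L0
  assumes secL: "(L1, L0) \<in> sections G S" and secU: "(U1, U0) \<in> sections G S"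
    and mult: "multiple_of G (U1, U0) (L1, L0)"
    and cond0: "section_condition G S U0 L0" and cond1: "section_condition G S U1 L1"
    and tensor: "section_scheme G S (U1, L0) =
      internal_tensor G (section_scheme G S (L1, L0)) (section_scheme G S (U0, L0))"
    and triv: "sec_trivial (L1, L0)"
begin

lemmas Lsec = sectionD[OF secL]
lemmas Usec = sectionD[OF secU]
lemmas LU = multipleE[OF secU secL mult]

lemma L0_U0: "L0 \<subseteq> U0" using LU(1) by blast

lemma carriers:
  "a \<in> L0 \<Longrightarrow> a \<in> V" "a \<in> L1 \<Longrightarrow> a \<in> V" "a \<in> U0 \<Longrightarrow> a \<in> V" "a \<in> U1 \<Longrightarrow> a \<in> V"
  using Lsec(3,4) Usec(3,4) subgroup.mem_carrier by metis+

lemma sec10: "(U1, L0) \<in> sections G S" "(U0, L0) \<in> sections G S"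
  using secL secU L0_U0 unfolding sections_def by auto

text \<open>Pointwise form of the condition: outside \<open>coset_equiv G U\<close> a basis relation
  is a union of products of \<open>L\<close>-cosets, so both ends may be moved modulo
  \<open>L\<close>.\<close>

lemma section_condition_mem:
  assumes "section_condition G S U L" "subgroup U G" "subgroup L G" "scheme_group G S U"
    and "s \<in> S" "(a, b) \<in> s" "a \<otimes> inv b \<notin> U"
    and "a' \<in> V" "b' \<in> V" "a' \<otimes> inv a \<in> L" "b \<otimes> inv b' \<in> L"
  shows "(a', b') \<in> s"
proof -
  have O: "a \<in> V" "b \<in> V" using basis_carrier[OF assms(5,6)] by auto
  have "s \<inter> coset_equiv G U = {}"
  proof (rule ccontr)
    assume "s \<inter> coset_equiv G U \<noteq> {}"
    then obtain p q where "(p, q) \<in> s" "(p, q) \<in> coset_equiv G U" by auto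
    then show False
      using scheme_group_cong[OF assms(4,5,6)] coset_equiv_iff[OF assms(2)] assms(7) by blast
  qed
  then have eq: "coset_equiv G L O s = s" "s O coset_equiv G L = s"
    using assms(1,5) unfolding section_condition_def by auto
  have "(a', a) \<in> coset_equiv G L" "(b, b') \<in> coset_equiv G L"
    using coset_equiv_iff[OF assms(3)] assms(8-11) O by auto
  then have "(a', b) \<in> s" using eq(1) assms(6) by blast
  then show ?thesis using eq(2) \<open>(b, b') \<in> coset_equiv G L\<close> by blast
qed

text \<open>The two elements are \<open>l1 \<otimes> u\<close> and \<open>l2 \<otimes> u\<close>
  with a common factor \<open>u\<close> in \<open>U0\<close>. Over \<open>U1/L0\<close> the relation
  of \<open>a\<close> is by (S2) a product of a relation for \<open>L1/L0\<close> and one for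
  \<open>U0/L0\<close>, and by triviality the first does not distinguish \<open>l1\<close> from
  \<open>l2\<close>. This yields \<open>b\<close> modulo \<open>L0\<close>, and the
  \<open>U0/L0\<close>-condition removes the error because \<open>b\<close> is outside
  \<open>U0\<close>.\<close>

lemma same_basis:
  assumes a: "a \<in> U1 - U0" and b: "b \<in> U1 - U0" and ab: "a \<otimes> inv b \<in> L1" and s: "s \<in> S" "(\<one>, a) \<in> s"
  shows "(\<one>, b) \<in> s"
proof -
  have abO: "a \<in> V" "b \<in> V" using a b carriers by auto
  obtain l1 u where lu: "l1 \<in> L1" "u \<in> U0" "a = l1 \<otimes> u" using LU(3)[of a] a by blast
  define l2 where "l2 = b \<otimes> inv u"
  have luO: "l1 \<in> V" "u \<in> V" "l2 \<in> V" using lu carriers abO unfolding l2_def by auto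
  have bl: "b = l2 \<otimes> u" unfolding l2_def using abO luO by (simp add: m_ac comm_cancel)
  have l2_eq: "l2 = inv (a \<otimes> inv b) \<otimes> l1"
    unfolding l2_def lu(3) using abO luO by (simp add: inv_mult m_ac comm_cancel)
  have l2: "l2 \<in> L1" unfolding l2_eq using ab lu(1) Lsec(3) by (simp add: subgroup.m_closed subgroup.m_inv_closed)
  note U0m = subgroup_closed[OF Usec(4)]
  note L1m = subgroup_closed[OF Lsec(3)]
  note L0m = subgroup_closed[OF Lsec(4)]
  have nl: "l1 \<notin> L0" "l2 \<notin> L0" using a b lu bl L0_U0 U0m by auto
  have ones: "\<one> \<in> L0" "\<one> \<in> U1" "\<one> \<in> U0" "\<one> \<in> L1"
    using Lsec(3,4) Usec(3,4) subgroup.one_closed by metis+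
  define r where "r = {(\<Gamma>, \<Gamma>') \<in> section_points G (U1, L0) \<times> section_points G (U1, L0). s \<inter> (\<Gamma> \<times> \<Gamma>') \<noteq> {}}"
  note rel = section_relation[OF sec10(1) s(1) r_def ones(2)]
  have "r \<in> section_scheme G S (U1, L0)" unfolding section_scheme_def r_def using s ones a by auto
  then obtain s' t' where st: "s' \<in> section_scheme G S (L1, L0)" "t' \<in> section_scheme G S (U0, L0)"
    and r_eq: "r = {(\<Gamma> <#> \<Delta>, \<Gamma>' <#> \<Delta>') | \<Gamma> \<Gamma>' \<Delta> \<Delta>'. (\<Gamma>, \<Gamma>') \<in> s' \<and> (\<Delta>, \<Delta>') \<in> t'}"
    unfolding tensor internal_tensor_def by blast
  obtain s1 where s1: "s1 \<in> S"
    "s' = {(\<Gamma>, \<Gamma>') \<in> section_points G (L1, L0) \<times> section_points G (L1, L0). s1 \<inter> (\<Gamma> \<times> \<Gamma>') \<noteq> {}}"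
    using st(1) unfolding section_scheme_def by auto
  have t'sub: "t' \<subseteq> section_points G (U0, L0) \<times> section_points G (U0, L0)"
    using st(2) unfolding section_scheme_def by auto
  have "(L0 #> \<one>, L0 #> a) \<in> r" using rel[of a] a s(2) ones abO by (auto intro!: bexI[of _ \<one>])
  then obtain \<Gamma> \<Gamma>' \<Delta> \<Delta>' where GD: "L0 #> \<one> = \<Gamma> <#> \<Delta>" "L0 #> a = \<Gamma>' <#> \<Delta>'" "(\<Gamma>, \<Gamma>') \<in> s'" "(\<Delta>, \<Delta>') \<in> t'"
    unfolding r_eq by auto
  obtain c c' where c: "c \<in> L1" "c' \<in> L1" "\<Gamma> = L0 #> c" "\<Gamma>' = L0 #> c'"
    using GD(3) unfolding s1(2) section_points_eq by blast
  obtain e e' where e: "e \<in> U0" "e' \<in> U0" "\<Delta> = L0 #> e" "\<Delta>' = L0 #> e'"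
    using GD(4) t'sub unfolding section_points_eq by blast
  have ceO: "c \<in> V" "c' \<in> V" "e \<in> V" "e' \<in> V" using c e carriers by auto
  \<comment> \<open>The starting coset splits trivially: its components come from \<open>L1\<close>
    and \<open>U0\<close>, which meet in \<open>L0\<close>.\<close>
  have "L0 #> (c \<otimes> e) = L0 #> \<one>" using GD(1) c(3) e(3) coset_set_mult[OF Lsec(4) ceO(1,3)] by simp
  then have "c \<otimes> e \<otimes> inv \<one> \<in> L0" using coset_eq_iff[OF Lsec(4) _ one_closed, of "c \<otimes> e"] ceO by simp
  then have ce: "c \<otimes> e \<in> L0" using ceO by simp
  then have "c \<otimes> e \<otimes> inv e \<in> U0" using U0m e(1) L0_U0 by blast
  then have "c \<in> U0" using ceO by (simp add: m_ac comm_cancel)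
  then have cL: "c \<in> L0" using c LU(1) by blast
  then have "inv c \<otimes> (c \<otimes> e) \<in> L0" using L0m ce by blast
  then have eL: "e \<in> L0" using ceO by (simp add: comm_cancel)
  \<comment> \<open>The components of the end point agree with \<open>l1\<close> and
    \<open>u\<close> modulo \<open>L0\<close>.\<close>
  have "L0 #> a = L0 #> (c' \<otimes> e')" using GD(2) c(4) e(4) coset_set_mult[OF Lsec(4) ceO(2,4)] by simp
  then have d: "a \<otimes> inv (c' \<otimes> e') \<in> L0" using coset_eq_iff[OF Lsec(4) abO(1), of "c' \<otimes> e'"] ceO by simp
  have "a \<otimes> inv (c' \<otimes> e') \<otimes> (e' \<otimes> inv u) \<in> U0"
    using U0m(1)[OF subsetD[OF L0_U0 d] U0m(1)[OF e(2) U0m(2)[OF lu(2) lu(2)]]] .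
  moreover have "a \<otimes> inv (c' \<otimes> e') \<otimes> (e' \<otimes> inv u) = l1 \<otimes> inv c'"
    unfolding lu(3) using luO ceO by (simp add: inv_mult m_ac comm_cancel)
  ultimately have lc: "l1 \<otimes> inv c' \<in> L0"
    using LU(1) L1m(1)[OF lu(1) L1m(2)[OF c(2) c(2)]] by simp
  have "inv (l1 \<otimes> inv c') \<otimes> (a \<otimes> inv (c' \<otimes> e')) \<in> L0"
    using L0m(1)[OF L0m(2)[OF lc lc] d] .
  moreover have "inv (l1 \<otimes> inv c') \<otimes> (a \<otimes> inv (c' \<otimes> e')) = u \<otimes> inv e'"
    unfolding lu(3) using luO ceO by (simp add: inv_mult m_ac comm_cancel)
  ultimately have ue: "u \<otimes> inv e' \<in> L0" by simp
  have c': "c' \<notin> L0"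
  proof
    assume "c' \<in> L0"
    then have "l1 \<otimes> inv c' \<otimes> c' \<in> L0" using lc L0m by blast
    then show False using nl luO ceO by (simp add: m_assoc)
  qed
  have "(L0 #> c, L0 #> c') \<in> s'" using GD(3) c by simp
  then obtain l where l: "l \<in> L0" "(\<one>, c' \<otimes> inv c \<otimes> l) \<in> s1"
    using section_relation[OF secL s1 c(1,2)] by blast
  have lO: "l \<in> V" using l carriers by auto
  have "c' \<otimes> inv c \<otimes> l \<in> L1"
    using L1m(1)[OF L1m(1)[OF c(2) L1m(2)[OF c(1) c(1)]] subsetD[OF Lsec(5) l(1)]] .
  moreover have "c' \<otimes> inv c \<otimes> l \<notin> L0"
  proof
    assume "c' \<otimes> inv c \<otimes> l \<in> L0"
    then have "c' \<otimes> inv c \<otimes> l \<otimes> (c \<otimes> inv l) \<in> L0"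
      using L0m(1)[OF _ L0m(1)[OF cL L0m(2)[OF l(1) l(1)]]] by blast
    moreover have "c' \<otimes> inv c \<otimes> l \<otimes> (c \<otimes> inv l) = c'" using ceO lO by (simp add: m_ac comm_cancel)
    ultimately show False using c' by simp
  qed
  ultimately have "c' \<otimes> inv c \<otimes> l \<in> L1 - L0" by simp
  \<comment> \<open>Triviality allows \<open>l2\<close> as the first component; the second one is
    kept.\<close>
  then obtain s2 k where k: "s2 \<in> S" "k \<in> L0" "(\<one>, c' \<otimes> inv c \<otimes> l) \<in> s2" "(\<one>, l2 \<otimes> k) \<in> s2"
    using triv l2 nl(2) unfolding sec_trivial_def by fastforce
  have "s2 = s1" using basis_eq[OF k(1) s1(1) k(3) l(2)] .
  then have "(L0 #> \<one>, L0 #> l2) \<in> s'"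
    using section_relation[OF secL s1 ones(4) l2] k luO by auto
  moreover have "L0 #> e = L0 #> \<one>" using coset_eq_iff[OF Lsec(4) ceO(3) one_closed] eL ceO by simp
  then have "(L0 #> \<one>, L0 #> e') \<in> t'" using GD(4) e by simp
  ultimately have "((L0 #> \<one>) <#> (L0 #> \<one>), (L0 #> l2) <#> (L0 #> e')) \<in> r" unfolding r_eq by blast
  then have "(L0 #> \<one>, L0 #> (l2 \<otimes> e')) \<in> r"
    using coset_set_mult[OF Lsec(4) one_closed one_closed] coset_set_mult[OF Lsec(4) luO(3) ceO(4)] by simp
  moreover have "L0 #> b = L0 #> (l2 \<otimes> e')"
  proof -
    have "b \<otimes> inv (l2 \<otimes> e') = u \<otimes> inv e'" unfolding bl using luO ceO by (simp add: inv_mult m_ac comm_cancel)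
    then show ?thesis using coset_eq_iff[OF Lsec(4) abO(2), of "l2 \<otimes> e'"] ue luO ceO by simp
  qed
  ultimately have "(L0 #> \<one>, L0 #> b) \<in> r" by simp
  then obtain k' where k': "k' \<in> L0" "(\<one>, b \<otimes> k') \<in> s" using rel[of b] b abO by auto
  have k'O: "k' \<in> V" using k' carriers by auto
  \<comment> \<open>The factor \<open>k'\<close> from \<open>L0\<close> is absorbed by the
    \<open>U0/L0\<close>-condition.\<close>
  show "(\<one>, b) \<in> s"
  proof (rule section_condition_mem[OF cond0 Usec(4) Lsec(4) Usec(2) s(1) k'(2)])
    show "\<one> \<otimes> inv (b \<otimes> k') \<notin> U0"
    proof
      assume "\<one> \<otimes> inv (b \<otimes> k') \<in> U0"
      then have "\<one> \<otimes> inv (b \<otimes> k') \<otimes> k' \<in> U0" using U0m k'(1) L0_U0 by blast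
      then have "inv (\<one> \<otimes> inv (b \<otimes> k') \<otimes> k') \<in> U0" using U0m by blast
      moreover have "inv (\<one> \<otimes> inv (b \<otimes> k') \<otimes> k') = b"
        using abO k'O by (simp add: inv_mult m_ac comm_cancel)
      ultimately show False using b by simp
    qed
    have "b \<otimes> k' \<otimes> inv b = k'" using abO k'O by (simp add: m_ac comm_cancel)
    then show "b \<otimes> k' \<otimes> inv b \<in> L0" using k'(1) by simp
  qed (use abO ones in auto)
qed

end

section \<open>Exchange automorphisms and the refined partition\<close>

context singular
begin

text \<open>If the two cosets differ, the map multiplies by \<open>l\<close> on one and by
  \<open>inv l\<close> on the other, so points move only within \<open>L1\<close>-cosets. Pairs
  joining different \<open>U1\<close>-cosets are covered by the \<open>U1/L1\<close>-condition, and
  pairs in one \<open>U0\<close>-coset undergo a common translation. For the remaining pairs the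
  quotients before and after lie in \<open>U1 - U0\<close> and differ by an element of
  \<open>L1\<close>, which is the case of \<open>same_basis\<close>.\<close>

lemma swap_automorphism:
  assumes a: "a \<in> V" and b: "b \<in> V" and ab: "a \<otimes> inv b \<in> U1"
  shows "\<exists>k. bij_betw k V V \<and> (\<forall>z\<in>U0 #> a. k z \<in> U0 #> b) \<and>
    (\<forall>z\<in>V. z \<notin> U0 #> a \<longrightarrow> z \<notin> U0 #> b \<longrightarrow> k z = z) \<and>
    (\<forall>s\<in>S. \<forall>z\<in>V. \<forall>w\<in>V. (k z, k w) \<in> s \<longleftrightarrow> (z, w) \<in> s)"
proof (cases "a \<otimes> inv b \<in> U0")
  case True
  then have "U0 #> a = U0 #> b" using coset_eq_iff[OF Usec(4) a b] by simp
  then show ?thesis by (intro exI[of _ id]) auto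
next
  case False
  have "b \<otimes> inv a \<in> U1" using sub_sym[OF Usec(3) a b ab] .
  \<comment> \<open>The part \<open>u\<close> does not affect the target coset, so translation by
    \<open>l\<close> alone carries \<open>U0 #> a\<close> to \<open>U0 #> b\<close>.\<close>
  then obtain l u where lu: "l \<in> L1" "u \<in> U0" "b \<otimes> inv a = l \<otimes> u" using LU(3) by blast
  have luO: "l \<in> V" "u \<in> V" using lu carriers by auto
  have "b = (b \<otimes> inv a) \<otimes> a" using a b by (simp add: m_assoc)
  then have beq: "b = l \<otimes> u \<otimes> a" using lu(3) by simp
  note U0m = subgroup_closed[OF Usec(4)]
  note L1m = subgroup_closed[OF Lsec(3)]
  note U1m = subgroup_closed[OF Usec(3)]
  define c where "c z = (if z \<otimes> inv a \<in> U0 then l else if z \<otimes> inv b \<in> U0 then inv l else \<one>)" for z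
  define k where "k z = z \<otimes> c z" for z
  have cL: "c z \<in> L1" for z
    unfolding c_def using lu(1) L1m(2)[OF lu(1) lu(1)] subgroup.one_closed[OF Lsec(3)] by auto
  have cO: "c z \<in> V" for z using cL carriers by blast
  have kO: "k z \<in> V" if "z \<in> V" for z unfolding k_def using that cO by simp
  have c_cong: "c z = c w" if "z \<in> V" "w \<in> V" "z \<otimes> inv w \<in> U0" for z w
  proof -
    have "z \<otimes> inv d \<in> U0 \<longleftrightarrow> w \<otimes> inv d \<in> U0" if d: "d \<in> V" for d
      using sub_trans[OF Usec(4) \<open>w \<in> V\<close> \<open>z \<in> V\<close> d]
        sub_trans[OF Usec(4) \<open>z \<in> V\<close> \<open>w \<in> V\<close> d] sub_sym[OF Usec(4) \<open>z \<in> V\<close> \<open>w \<in> V\<close>]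
        \<open>z \<otimes> inv w \<in> U0\<close> by blast
    then show ?thesis unfolding c_def using a b by simp
  qed
  have ka: "k z \<otimes> inv b \<in> U0 \<and> k z = z \<otimes> l" if z: "z \<in> V" "z \<otimes> inv a \<in> U0" for z
  proof -
    have "k z = z \<otimes> l" unfolding k_def c_def using z by simp
    moreover have "z \<otimes> l \<otimes> inv b = z \<otimes> inv a \<otimes> inv u"
      unfolding beq using z(1) luO a by (simp add: inv_mult m_ac comm_cancel)
    ultimately show ?thesis using U0m(1)[OF z(2) U0m(2)[OF lu(2) lu(2)]] by simp
  qed
  have kb: "k z \<otimes> inv a \<in> U0 \<and> k z = z \<otimes> inv l" if z: "z \<in> V" "z \<otimes> inv b \<in> U0" for z
  proof -
    have "z \<otimes> inv a \<notin> U0"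
      using False sub_trans[OF Usec(4) a z(1) b sub_sym[OF Usec(4) z(1) a] z(2)] by blast
    then have "k z = z \<otimes> inv l" unfolding k_def c_def using z by simp
    moreover have "z \<otimes> inv l \<otimes> inv a = z \<otimes> inv b \<otimes> u"
      unfolding beq using z(1) luO a by (simp add: inv_mult m_ac comm_cancel)
    ultimately show ?thesis using U0m(1)[OF z(2) lu(2)] by simp
  qed
  have kn: "k z = z" if "z \<in> V" "z \<otimes> inv a \<notin> U0" "z \<otimes> inv b \<notin> U0" for z
    unfolding k_def c_def using that by simp
  \<comment> \<open>\<open>k\<close> is an involution, so it is bijective and preservation of
    relations need only be checked in one direction.\<close>
  have kk: "k (k z) = z" if z: "z \<in> V" for z
  proof -
    consider "z \<otimes> inv a \<in> U0" | "z \<otimes> inv b \<in> U0" | "z \<otimes> inv a \<notin> U0" "z \<otimes> inv b \<notin> U0" by blast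
    then show ?thesis
    proof cases
      case 1
      have "k z = z \<otimes> l" "k (k z) = k z \<otimes> inv l" using ka[OF z 1] kb[OF kO[OF z]] by auto
      then show ?thesis using z luO by (simp add: m_assoc)
    next
      case 2
      have "k z = z \<otimes> inv l" "k (k z) = k z \<otimes> l" using kb[OF z 2] ka[OF kO[OF z]] by auto
      then show ?thesis using z luO by (simp add: m_assoc)
    qed (use kn z in simp)
  qed
  have bij: "bij_betw k V V" using kO kk by (intro bij_betwI[of k _ _ k]) auto
  \<comment> \<open>Points with images in one \<open>U0\<close>-coset are moved back by a common
    factor, so they were in one \<open>U0\<close>-coset before.\<close>
  have k_dist: "z \<otimes> inv w \<in> U0" if zw: "z \<in> V" "w \<in> V" "k z \<otimes> inv (k w) \<in> U0" for z w
  proof -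
    have "c (k z) = c (k w)" using c_cong[OF kO kO] zw by blast
    then have "z \<otimes> inv w = (k z \<otimes> c (k z)) \<otimes> inv (k w \<otimes> c (k z))" using kk zw unfolding k_def by metis
    also have "\<dots> = k z \<otimes> inv (k w)" using kO cO zw by (simp add: inv_mult m_ac comm_cancel)
    finally show ?thesis using zw(3) by simp
  qed
  have kL: "k z \<otimes> inv z \<in> L1" "z \<otimes> inv (k z) \<in> L1" if z: "z \<in> V" for z
  proof -
    have "k z \<otimes> inv z = c z" unfolding k_def using z cO by (simp add: m_ac comm_cancel)
    then show "k z \<otimes> inv z \<in> L1" using cL by simp
    then show "z \<otimes> inv (k z) \<in> L1" using sub_sym[OF Lsec(3) kO[OF z] z] by blast
  qed
  have fwd: "(k z, k w) \<in> s" if s: "s \<in> S" "(z, w) \<in> s" for s z w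
  proof -
    have zw: "z \<in> V" "w \<in> V" using basis_carrier[OF s] by auto
    note kzw = kO[OF zw(1)] kO[OF zw(2)]
    show ?thesis
    proof (cases "z \<otimes> inv w \<in> U1")
      case False
      show ?thesis
        using section_condition_mem[OF cond1 Usec(3) Lsec(3) Usec(1) s False kzw kL(1)[OF zw(1)] kL(2)[OF zw(2)]] .
    next
      case U1: True
      show ?thesis
      proof (cases "z \<otimes> inv w \<in> U0")
        case True
        then have "c z = c w" using c_cong zw by blast
        then show ?thesis unfolding k_def using translate[OF s cO[of w]] by simp
      next
        case U0: False
        define A B where "A = w \<otimes> inv z" and "B = k w \<otimes> inv (k z)"
        have O: "A \<in> V" "B \<in> V" unfolding A_def B_def using zw kzw by auto
        have A: "A \<in> U1" "A \<notin> U0"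
          unfolding A_def using sub_sym[OF Usec(3) zw U1] U0 sub_sym[OF Usec(4) zw(2,1)] by blast+
        have "A \<otimes> inv B = (w \<otimes> inv (k w)) \<otimes> (k z \<otimes> inv z)"
          unfolding A_def B_def using zw kzw by (simp add: inv_mult m_ac)
        then have AB: "A \<otimes> inv B \<in> L1" using L1m(1) kL zw by simp
        have "B = A \<otimes> inv (A \<otimes> inv B)" using O by (simp add: inv_mult m_ac comm_cancel)
        moreover have "A \<otimes> inv (A \<otimes> inv B) \<in> U1"
          using U1m(1)[OF A(1) U1m(2)[OF subsetD[OF LU(2) AB] subsetD[OF LU(2) AB]]] .
        ultimately have B1: "B \<in> U1" by simp
        have B0: "B \<notin> U0"
          unfolding B_def using U0 k_dist[OF zw] sub_sym[OF Usec(4) kzw(2,1)] by blast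
        have "(\<one>, A) \<in> s" using translate_iff[OF s(1) zw] s(2) unfolding A_def by simp
        then have "(\<one>, B) \<in> s" using same_basis[of A B, OF _ _ AB s(1)] A B1 B0 by blast
        then show ?thesis using translate_iff[OF s(1) kzw] unfolding B_def by simp
      qed
    qed
  qed
  have "(k z, k w) \<in> s \<longleftrightarrow> (z, w) \<in> s" if "s \<in> S" "z \<in> V" "w \<in> V" for s z w
    using fwd[OF that(1), of z w] fwd[OF that(1), of "k z" "k w"] kk that by auto
  moreover have "k z \<in> U0 #> b" if z: "z \<in> U0 #> a" for z
  proof -
    have zO: "z \<in> V" using z r_coset_subset_G[OF subgroup.subset[OF Usec(4)] a] by blast
    show ?thesis using ka[OF zO] mem_coset_iff[OF Usec(4) zO a] mem_coset_iff[OF Usec(4) kO[OF zO] b] z by blast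
  qed
  moreover have "k z = z" if "z \<in> V" "z \<notin> U0 #> a" "z \<notin> U0 #> b" for z
    using kn that mem_coset_iff[OF Usec(4)] a b by blast
  ultimately show ?thesis using bij by (intro exI[of _ k]) blast
qed

text \<open>\<open>None\<close> leaves the pairs joining different \<open>U1\<close>-cosets
  unrefined. A color depends only on the quotient of the pair, which keeps the refined relations
  translation invariant.\<close>

definition color :: "'a \<times> 'a \<Rightarrow> 'a set option" where
  "color p = (if fst p \<otimes> inv (snd p) \<in> U1 then Some (U0 #> (fst p \<otimes> inv (snd p))) else None)"

definition refined :: "('a \<times> 'a) set set" where
  "refined = {s \<inter> {p. color p = c} | s c. s \<in> S} - {{}}"

text \<open>By commutativity the double quotient of the four points may be grouped either way; equal
  colors thus become equal shifts.\<close>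

lemma shift_swap:
  assumes "a \<in> V" "b \<in> V" "a' \<in> V" "b' \<in> V"
  shows "U0 #> (a \<otimes> inv b) = U0 #> (a' \<otimes> inv b') \<longleftrightarrow> U0 #> (a \<otimes> inv a') = U0 #> (b \<otimes> inv b')"
proof -
  have "a \<otimes> inv b \<otimes> inv (a' \<otimes> inv b') = a \<otimes> inv a' \<otimes> inv (b \<otimes> inv b')"
    using assms by (simp add: inv_mult m_ac)
  then show ?thesis using coset_eq_iff[OF Usec(4)] assms by simp
qed

lemma color_eq_iff:
  assumes "a \<in> V" "b \<in> V" "a' \<in> V" "b' \<in> V" "a \<otimes> inv b \<in> U1 \<longleftrightarrow> a' \<otimes> inv b' \<in> U1"
  shows "color (a, b) = color (a', b') \<longleftrightarrow>
    (a \<otimes> inv b \<in> U1 \<longrightarrow> U0 #> (a \<otimes> inv a') = U0 #> (b \<otimes> inv b'))"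
  unfolding color_def fst_conv snd_conv using shift_swap[OF assms(1-4)] assms(5) by auto

lemma refined_mem:
  assumes "t \<in> refined" "p \<in> t"
  obtains s where "s \<in> S" "t = s \<inter> {q. color q = color p}"
proof -
  obtain s c where s: "s \<in> S" "t = s \<inter> {q. color q = c}" using assms(1) unfolding refined_def by blast
  then have "c = color p" using assms(2) by simp
  then show thesis using s that by simp
qed

lemma refinedI: "s \<in> S \<Longrightarrow> p \<in> s \<Longrightarrow> s \<inter> {q. color q = color p} \<in> refined"
  unfolding refined_def by (intro DiffI CollectI exI[of _ s] exI[of _ "color p"]) auto

lemma refined_partition: "partition_on (V \<times> V) refined"
proof (rule partition_onI)
  show "\<Union>refined = V \<times> V"
  proof
    show "\<Union>refined \<subseteq> V \<times> V" unfolding refined_def using nonempty_basis(2)[OF part] by blast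
    show "V \<times> V \<subseteq> \<Union>refined"
    proof
      fix p assume "p \<in> V \<times> V"
      then obtain s where s: "s \<in> S" "p \<in> s" using partition_on_obtain[OF part] by blast
      then have "p \<in> s \<inter> {q. color q = color p}" by simp
      then show "p \<in> \<Union>refined" using refinedI[OF s] by blast
    qed
  qed
  show "{} \<notin> refined" unfolding refined_def by simp
  fix t t' assume t: "t \<in> refined" "t' \<in> refined" "t \<noteq> t'"
  show "disjnt t t'"
  proof (rule ccontr)
    assume "\<not> disjnt t t'"
    then obtain p where p: "p \<in> t" "p \<in> t'" unfolding disjnt_def by blast
    obtain s where s: "s \<in> S" "t = s \<inter> {q. color q = color p}" using refined_mem[OF t(1) p(1)] .
    obtain s' where s': "s' \<in> S" "t' = s' \<inter> {q. color q = color p}" using refined_mem[OF t(2) p(2)] .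
    have "s = s'" using basis_eq[OF s(1) s'(1)] p s s' by blast
    then show False using t(3) s s' by simp
  qed
qed

lemma refined_coarser: "coarser S refined"
  unfolding coarser_def
proof
  fix s assume s: "s \<in> S"
  have "s \<subseteq> \<Union>{t \<in> refined. t \<subseteq> s}" using refinedI[OF s] by blast
  then show "union_of_basis refined s"
    unfolding union_of_basis_def by (intro exI[of _ "{t \<in> refined. t \<subseteq> s}"]) blast
qed

lemma shift_refinement_col:
  assumes "WL_forth m V R" "(x, y) \<in> shift_refinement m U1 U0 R" "i < m" "j < m"
    and "x ! i \<otimes> inv (x ! j) \<in> U1 \<longleftrightarrow> y ! i \<otimes> inv (y ! j) \<in> U1"
  shows "color (x ! i, x ! j) = color (y ! i, y ! j)"
proof -
  have R: "(x, y) \<in> R" "x ! i \<otimes> inv (x ! j) \<in> U1 \<longrightarrow> U0 #> (x ! i \<otimes> inv (y ! i)) = U0 #> (x ! j \<otimes> inv (y ! j))"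
    using assms(2-4) unfolding shift_refinement_def by auto
  have T: "x \<in> tuples m V" "y \<in> tuples m V" using WL_forth_subset[OF assms(1) R(1)] by auto
  show ?thesis
    using color_eq_iff[OF tuples_nth[OF T(1) assms(3)] tuples_nth[OF T(1) assms(4)]
        tuples_nth[OF T(2) assms(3)] tuples_nth[OF T(2) assms(4)] assms(5)] R(2) by blast
qed

end

section \<open>The game on pairs and the invariance of scheme groups\<close>

context circulant
begin

text \<open>The game for \<open>m = 2\<close> and the identity; its restriction to constant shifts
  will give the coherence of \<open>refined\<close>.\<close>

definition basis_tuples :: "('a list \<times> 'a list) set" where
  "basis_tuples = {(x, y) \<in> tuples 2 V \<times> tuples 2 V. \<exists>s\<in>S. (x ! 0, x ! 1) \<in> s \<and> (y ! 0, y ! 1) \<in> s}"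

text \<open>Coherence restated as a game: intersection numbers count points by the two basis
  relations joining them to the pebbles, and equal counts give the answering permutation.\<close>

lemma basis_tuples_forth: "WL_forth 2 V basis_tuples"
proof (rule WL_forthI)
  show "basis_tuples \<subseteq> tuples 2 V \<times> tuples 2 V" unfolding basis_tuples_def by auto
  fix x y assume "(x, y) \<in> basis_tuples"
  then obtain t where xy: "x \<in> tuples 2 V" "y \<in> tuples 2 V" and t: "t \<in> S" "(x ! 0, x ! 1) \<in> t" "(y ! 0, y ! 1) \<in> t"
    unfolding basis_tuples_def by auto
  have len: "length x = 2" "length y = 2" using xy by (auto simp: tuples_length)
  have O: "x ! 0 \<in> V" "x ! 1 \<in> V" "y ! 0 \<in> V" "y ! 1 \<in> V" using xy tuples_nth by fastforce+
  define bs where "bs p = (THE s. s \<in> S \<and> p \<in> s)" for p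
  have bs_eq: "bs p = s" if "s \<in> S" "p \<in> s" for p s
    unfolding bs_def using that basis_eq by (intro the_equality) blast+
  have bs: "bs (a, b) \<in> S" "(a, b) \<in> bs (a, b)" if "a \<in> V" "b \<in> V" for a b
    using basis_obtain[OF that] bs_eq by metis+
  have bs_iff: "bs (a, b) = s \<longleftrightarrow> (a, b) \<in> s" if "a \<in> V" "b \<in> V" "s \<in> S" for a b s
    using bs[OF that(1,2)] bs_eq[OF that(3)] by blast
  let ?p = "\<lambda>\<gamma>. (bs (x ! 0, \<gamma>), bs (\<gamma>, x ! 1))" and ?q = "\<lambda>\<gamma>. (bs (y ! 0, \<gamma>), bs (\<gamma>, y ! 1))"
  have "card {\<gamma> \<in> V. ?p \<gamma> = c} = card {\<gamma> \<in> V. ?q \<gamma> = c}" for c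
  proof (cases "fst c \<in> S \<and> snd c \<in> S")
    case True
    have "{\<gamma> \<in> V. ?p \<gamma> = c} = {\<gamma> \<in> V. (x ! 0, \<gamma>) \<in> fst c \<and> (\<gamma>, x ! 1) \<in> snd c}"
      using bs_iff O True by (cases c) auto
    moreover have "{\<gamma> \<in> V. ?q \<gamma> = c} = {\<gamma> \<in> V. (y ! 0, \<gamma>) \<in> fst c \<and> (\<gamma>, y ! 1) \<in> snd c}"
      using bs_iff O True by (cases c) auto
    ultimately show ?thesis
      using intersection_number_eq[OF coherent conjunct1[OF True] conjunct2[OF True] t(1,2)]
        intersection_number_eq[OF coherent conjunct1[OF True] conjunct2[OF True] t(1,3)] by simp
  next
    case False
    then have "{\<gamma> \<in> V. ?p \<gamma> = c} = {}" "{\<gamma> \<in> V. ?q \<gamma> = c} = {}" using bs(1) O by fastforce+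
    then show ?thesis by (simp only:)
  qed
  then obtain g where g: "g permutes V" "\<forall>\<gamma>\<in>V. ?p \<gamma> = ?q (g \<gamma>)"
    using bij_with_equal_fibres[OF fin, of ?p ?q] by blast
  have "(x[i := \<gamma>], y[i := g \<gamma>]) \<in> basis_tuples" if \<gamma>: "\<gamma> \<in> V" and i: "i < 2" for \<gamma> i
  proof -
    have gO: "g \<gamma> \<in> V" using permutes_in_image[OF g(1)] \<gamma> by simp
    have T: "x[i := \<gamma>] \<in> tuples 2 V" "y[i := g \<gamma>] \<in> tuples 2 V"
      using tuples_update[OF xy(1) \<gamma>] tuples_update[OF xy(2) gO] by auto
    have eq: "bs (x ! 0, \<gamma>) = bs (y ! 0, g \<gamma>)" "bs (\<gamma>, x ! 1) = bs (g \<gamma>, y ! 1)" using g(2) \<gamma> by auto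
    consider "i = 0" | "i = 1" using i by linarith
    then have "\<exists>s\<in>S. (x[i := \<gamma>] ! 0, x[i := \<gamma>] ! 1) \<in> s \<and> (y[i := g \<gamma>] ! 0, y[i := g \<gamma>] ! 1) \<in> s"
    proof cases
      case 1
      then show ?thesis using bs[OF \<gamma> O(2)] bs[OF gO O(4)] eq len by (intro bexI[of _ "bs (\<gamma>, x ! 1)"]) auto
    next
      case 2
      then show ?thesis using bs[OF O(1) \<gamma>] bs[OF O(3) gO] eq len by (intro bexI[of _ "bs (x ! 0, \<gamma>)"]) auto
    qed
    then show ?thesis unfolding basis_tuples_def using T by blast
  qed
  then show "\<exists>g. bij_betw g V V \<and> (\<forall>\<gamma>\<in>V. \<forall>i<2. (x[i := \<gamma>], y[i := g \<gamma>]) \<in> basis_tuples)"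
    using permutes_imp_bij[OF g(1)] by blast
qed

lemma basis_tuples_scheme_group:
  assumes "scheme_group G S H" "(x, y) \<in> basis_tuples" "i < 2" "j < 2"
  shows "x ! i \<otimes> inv (x ! j) \<in> H \<longleftrightarrow> y ! i \<otimes> inv (y ! j) \<in> H"
proof -
  obtain s where xy: "x \<in> tuples 2 V" "y \<in> tuples 2 V" and s: "s \<in> S" "(x ! 0, x ! 1) \<in> s" "(y ! 0, y ! 1) \<in> s"
    using assms(2) unfolding basis_tuples_def by auto
  have H: "subgroup H G" using scheme_group_subgroup[OF assms(1)] .
  have O: "x ! 0 \<in> V" "x ! 1 \<in> V" "y ! 0 \<in> V" "y ! 1 \<in> V" using xy tuples_nth by fastforce+
  have 01: "x ! 0 \<otimes> inv (x ! 1) \<in> H \<longleftrightarrow> y ! 0 \<otimes> inv (y ! 1) \<in> H"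
    using scheme_group_cong[OF assms(1) s] .
  have 10: "x ! 1 \<otimes> inv (x ! 0) \<in> H \<longleftrightarrow> y ! 1 \<otimes> inv (y ! 0) \<in> H"
    using 01 sub_sym[OF H O(1,2)] sub_sym[OF H O(2,1)] sub_sym[OF H O(3,4)] sub_sym[OF H O(4,3)] by blast
  consider "i = 0" "j = 1" | "i = 1" "j = 0" | "i = j" using assms(3,4) by linarith
  then show ?thesis
  proof cases
    case 3
    then show ?thesis using tuples_nth[OF xy(1) assms(3)] tuples_nth[OF xy(2) assms(3)] by simp
  qed (use 01 10 in simp_all)
qed

text \<open>The image \<open>e\<close> of \<open>coset_equiv G H\<close> under \<open>\<phi>\<close>
  is translation invariant, and it is an equivalence because reflexivity, symmetry and transitivity
  can be pulled back through the game. So its classes are the cosets of a subgroup \<open>K\<close>;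
  the game also gives \<open>card H = card K\<close>, and in a cyclic group this forces
  \<open>K = H\<close>.\<close>

lemma scheme_group_preserved:
  assumes cyc: "cyclic_group G" and m: "m \<ge> 2" and bij: "bij_betw \<phi> S S"
    and R: "WL_forth m V R" "WL_compatible m S \<phi> R" "R \<noteq> {}"
    and H: "scheme_group G S H" and xy: "(x, y) \<in> R" "i < m" "j < m"
  shows "x ! i \<otimes> inv (x ! j) \<in> H \<longleftrightarrow> y ! i \<otimes> inv (y ! j) \<in> H"
proof -
  have Hs: "subgroup H G" using scheme_group_subgroup[OF H] .
  define e where "e = {(a, b). \<exists>s\<in>S. (a, b) \<in> \<phi> s \<and> (\<exists>(p, q)\<in>s. p \<otimes> inv q \<in> H)}"
  have m01: "0 < m" "1 < m" using m by auto
  have e_iff: "(y ! i, y ! j) \<in> e \<longleftrightarrow> x ! i \<otimes> inv (x ! j) \<in> H" if xy: "(x, y) \<in> R" "i < m" "j < m" for x y i j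
  proof -
    have T: "x \<in> tuples m V" using WL_forth_subset[OF R(1) xy(1)] by simp
    obtain s where s: "s \<in> S" "(x ! i, x ! j) \<in> s"
      using basis_obtain tuples_nth[OF T xy(2)] tuples_nth[OF T xy(3)] by metis
    have ys: "(y ! i, y ! j) \<in> \<phi> s" using WL_compatibleD(2)[OF R(2) xy s(1)] s(2) by simp
    show ?thesis
    proof
      assume "(y ! i, y ! j) \<in> e"
      then obtain s' p q where s': "s' \<in> S" "(y ! i, y ! j) \<in> \<phi> s'" "(p, q) \<in> s'" "p \<otimes> inv q \<in> H"
        unfolding e_def by blast
      have "(x ! i, x ! j) \<in> s'" using WL_compatibleD(2)[OF R(2) xy s'(1)] s'(2) by simp
      then show "x ! i \<otimes> inv (x ! j) \<in> H" using scheme_group_cong[OF H s'(1,3)] s'(4) by blast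
    next
      assume "x ! i \<otimes> inv (x ! j) \<in> H"
      then show "(y ! i, y ! j) \<in> e" unfolding e_def using s ys by blast
    qed
  qed
  have e_translate: "(a \<otimes> g, b \<otimes> g) \<in> e" if "(a, b) \<in> e" "g \<in> V" for a b g
    using that translate[OF bij_betw_apply[OF bij]] unfolding e_def by blast
  have e_refl: "(a, a) \<in> e" if a: "a \<in> V" for a
  proof -
    obtain y where y: "y \<in> tuples m V" "y ! 0 = a" using pair_tuple[OF a a m] by metis
    obtain x where x: "(x, y) \<in> R" using WL_forth_surj[OF R(1,3) y(1)] .
    have "x ! 0 \<in> V" using WL_forth_subset[OF R(1) x] tuples_nth m01 by blast
    then have "x ! 0 \<otimes> inv (x ! 0) \<in> H" using subgroup.one_closed[OF Hs] by simp
    then show ?thesis using e_iff[OF x m01(1) m01(1)] y(2) by simp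
  qed
  have eO: "a \<in> V \<and> b \<in> V" if "(a, b) \<in> e" for a b
    using that basis_carrier[OF bij_betw_apply[OF bij]] unfolding e_def by blast
  have e_sym: "(b, a) \<in> e" if ab: "(a, b) \<in> e" for a b
  proof -
    obtain y where y: "y \<in> tuples m V" "y ! 0 = a" "y ! 1 = b" using pair_tuple[OF _ _ m, of a V b] eO[OF ab] by metis
    obtain x where x: "(x, y) \<in> R" using WL_forth_surj[OF R(1,3) y(1)] .
    have O: "x ! 0 \<in> V" "x ! 1 \<in> V" using WL_forth_subset[OF R(1) x] tuples_nth m01 by blast+
    show ?thesis using e_iff[OF x m01] e_iff[OF x m01(2,1)] sub_sym[OF Hs O] ab y by simp
  qed
  have e_trans: "(a, c) \<in> e" if ab: "(a, b) \<in> e" and bc: "(b, c) \<in> e" for a b c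
  proof -
    obtain y where y: "y \<in> tuples m V" "y ! 0 = a" "y ! 1 = c"
      using pair_tuple[OF _ _ m, of a V c] eO[OF ab] eO[OF bc] by metis
    obtain x where x: "(x, y) \<in> R" using WL_forth_surj[OF R(1,3) y(1)] .
    have T: "x \<in> tuples m V" using WL_forth_subset[OF R(1) x] by simp
    have O: "x ! 0 \<in> V" "x ! 1 \<in> V" using T tuples_nth m01 by blast+
    have len: "length x = m" "length y = m" using T y(1) by (auto simp: tuples_length)
    obtain g where g: "bij_betw g V V"
      "\<And>\<alpha> i. \<alpha> \<in> V \<Longrightarrow> i < m \<Longrightarrow> (x[i := \<alpha>], y[i := g \<alpha>]) \<in> R"
      using WL_forthE[OF R(1) x] by metis
    \<comment> \<open>Transitivity needs a third point: a move places the preimage of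
      \<open>b\<close> beside the two pebbles.\<close>
    obtain \<beta> where \<beta>: "\<beta> \<in> V" "g \<beta> = b" using g(1) eO[OF ab] by (metis bij_betw_iff_bijections)
    have "x ! 0 \<otimes> inv \<beta> \<in> H" using e_iff[OF g(2)[OF \<beta>(1) m01(2)] m01] ab y \<beta> len m01 by simp
    moreover have "\<beta> \<otimes> inv (x ! 1) \<in> H" using e_iff[OF g(2)[OF \<beta>(1) m01(1)] m01] bc y \<beta> len m01 by simp
    ultimately have "x ! 0 \<otimes> inv (x ! 1) \<in> H" using sub_trans[OF Hs O(1) \<beta>(1) O(2)] by blast
    then show ?thesis using e_iff[OF x m01] y by simp
  qed
  define K where "K = {h \<in> V. (h, \<one>) \<in> e}"
  \<comment> \<open>\<open>K\<close> is the class of \<open>\<one>\<close>, and translation reduces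
    every pair to one ending in \<open>\<one>\<close>.\<close>
  have e_K: "(a, b) \<in> e \<longleftrightarrow> a \<otimes> inv b \<in> K" if ab: "a \<in> V" "b \<in> V" for a b
    unfolding K_def using e_translate[of a b "inv b"] e_translate[of "a \<otimes> inv b" \<one> b] ab
    by (auto simp: m_assoc)
  have Ks: "subgroup K G"
  proof (rule subgroupI)
    show "K \<subseteq> V" unfolding K_def by blast
    show "K \<noteq> {}" unfolding K_def using e_refl[OF one_closed] by blast
    show "inv h \<in> K" if h: "h \<in> K" for h
    proof -
      have "h \<in> V" "(\<one>, h) \<in> e" using h e_sym unfolding K_def by auto
      then show ?thesis using e_translate[of \<one> h "inv h"] unfolding K_def by simp
    qed
    show "h \<otimes> h' \<in> K" if h: "h \<in> K" "h' \<in> K" for h h'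
    proof -
      have O: "h \<in> V" "h' \<in> V" "(h, \<one>) \<in> e" "(h', \<one>) \<in> e" using h unfolding K_def by auto
      then have "(h \<otimes> h', h') \<in> e" using e_translate[OF O(3,2)] by simp
      then show ?thesis unfolding K_def using e_trans O by simp
    qed
  qed
  have "card H = card K"
  proof -
    \<comment> \<open>With \<open>\<one>\<close> in coordinate 1, the answers to the moves of
      coordinate 0 map \<open>H\<close> onto a coset of \<open>K\<close>.\<close>
    obtain x where x: "x \<in> tuples m V" "x ! 1 = \<one>" using pair_tuple[OF one_closed one_closed m] by metis
    obtain y where y: "(x, y) \<in> R" using WL_forth_total[OF R(1,3) x(1)] .
    have T: "y \<in> tuples m V" using WL_forth_subset[OF R(1) y] by simp
    have O: "y ! 1 \<in> V" using T tuples_nth m01 by blast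
    have len: "length x = m" "length y = m" using T x(1) by (auto simp: tuples_length)
    obtain g where g: "bij_betw g V V"
      "\<And>\<alpha> i. \<alpha> \<in> V \<Longrightarrow> i < m \<Longrightarrow> (x[i := \<alpha>], y[i := g \<alpha>]) \<in> R"
      using WL_forthE[OF R(1) y] by metis
    have iff: "g \<alpha> \<otimes> inv (y ! 1) \<in> K \<longleftrightarrow> \<alpha> \<in> H" if \<alpha>: "\<alpha> \<in> V" for \<alpha>
      using e_iff[OF g(2)[OF \<alpha> m01(1)] m01] e_K[OF bij_betw_apply[OF g(1) \<alpha>] O] x \<alpha> len m01 by simp
    have "bij_betw g {\<alpha> \<in> V. \<alpha> \<in> H} {\<beta> \<in> V. \<beta> \<otimes> inv (y ! 1) \<in> K}"
      using iff by (intro bij_betw_Collect[OF g(1)]) blast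
    moreover have "{\<alpha> \<in> V. \<alpha> \<in> H} = H" using subgroup.subset[OF Hs] by blast
    moreover have "{\<beta> \<in> V. \<beta> \<otimes> inv (y ! 1) \<in> K} = K #> y ! 1"
      using mem_coset_iff[OF Ks _ O] r_coset_subset_G[OF subgroup.subset[OF Ks] O] by blast
    ultimately have "card H = card (K #> y ! 1)" using bij_betw_same_card by metis
    also have "\<dots> = card K"
      using card_rcosets_equal[OF _ subgroup.subset[OF Ks]] rcosetsI[OF subgroup.subset[OF Ks] O] by simp
    finally show ?thesis .
  qed
  then have "K = H" using cyclic_subgroup_eq_roots[OF cyc fin Hs] cyclic_subgroup_eq_roots[OF cyc fin Ks] by simp
  then show ?thesis
    using e_iff[OF xy] e_K WL_forth_subset[OF R(1) xy(1)] tuples_nth xy(2,3) by blast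
qed

end

section \<open>The refined scheme as the extension, and its self-equivalence\<close>

context singular
begin

lemma refined_same:
  assumes "s \<in> S" "p \<in> s" "q \<in> s" "color p = color q" "r \<in> refined"
  shows "p \<in> r \<longleftrightarrow> q \<in> r"
proof -
  have t: "s \<inter> {q. color q = color p} \<in> refined" using refinedI[OF assms(1,2)] .
  have pq: "p \<in> s \<inter> {q. color q = color p}" "q \<in> s \<inter> {q. color q = color p}" using assms(2-4) by auto
  show ?thesis
    using partition_on_member_eq[OF refined_partition assms(5) t _ pq(1)]
      partition_on_member_eq[OF refined_partition assms(5) t _ pq(2)] pq by blast
qed

text \<open>Automorphisms must act on either side of a position, because
  \<open>shift_refinement_forth\<close> needs equidistribution of a block and of its
  answers.\<close>

lemma swap_tuples:
  assumes aut: "\<And>k x y. (x, y) \<in> R \<Longrightarrow> bij_betw k V V \<Longrightarrow>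
      (\<And>s a b. s \<in> S \<Longrightarrow> a \<in> V \<Longrightarrow> b \<in> V \<Longrightarrow> (k a, k b) \<in> s \<longleftrightarrow> (a, b) \<in> s) \<Longrightarrow>
      (map k x, y) \<in> R \<and> (x, map k y) \<in> R"
    and ab: "a \<in> V" "b \<in> V" "a \<otimes> inv b \<in> U1"
  shows "\<exists>k. bij_betw k V V \<and> (\<forall>z\<in>U0 #> a. k z \<in> U0 #> b) \<and>
    (\<forall>z\<in>V. z \<notin> U0 #> a \<longrightarrow> z \<notin> U0 #> b \<longrightarrow> k z = z) \<and>
    (\<forall>(x, y)\<in>R. (map k x, y) \<in> R \<and> (x, map k y) \<in> R)"
proof -
  obtain k where k: "bij_betw k V V" "\<forall>z\<in>U0 #> a. k z \<in> U0 #> b"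
    "\<forall>z\<in>V. z \<notin> U0 #> a \<longrightarrow> z \<notin> U0 #> b \<longrightarrow> k z = z"
    "\<forall>s\<in>S. \<forall>a\<in>V. \<forall>b\<in>V. (k a, k b) \<in> s \<longleftrightarrow> (a, b) \<in> s"
    using swap_automorphism[OF ab] by (elim exE conjE)
  have "(map k x, y) \<in> R \<and> (x, map k y) \<in> R" if "(x, y) \<in> R" for x y
    using aut[OF that k(1)] k(4) by simp
  then show ?thesis using k(1-3) by (intro exI[of _ k] conjI) auto
qed

lemma refined_tuples_forth: "WL_forth 2 V (shift_refinement 2 U1 U0 basis_tuples)"
proof -
  have difun: "(x, y') \<in> basis_tuples"
    if "(x, y) \<in> basis_tuples" "(x', y) \<in> basis_tuples" "(x', y') \<in> basis_tuples" for x y x' y'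
    using that basis_eq unfolding basis_tuples_def by blast
  have aut: "(map k x, y) \<in> basis_tuples \<and> (x, map k y) \<in> basis_tuples"
    if xy: "(x, y) \<in> basis_tuples" and k: "bij_betw k V V"
      "\<And>s a b. s \<in> S \<Longrightarrow> a \<in> V \<Longrightarrow> b \<in> V \<Longrightarrow> (k a, k b) \<in> s \<longleftrightarrow> (a, b) \<in> s" for k x y
  proof -
    obtain s where T: "x \<in> tuples 2 V" "y \<in> tuples 2 V" and s: "s \<in> S" "(x ! 0, x ! 1) \<in> s" "(y ! 0, y ! 1) \<in> s"
      using xy unfolding basis_tuples_def by auto
    have kT: "map k z \<in> tuples 2 V" "map k z ! 0 = k (z ! 0)" "map k z ! 1 = k (z ! 1)" if "z \<in> tuples 2 V" for z
      using that bij_betw_apply[OF k(1)] unfolding tuples_def by auto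
    have "(k (x ! 0), k (x ! 1)) \<in> s" "(k (y ! 0), k (y ! 1)) \<in> s"
      using k(2)[OF s(1)] s basis_carrier[OF s(1)] by blast+
    then show ?thesis unfolding basis_tuples_def using s T kT[OF T(1)] kT[OF T(2)] by auto
  qed
  show ?thesis
    by (rule shift_refinement_forth[OF fin order_refl Usec(4,3,5) basis_tuples_forth
          basis_tuples_scheme_group[OF Usec(1)] basis_tuples_scheme_group[OF Usec(2)] difun
          swap_tuples[OF aut]])
qed

lemma refined_tuples_same:
  assumes "(x, y) \<in> shift_refinement 2 U1 U0 basis_tuples" "r \<in> refined"
  shows "(x ! 0, x ! 1) \<in> r \<longleftrightarrow> (y ! 0, y ! 1) \<in> r"
proof -
  have xy: "(x, y) \<in> basis_tuples" using assms(1) unfolding shift_refinement_def by auto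
  then obtain s where s: "s \<in> S" "(x ! 0, x ! 1) \<in> s" "(y ! 0, y ! 1) \<in> s" unfolding basis_tuples_def by auto
  have "color (x ! 0, x ! 1) = color (y ! 0, y ! 1)"
    using shift_refinement_col[OF basis_tuples_forth assms(1), of 0 1] basis_tuples_scheme_group[OF Usec(1) xy, of 0 1] by simp
  then show ?thesis using refined_same[OF s _ assms(2)] by blast
qed

lemma refined_circulant: "circulant_scheme G refined"
  unfolding circulant_scheme_def coherent_configuration_def
proof (intro conjI ballI)
  show "partition_on (V \<times> V) refined" by (rule refined_partition)
  have "union_of_basis S (Id_on V)" using coherent unfolding coherent_configuration_def by simp
  then show "union_of_basis refined (Id_on V)" by (rule coarser_union_of_basis[OF refined_coarser])
next
  fix t assume t: "t \<in> refined"
  obtain a b where ab: "(a, b) \<in> t" using nonempty_basis(1)[OF refined_partition t] by auto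
  obtain s where s: "s \<in> S" "t = s \<inter> {q. color q = color (a, b)}" using refined_mem[OF t ab] .
  have s': "s\<inverse> \<in> S" using coherent s(1) unfolding coherent_configuration_def by blast
  have O: "a \<in> V" "b \<in> V" using basis_carrier[OF s(1)] ab s(2) by auto
  have abs: "(a, b) \<in> s" using ab s(2) by blast
  \<comment> \<open>Reversing a pair inverts its quotient, so transposition respects the
    refinement.\<close>
  have "color (d, c) = color (b, a) \<longleftrightarrow> color (c, d) = color (a, b)" if cd: "(c, d) \<in> s" for c d
  proof -
    have O': "c \<in> V" "d \<in> V" using basis_carrier[OF s(1) cd] by auto
    have 1: "c \<otimes> inv d \<in> U1 \<longleftrightarrow> a \<otimes> inv b \<in> U1" using scheme_group_cong[OF Usec(1) s(1) cd abs] .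
    have 2: "d \<otimes> inv c \<in> U1 \<longleftrightarrow> c \<otimes> inv d \<in> U1" "b \<otimes> inv a \<in> U1 \<longleftrightarrow> a \<otimes> inv b \<in> U1"
      using sub_sym[OF Usec(3)] O O' by blast+
    show ?thesis
      using color_eq_iff[OF O' O 1] color_eq_iff[OF O'(2,1) O(2,1)] 1 2 by auto
  qed
  then have "t\<inverse> = s\<inverse> \<inter> {q. color q = color (b, a)}" unfolding s(2) by auto
  then show "t\<inverse> \<in> refined" using refinedI[OF s', of "(b, a)"] abs by simp
next
  fix r s t assume rst: "r \<in> refined" "s \<in> refined" "t \<in> refined"
  obtain a b where ab: "(a, b) \<in> t" using nonempty_basis(1)[OF refined_partition rst(3)] by auto
  have "card {\<gamma> \<in> V. (a', \<gamma>) \<in> r \<and> (\<gamma>, b') \<in> s} = card {\<gamma> \<in> V. (a, \<gamma>) \<in> r \<and> (\<gamma>, b) \<in> s}"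
    if ab': "(a', b') \<in> t" for a' b'
  proof -
    obtain u where u: "u \<in> S" "t = u \<inter> {q. color q = color (a, b)}" using refined_mem[OF rst(3) ab] .
    have uu: "(a, b) \<in> u" "(a', b') \<in> u" and color: "color (a, b) = color (a', b')" using ab ab' u(2) by auto
    have O: "a \<in> V" "b \<in> V" "a' \<in> V" "b' \<in> V" using basis_carrier[OF u(1)] uu by auto
    \<comment> \<open>Two pairs of one refined relation form a position of the restricted game, and
      its answering permutation matches the points counted by the intersection number.\<close>
    have bt: "([a, b], [a', b']) \<in> basis_tuples"
      unfolding basis_tuples_def tuples_def using O u(1) uu by auto
    have 01: "a \<otimes> inv b \<in> U1 \<longrightarrow> U0 #> (a \<otimes> inv a') = U0 #> (b \<otimes> inv b')"
      using color_eq_iff[OF O(1,2,3,4) scheme_group_cong[OF Usec(1) u(1) uu]] color by blast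
    have 10: "b \<otimes> inv a \<in> U1 \<longrightarrow> U0 #> (b \<otimes> inv b') = U0 #> (a \<otimes> inv a')"
      using 01 sub_sym[OF Usec(3) O(2,1)] by auto
    have "([a, b], [a', b']) \<in> shift_refinement 2 U1 U0 basis_tuples"
      unfolding shift_refinement_def using bt 01 10 by (auto simp: less_2_cases_iff)
    then obtain g where g: "bij_betw g V V"
      "\<And>\<alpha> i. \<alpha> \<in> V \<Longrightarrow> i < 2 \<Longrightarrow> ([a, b][i := \<alpha>], [a', b'][i := g \<alpha>]) \<in> shift_refinement 2 U1 U0 basis_tuples"
      using WL_forthE[OF refined_tuples_forth] by metis
    have "((a', g \<gamma>) \<in> r \<and> (g \<gamma>, b') \<in> s) \<longleftrightarrow> ((a, \<gamma>) \<in> r \<and> (\<gamma>, b) \<in> s)" if \<gamma>: "\<gamma> \<in> V" for \<gamma>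
      using refined_tuples_same[OF g(2)[OF \<gamma>, of 1] rst(1)] refined_tuples_same[OF g(2)[OF \<gamma>, of 0] rst(2)] by simp
    then have "bij_betw g {\<gamma> \<in> V. (a, \<gamma>) \<in> r \<and> (\<gamma>, b) \<in> s} {\<gamma> \<in> V. (a', \<gamma>) \<in> r \<and> (\<gamma>, b') \<in> s}"
      by (rule bij_betw_Collect[OF g(1)])
    from bij_betw_same_card[OF this] show ?thesis by simp
  qed
  then show "\<exists>c. \<forall>(\<alpha>, \<beta>)\<in>t. card {\<gamma> \<in> V. (\<alpha>, \<gamma>) \<in> r \<and> (\<gamma>, \<beta>) \<in> s} = c" by blast
next
  fix t assume t: "t \<in> refined"
  show "case p of (a, b) \<Rightarrow> \<forall>g\<in>V. (a \<otimes> g, b \<otimes> g) \<in> t" if p: "p \<in> t" for p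
  proof (cases p)
    case (Pair a b)
    obtain s where s: "s \<in> S" "t = s \<inter> {q. color q = color p}" using refined_mem[OF t p] .
    have "(a \<otimes> g, b \<otimes> g) \<in> t" if g: "g \<in> V" for g
    proof -
      have abs: "(a, b) \<in> s" using p s Pair by blast
      have O: "a \<in> V" "b \<in> V" using basis_carrier[OF s(1) abs] by auto
      have "a \<otimes> g \<otimes> inv (b \<otimes> g) = a \<otimes> inv b" using O g by (simp add: inv_mult m_ac comm_cancel)
      then have "color (a \<otimes> g, b \<otimes> g) = color p" unfolding Pair color_def by simp
      then show ?thesis using s(2) translate[OF s(1) abs g] by blast
    qed
    then show ?thesis using Pair by simp
  qed
qed

lemma refined_sec_regular: "circulant.sec_regular G refined (U1, U0)"
proof -
  interpret Rf: circulant G refined by unfold_locales (rule fin, rule refined_circulant)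
  show ?thesis
    unfolding Rf.sec_regular_def fst_conv snd_conv
  proof (intro ballI allI impI)
    fix t a b assume t: "t \<in> refined" "a \<in> U1" "(\<one>, a) \<in> t" "(\<one>, b) \<in> t"
    have O: "a \<in> V" "b \<in> V" using Rf.basis_carrier[OF t(1)] t(3,4) by auto
    obtain s where s: "s \<in> S" "t = s \<inter> {q. color q = color (\<one>, a)}" using refined_mem[OF t(1,3)] .
    have "color (\<one>, a) = color (\<one>, b)" using t s by auto
    moreover have "\<one> \<otimes> inv a \<in> U1" using subgroup.m_inv_closed[OF Usec(3) t(2)] O by simp
    ultimately have "U0 #> (inv a) = U0 #> (inv b)" unfolding color_def using O by (auto split: if_splits)
    then have "inv a \<otimes> inv (inv b) \<in> U0" using coset_eq_iff[OF Usec(4)] O by simp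
    then have "inv (inv a \<otimes> inv (inv b)) \<in> U0" using subgroup.m_inv_closed[OF Usec(4)] by blast
    then show "a \<otimes> inv b \<in> U0" using O by (simp add: inv_mult)
  qed
qed

text \<open>For a circulant scheme finer than \<open>S\<close>, regularity at the chosen section
  \<open>\<SS>\<close> is equivalent to regularity at \<open>U1/U0\<close>. So
  \<open>refined\<close> is one of the schemes among which the extension is least; conversely, a
  scheme regular at \<open>U1/U0\<close> separates the cosets of \<open>U0\<close> in
  \<open>U1\<close>, that is, the colors.\<close>

lemma extension_eq_refined:
  assumes C: "C \<in> sections G S // projective_equiv G S" "(U1, U0) \<in> C" "\<SS> \<in> C"
    and ext: "is_section_extension G S \<SS> T"
  shows "T = refined"
proof -
  obtain U L where UL: "\<SS> = (U, L)" by (cases \<SS>)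
  have reg: "regularizes_section G S \<SS> T" and least: "\<And>T'. regularizes_section G S \<SS> T' \<Longrightarrow> coarser T T'"
    using ext unfolding is_section_extension_def by auto
  have T: "circulant_scheme G T" "coarser S T"
    and Treg: "regular_scheme (section_points G \<SS>) (section_scheme G T \<SS>)"
    using reg unfolding regularizes_section_def by auto
  have secS: "(U, L) \<in> sections G S"
    using projective_class_invariant(1)[OF C(1,3,3), of "\<lambda>_. True"] UL by simp
  interpret Rf: circulant G refined by unfold_locales (rule fin, rule refined_circulant)
  interpret T: circulant G T by unfold_locales (rule fin, rule T)
  \<comment> \<open>Projective equivalence refers to sections of \<open>S\<close>; these remain
    sections of every finer scheme.\<close>
  have invR: "Rf.sec_regular \<SS> \<longleftrightarrow> Rf.sec_regular (U1, U0)"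
  proof (rule projective_class_invariant(2)[OF C(1,3,2)])
    fix \<AA> \<BB> assume "\<AA> \<in> sections G S" "\<BB> \<in> sections G S" "multiple_of G \<AA> \<BB>"
    then show "Rf.sec_regular \<AA> \<longleftrightarrow> Rf.sec_regular \<BB>"
      using Rf.sec_regular_multiple sections_coarser[OF refined_coarser] by (cases \<AA>; cases \<BB>) blast
  qed
  have invT: "T.sec_regular \<SS> \<longleftrightarrow> T.sec_regular (U1, U0)"
  proof (rule projective_class_invariant(2)[OF C(1,3,2)])
    fix \<AA> \<BB> assume "\<AA> \<in> sections G S" "\<BB> \<in> sections G S" "multiple_of G \<AA> \<BB>"
    then show "T.sec_regular \<AA> \<longleftrightarrow> T.sec_regular \<BB>"
      using T.sec_regular_multiple sections_coarser[OF T(2)] by (cases \<AA>; cases \<BB>) blast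
  qed
  have "regular_scheme (section_points G \<SS>) (section_scheme G refined \<SS>)"
    using Rf.sec_regular_iff[of U L] invR refined_sec_regular secS sections_coarser[OF refined_coarser, of G] UL by blast
  then have "coarser T refined"
    using least refined_circulant refined_coarser unfolding regularizes_section_def by blast
  moreover have "coarser refined T"
    unfolding coarser_def
  proof
    fix t assume t: "t \<in> refined"
    have "T.sec_regular (U, L)"
      using T.sec_regular_iff[of U L] Treg secS sections_coarser[OF T(2), of G] UL by blast
    then have Tr: "T.sec_regular (U1, U0)" using invT UL by simp
    have U1T: "scheme_group G T U1" using scheme_group_coarser[OF T(2) Usec(1)] .
    show "union_of_basis T t"
      unfolding union_of_basis_iff[OF T.part]
    proof (intro conjI ballI impI)
      show "t \<subseteq> V \<times> V" using nonempty_basis(2)[OF refined_partition t] .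
      fix r assume r: "r \<in> T" "r \<inter> t \<noteq> {}"
      then obtain a b where ab: "(a, b) \<in> r" "(a, b) \<in> t" by auto
      obtain s where s: "s \<in> S" "t = s \<inter> {q. color q = color (a, b)}" using refined_mem[OF t ab(2)] .
      have sT: "union_of_basis T s" using T(2) s(1) unfolding coarser_def by blast
      have O: "a \<in> V" "b \<in> V" using T.basis_carrier[OF r(1) ab(1)] by auto
      show "r \<subseteq> t"
      proof (rule subrelI)
        fix c d assume cd: "(c, d) \<in> r"
        have O': "c \<in> V" "d \<in> V" using T.basis_carrier[OF r(1) cd] by auto
        have "(c, d) \<in> s" using T.union_of_basis_closed[OF sT r(1) ab(1) cd] ab(2) s(2) by blast
        moreover have "color (c, d) = color (a, b)"
        proof (cases "a \<otimes> inv b \<in> U1")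
          case True
          then have cd1: "c \<otimes> inv d \<in> U1" using T.scheme_group_cong[OF U1T r(1) ab(1) cd] by simp
          have "b \<otimes> inv a \<in> U1" using sub_sym[OF Usec(3) O True] .
          moreover have "(\<one>, b \<otimes> inv a) \<in> r" "(\<one>, d \<otimes> inv c) \<in> r"
            using T.translate_iff[OF r(1) O] T.translate_iff[OF r(1) O'] ab(1) cd by blast+
          ultimately have "b \<otimes> inv a \<otimes> inv (d \<otimes> inv c) \<in> U0"
            using Tr r(1) unfolding T.sec_regular_def by auto
          moreover have "b \<otimes> inv a \<otimes> inv (d \<otimes> inv c) = c \<otimes> inv d \<otimes> inv (a \<otimes> inv b)"
            using O O' by (simp add: inv_mult m_ac)
          ultimately have "U0 #> (c \<otimes> inv d) = U0 #> (a \<otimes> inv b)" using coset_eq_iff[OF Usec(4)] O O' by simp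
          then show ?thesis unfolding color_def using True cd1 by simp
        next
          case False
          then have "c \<otimes> inv d \<notin> U1" using T.scheme_group_cong[OF U1T r(1) ab(1) cd] by simp
          then show ?thesis unfolding color_def using False by simp
        qed
        ultimately show "(c, d) \<in> t" using s(2) by blast
      qed
    qed
  qed
  ultimately show ?thesis using coarser_antisym[OF T.part refined_partition] by blast
qed

lemma refined_self_equivalent:
  assumes cyc: "cyclic_group G" and m: "m \<ge> 2" and bij: "bij_betw \<phi> S S"
    and WL: "WL_self_equivalent m V S \<phi>"
  shows "\<exists>\<psi>. algebraic_automorphism V refined \<psi> \<and> extends_automorphism S \<phi> refined \<psi> \<and>
    WL_self_equivalent m V refined \<psi>"
proof (rule WL_self_equivalent_imp_forth[OF fin _ m part bij WL])
  show "V \<noteq> {}" using one_closed by blast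
  fix R assume R: "WL_forth m V R" "WL_compatible m S \<phi> R" "R \<noteq> {}"
    and R_coord: "\<And>x y \<sigma>. (x, y) \<in> R \<Longrightarrow> \<sigma> \<in> {..<m} \<rightarrow> {..<m} \<Longrightarrow>
       (coordinate_map m \<sigma> x, coordinate_map m \<sigma> y) \<in> R"
    and R_difun: "\<And>x y x' y'. (x, y) \<in> R \<Longrightarrow> (x', y) \<in> R \<Longrightarrow> (x', y') \<in> R \<Longrightarrow> (x, y') \<in> R"
    and R_stable: "\<And>x x' y y'. (x, x') \<in> WL_stable m V S \<Longrightarrow> (x', y') \<in> R \<Longrightarrow>
       (y', y) \<in> WL_stable m V S \<Longrightarrow> (x, y) \<in> R"
  note RT = WL_forth_subset[OF R(1)]
  note pres = scheme_group_preserved[OF cyc m bij R]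
  have R_aut: "(map k x, y) \<in> R \<and> (x, map k y) \<in> R"
    if xy: "(x, y) \<in> R" and k: "bij_betw k V V"
      "\<And>s a b. s \<in> S \<Longrightarrow> a \<in> V \<Longrightarrow> b \<in> V \<Longrightarrow> (k a, k b) \<in> s \<longleftrightarrow> (a, b) \<in> s" for k x y
  proof -
    have T: "x \<in> tuples m V" "y \<in> tuples m V" using RT[OF xy] by auto
    \<comment> \<open>The image of a tuple under an automorphism has the same stable color, and
      \<open>R\<close> is saturated under the stable coloring.\<close>
    have kx: "(x, map k x) \<in> WL_stable m V S" and ky: "(y, map k y) \<in> WL_stable m V S"
      using WL_stable_automorphism[OF fin k] T by blast+
    have rx: "(x, x) \<in> WL_stable m V S" and ry: "(y, y) \<in> WL_stable m V S"
      using equiv_class_self[OF equiv_WL_stable] T by blast+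
    show ?thesis using R_stable[OF equiv_WL_stable_sym[OF kx] xy ry] R_stable[OF rx xy ky] by blast
  qed
  define Q where "Q = shift_refinement m U1 U0 R"
  have Q_sub: "(x, y) \<in> R" if "(x, y) \<in> Q" for x y using that unfolding Q_def shift_refinement_def by auto
  have Q_forth: "WL_forth m V Q"
    unfolding Q_def
    by (rule shift_refinement_forth[OF fin m Usec(4,3,5) R(1) pres[OF Usec(1)] pres[OF Usec(2)] R_difun
          swap_tuples[OF R_aut]])
  \<comment> \<open>A constant tuple is answered by a constant tuple, for which all shifts
    coincide.\<close>
  have Q_ne: "Q \<noteq> {}"
  proof -
    have x: "replicate m \<one> \<in> tuples m V" unfolding tuples_def by auto
    obtain y where y: "(replicate m \<one>, y) \<in> R" using WL_forth_total[OF R(1,3) x] .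
    have "y ! i = y ! j" if "i < m" "j < m" for i j
      using WL_compatibleD(1)[OF R(2) y that] that by simp
    then have "U0 #> (replicate m \<one> ! i \<otimes> inv (y ! i)) = U0 #> (replicate m \<one> ! j \<otimes> inv (y ! j))"
      if "i < m" "j < m" for i j using that by (metis nth_replicate)
    then have "(replicate m \<one>, y) \<in> Q" unfolding Q_def shift_refinement_def using y by blast
    then show ?thesis by blast
  qed
  have Q_coord: "(coordinate_map m \<sigma> x, coordinate_map m \<sigma> y) \<in> Q"
    if xy: "(x, y) \<in> Q" and s: "\<sigma> \<in> {..<m} \<rightarrow> {..<m}" for x y \<sigma>
  proof -
    have "\<sigma> i < m" if "i < m" for i using s that by auto
    then show ?thesis using xy R_coord[OF Q_sub[OF xy] s] unfolding Q_def shift_refinement_def by simp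
  qed
  have Q_col: "color (x ! i, x ! j) = color (y ! i, y ! j)" if "(x, y) \<in> Q" "i < m" "j < m" for x y i j
    using shift_refinement_col[OF R(1) that[unfolded Q_def] pres[OF Usec(1) Q_sub[OF that(1)] that(2,3)]] .
  \<comment> \<open>\<open>\<phi>\<close> acts on the relation of \<open>S\<close> containing
    \<open>t\<close>, while the color of \<open>t\<close>, a single value, is kept.\<close>
  define \<psi> where "\<psi> t = \<phi> (THE s. s \<in> S \<and> t \<subseteq> s) \<inter> {q. color q \<in> color ` t}" for t
  have psi: "\<psi> t = \<phi> s \<inter> {q. color q = color p}" if s: "s \<in> S" "p \<in> s" "t = s \<inter> {q. color q = color p}" for t s p
  proof -
    have "p \<in> t" using s by simp
    then have "(THE s. s \<in> S \<and> t \<subseteq> s) = s"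
      using s basis_eq by (intro the_equality) blast+
    moreover have "color ` t = {color p}" using \<open>p \<in> t\<close> s(3) by auto
    ultimately show ?thesis unfolding \<psi>_def by simp
  qed
  have Q_compat: "WL_compatible m refined \<psi> Q"
  proof -
    have "(x ! i = x ! j \<longleftrightarrow> y ! i = y ! j) \<and> (\<forall>t\<in>refined. (x ! i, x ! j) \<in> t \<longleftrightarrow> (y ! i, y ! j) \<in> \<psi> t)"
      if xy: "(x, y) \<in> Q" "i < m" "j < m" for x y i j
    proof (intro conjI ballI)
      show "x ! i = x ! j \<longleftrightarrow> y ! i = y ! j" using WL_compatibleD(1)[OF R(2) Q_sub[OF xy(1)] xy(2,3)] .
      fix t assume t: "t \<in> refined"
      obtain p where p: "p \<in> t" using nonempty_basis(1)[OF refined_partition t] by blast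
      obtain s where s: "s \<in> S" "t = s \<inter> {q. color q = color p}" using refined_mem[OF t p] .
      have ps: "p \<in> s" using p s(2) by blast
      show "(x ! i, x ! j) \<in> t \<longleftrightarrow> (y ! i, y ! j) \<in> \<psi> t"
        unfolding psi[OF s(1) ps s(2)]
        using Q_col[OF xy] WL_compatibleD(2)[OF R(2) Q_sub[OF xy(1)] xy(2,3) s(1)] s(2) by auto
    qed
    then show ?thesis unfolding WL_compatible_def by blast
  qed
  have m01: "0 < m" "1 < m" using m by auto
  note comp01 = WL_compatibleD(2)[OF Q_compat _ m01]
  have obt: "\<exists>x y. (x, y) \<in> Q \<and> (x ! 0, x ! 1) \<in> t" if t: "t \<in> refined" for t
  proof -
    obtain a b where ab: "(a, b) \<in> t" using nonempty_basis(1)[OF refined_partition t] by auto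
    then have O: "a \<in> V" "b \<in> V" using nonempty_basis(2)[OF refined_partition t] by auto
    obtain x where x: "x \<in> tuples m V" "x ! 0 = a" "x ! 1 = b" using pair_tuple[OF O m] .
    obtain y where "(x, y) \<in> Q" using WL_forth_total[OF Q_forth Q_ne x(1)] .
    then show ?thesis using x ab by blast
  qed
  \<comment> \<open>That \<open>\<phi> s\<close> contains a pair of the color of \<open>t\<close> is
    provided by a position of the game.\<close>
  have psi_in: "\<psi> t \<in> refined" if t: "t \<in> refined" for t
  proof -
    obtain x y where xy: "(x, y) \<in> Q" "(x ! 0, x ! 1) \<in> t" using obt[OF t] by blast
    obtain s where s: "s \<in> S" "t = s \<inter> {q. color q = color (x ! 0, x ! 1)}" using refined_mem[OF t xy(2)] .
    have y: "(y ! 0, y ! 1) \<in> \<psi> t" using comp01[OF xy(1) t] xy(2) by simp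
    have psi_t: "\<psi> t = \<phi> s \<inter> {q. color q = color (x ! 0, x ! 1)}" using psi[OF s(1) _ s(2)] xy(2) s(2) by blast
    then have "color (y ! 0, y ! 1) = color (x ! 0, x ! 1)" "(y ! 0, y ! 1) \<in> \<phi> s" using y by auto
    then show ?thesis using refinedI[OF bij_betw_apply[OF bij s(1)]] psi_t by metis
  qed
  have psi_inj: "inj_on \<psi> refined"
  proof (rule inj_onI)
    fix t t' assume t: "t \<in> refined" "t' \<in> refined" "\<psi> t = \<psi> t'"
    obtain x y where xy: "(x, y) \<in> Q" "(x ! 0, x ! 1) \<in> t" using obt[OF t(1)] by blast
    have "(x ! 0, x ! 1) \<in> t'" using comp01[OF xy(1) t(1)] comp01[OF xy(1) t(2)] xy(2) t(3) by simp
    then show "t = t'" using partition_on_member_eq[OF refined_partition t(1,2) xy(2)] by blast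
  qed
  have "refined \<subseteq> Pow (V \<times> V)" using nonempty_basis(2)[OF refined_partition] by blast
  then have "finite refined" using fin by (meson finite_Pow_iff finite_SigmaI finite_subset)
  then have psi_bij: "bij_betw \<psi> refined refined"
    using psi_inj psi_in by (intro bij_betw_imageI endo_inj_surj) auto
  have "extend_to_unions refined \<psi> s = \<phi> s" if s: "s \<in> S" for s
    unfolding extend_to_unions_def
  proof
    show "\<Union> (\<psi> ` {t \<in> refined. t \<subseteq> s}) \<subseteq> \<phi> s"
    proof (rule UN_least)
      fix t assume "t \<in> {t \<in> refined. t \<subseteq> s}"
      then have t: "t \<in> refined" "t \<subseteq> s" by auto
      obtain p where p: "p \<in> t" using nonempty_basis(1)[OF refined_partition t(1)] by blast
      obtain s' where s': "s' \<in> S" "t = s' \<inter> {q. color q = color p}" using refined_mem[OF t(1) p] .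
      have "s' = s" using basis_eq[OF s'(1) s, of p] p s'(2) t(2) by blast
      then show "\<psi> t \<subseteq> \<phi> s" using psi[OF s'(1) _ s'(2)] p s'(2) by blast
    qed
    show "\<phi> s \<subseteq> \<Union> (\<psi> ` {t \<in> refined. t \<subseteq> s})"
    proof (rule subrelI)
      fix a b assume ab: "(a, b) \<in> \<phi> s"
      then have O: "a \<in> V" "b \<in> V" using basis_carrier[OF bij_betw_apply[OF bij s]] by auto
      obtain y where y: "y \<in> tuples m V" "y ! 0 = a" "y ! 1 = b" using pair_tuple[OF O m] .
      obtain x where x: "(x, y) \<in> Q" using WL_forth_surj[OF Q_forth Q_ne y(1)] .
      have xs: "(x ! 0, x ! 1) \<in> s" using WL_compatibleD(2)[OF R(2) Q_sub[OF x] m01 s] ab y by simp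
      define t where "t = s \<inter> {q. color q = color (x ! 0, x ! 1)}"
      have t: "t \<in> refined" unfolding t_def using refinedI[OF s xs] .
      have "(x ! 0, x ! 1) \<in> t" unfolding t_def using xs by simp
      then have "(a, b) \<in> \<psi> t" using comp01[OF x t] y by simp
      moreover have "t \<subseteq> s" unfolding t_def by blast
      ultimately show "(a, b) \<in> \<Union> (\<psi> ` {t \<in> refined. t \<subseteq> s})" using t by blast
    qed
  qed
  then have "extends_automorphism S \<phi> refined \<psi>" unfolding extends_automorphism_def by simp
  moreover have "coherent_configuration V refined" using refined_circulant unfolding circulant_scheme_def by simp
  then have "algebraic_automorphism V refined \<psi>"
    using algebraic_automorphism_of_forth[OF _ m psi_bij Q_forth Q_compat Q_ne] by blast
  moreover have "WL_self_equivalent m V refined \<psi>"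
    using WL_self_equivalentI[OF fin m refined_partition psi_bij Q_forth Q_compat Q_ne Q_coord] by blast
  ultimately show ?thesis by blast
qed

end

theorem theorem5p4:
  fixes G :: "('a, 'b) monoid_scheme"
    and \<X> \<X>\<^sub>s :: "('a \<times> 'a) set set"
    and \<phi> :: "('a \<times> 'a) set \<Rightarrow> ('a \<times> 'a) set"
    and m :: nat
  assumes "group G" and "cyclic_group G" and "finite (carrier G)"
    and "circulant_scheme G \<X>"
    and "singular_extension G \<X> \<X>\<^sub>s"
    and "algebraic_automorphism (carrier G) \<X> \<phi>"
    and "m \<ge> 2"
    and "WL_self_equivalent m (carrier G) \<X> \<phi>"
  shows "\<exists>\<phi>\<^sub>s. algebraic_automorphism (carrier G) \<X>\<^sub>s \<phi>\<^sub>s \<and>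
              extends_automorphism \<X> \<phi> \<X>\<^sub>s \<phi>\<^sub>s \<and>
              WL_self_equivalent m (carrier G) \<X>\<^sub>s \<phi>\<^sub>s"
proof -
  interpret comm_group G using group.cyclic_imp_abelian_group[OF assms(1,2)] .
  interpret circulant G \<X> by unfold_locales (rule assms(3), rule assms(4))
  obtain C \<SS> where C: "singular_class G \<X> C" "\<SS> \<in> C" "is_section_extension G \<X> \<SS> \<X>\<^sub>s"
    using assms(5) unfolding singular_extension_def by blast
  have Cq: "C \<in> sections G \<X> // projective_equiv G \<X>" and Ct: "\<exists>\<TT>\<in>C. trivial_section G \<X> \<TT>"
    using C(1) unfolding singular_class_def by auto
  obtain L0 L1 U0 U1 where sg: "(L1, L0) \<in> C" "(U1, U0) \<in> C" "multiple_of G (U1, U0) (L1, L0)"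
    "section_condition G \<X> U0 L0" "section_condition G \<X> U1 L1"
    "section_scheme G \<X> (U1, L0) =
       internal_tensor G (section_scheme G \<X> (L1, L0)) (section_scheme G \<X> (U0, L0))"
    using C(1) unfolding singular_class_def by (elim conjE exE)
  have sec: "\<TT> \<in> sections G \<X>" if "\<TT> \<in> C" for \<TT>
    using projective_class_invariant(1)[OF Cq that that, of "\<lambda>_. True"] by simp
  obtain \<TT> where T: "\<TT> \<in> C" "trivial_section G \<X> \<TT>" using Ct by blast
  have "sec_trivial \<TT>" using trivial_section_imp sec[OF T(1)] T(2) by (cases \<TT>) blast
  moreover have "sec_trivial \<TT> \<longleftrightarrow> sec_trivial (L1, L0)"
  proof (rule projective_class_invariant(2)[OF Cq T(1) sg(1)])
    fix \<AA> \<BB> assume "\<AA> \<in> sections G \<X>" "\<BB> \<in> sections G \<X>" "multiple_of G \<AA> \<BB>"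
    then show "sec_trivial \<AA> \<longleftrightarrow> sec_trivial \<BB>"
      using sec_trivial_multiple by (cases \<AA>; cases \<BB>) blast
  qed
  ultimately interpret singular G \<X> U1 U0 L1 L0
    using sg sec by unfold_locales auto
  have "\<X>\<^sub>s = refined" using extension_eq_refined[OF Cq sg(2) C(2,3)] .
  moreover have "bij_betw \<phi> \<X> \<X>" using assms(6) unfolding algebraic_automorphism_def by simp
  ultimately show ?thesis using refined_self_equivalent[OF assms(2,7) _ assms(8)] by simp
qed

end
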